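(* Let $\varphi$ be a $G_2$-structure on a smooth 7-manifold $M$ with full torsion tensor $T_{lm}$ and associated metric $g$. Then the Ricci curvature $R_{jk}$ of $g$ is given by $$R_{jk} = (\nabla_i T_{jm} - \nabla_j T_{im})\,\varphi_{nkl}\,g^{mn}g^{il} - T_{jl}g^{li}T_{ik} + \mathrm{Tr}_g(T)\,T_{jk} - T_{jb}T_{ia}\,g^{il}g^{ap}\psi_{lpqk}\,g^{bq}.$$ This can also be written in the form $$R_{jk} = \nabla_i\big(T_{jm}\varphi_{nkl}g^{mn}g^{il}\big) - \nabla_j\big(T_{im}\varphi_{nkl}g^{mn}g^{il}\big) - T_{jl}g^{li}T_{ik} + \mathrm{Tr}_g(T)\,T_{jk} + T_{jb}T_{ia}\,g^{il}g^{ap}\psi_{lpqk}\,g^{bq}.$$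
   Context: Index notation in local coordinates $x^1,\dots,x^7$, with the summation convention; forms are written $\alpha=\frac{1}{k!}\alpha_{i_1\cdots i_k}dx^{i_1}\wedge\cdots\wedge dx^{i_k}$. A $G_2$-structure on a smooth 7-manifold $M$ is a smooth 3-form $\varphi$ which at each point is equivalent, under a linear isomorphism $T_xM\cong\mathbb{R}^7$, to $e^{123}+e^{145}+e^{167}+e^{246}-e^{257}-e^{347}-e^{356}$. It determines a unique Riemannian metric $g$ and orientation (volume form $\mathsf{vol}$) by the convention $(u\lrcorner\varphi)\wedge(v\lrcorner\varphi)\wedge\varphi=-6\,g(u,v)\,\mathsf{vol}$. Let $\psi=*\varphi$ (Hodge star) and $\nabla$ the Levi-Civita connection of $g$. The full torsion tensor $T_{lm}$ is the (unique) 2-tensor with $\nabla_l\varphi_{abc}=T_{lm}g^{mn}\psi_{nabc}$, and $\mathrm{Tr}_g(T)=g^{ij}T_{ij}$. Curvature convention: $R^m_{ijk}\frac{\partial}{\partial x^m}=(\nabla_i\nabla_j-\nabla_j\nabla_i)\frac{\partial}{\partial x^k}$, $R_{ijkl}=R^m_{ijk}g_{ml}$, and $R_{jk}=R_{ijkl}g^{il}$ (so the round sphere has positive Ricci curvature). *)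

theory Defs
  imports "HOL-Analysis.Analysis" "HOL-Combinatorics.Combinatorics"
begin

section \<open>Smooth manifolds\<close>

definition partial :: "'n \<Rightarrow> (real ^ 'n \<Rightarrow> real) \<Rightarrow> real ^ 'n \<Rightarrow> real" where
  "partial i f x = frechet_derivative f (at x) (axis i 1)"

fun iter_partial :: "'n list \<Rightarrow> (real ^ 'n \<Rightarrow> real) \<Rightarrow> real ^ 'n \<Rightarrow> real" where
  "iter_partial [] f = f"
| "iter_partial (i # is) f = partial i (iter_partial is f)"

text \<open>On an open set this is the usual class of infinitely differentiable functions:
  all iterated partial derivatives exist and are differentiable, hence continuous.\<close>
definition smooth_on :: "(real ^ 'n) set \<Rightarrow> (real ^ 'n \<Rightarrow> real) \<Rightarrow> bool" where
  "smooth_on S f \<longleftrightarrow> (\<forall>is. \<forall>x\<in>S. iter_partial is f differentiable (at x))"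

type_synonym ('a, 'n) chart = "'a set \<times> ('a \<Rightarrow> real ^ 'n)"

abbreviation chart_image :: "('a, 'n) chart \<Rightarrow> (real ^ 'n) set" where
  "chart_image ch \<equiv> snd ch ` fst ch"

definition transition :: "('a, 'n) chart \<Rightarrow> ('a, 'n) chart \<Rightarrow> real ^ 'n \<Rightarrow> real ^ 'n" where
  "transition ch ch' x = snd ch' (inv_into (fst ch) (snd ch) x)"

text \<open>The atlas need not be maximal (and may be taken to be).\<close>
definition smooth_manifold :: "'a topology \<Rightarrow> ('a, 'n::finite) chart set \<Rightarrow> bool" where
  "smooth_manifold M A \<longleftrightarrow>
     Hausdorff_space M \<and> second_countable M \<and>
     topspace M = (\<Union>ch\<in>A. fst ch) \<and>
     (\<forall>ch\<in>A. openin M (fst ch) \<and> open (chart_image ch) \<and>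
        homeomorphic_map (subtopology M (fst ch)) (top_of_set (chart_image ch)) (snd ch)) \<and>
     (\<forall>ch\<in>A. \<forall>ch'\<in>A. \<forall>a.
        smooth_on (snd ch ` (fst ch \<inter> fst ch')) (\<lambda>x. transition ch ch' x $ a))"

section \<open>Tensor fields in local coordinates\<close>

text \<open>Inside one chart, a tensor field of type \<open>(r, s)\<close> is given by its components: the point is
  the vector of coordinates, the first list holds the \<open>r\<close> upper indices and the second the \<open>s\<close>
  lower ones. Values at lists of other lengths are irrelevant.\<close>
type_synonym 'n tfield = "real ^ 'n \<Rightarrow> 'n list \<Rightarrow> 'n list \<Rightarrow> real"

text \<open>\<open>\<partial>y\<^sup>a/\<partial>x\<^sup>b\<close>, where \<open>x\<close>, \<open>y\<close> are the coordinates of the charts \<open>ch\<close>, \<open>ch'\<close>\<close>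
definition jac :: "('a, 'n) chart \<Rightarrow> ('a, 'n) chart \<Rightarrow> real ^ 'n \<Rightarrow> 'n \<Rightarrow> 'n \<Rightarrow> real" where
  "jac ch ch' x a b = partial b (\<lambda>z. transition ch ch' z $ a) x"

text \<open>A smooth tensor field on the manifold: smooth components in every chart, related by the
  tensor transformation law on overlaps.\<close>
definition tensor_field ::
  "('a, 'n::finite) chart set \<Rightarrow> nat \<Rightarrow> nat \<Rightarrow> (('a, 'n) chart \<Rightarrow> 'n tfield) \<Rightarrow> bool" where
  "tensor_field A r s \<Phi> \<longleftrightarrow>
     (\<forall>ch\<in>A. \<forall>us ls. length us = r \<longrightarrow> length ls = s \<longrightarrow>
        smooth_on (chart_image ch) (\<lambda>x. \<Phi> ch x us ls)) \<and>
     (\<forall>ch\<in>A. \<forall>ch'\<in>A. \<forall>p \<in> fst ch \<inter> fst ch'. \<forall>us ls. length us = r \<longrightarrow> length ls = s \<longrightarrow>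
        \<Phi> ch' (snd ch' p) us ls =
          (\<Sum>us' | length us' = r. \<Sum>ls' | length ls' = s.
             (\<Prod>k<r. jac ch ch' (snd ch p) (us ! k) (us' ! k)) *
             (\<Prod>k<s. jac ch' ch (snd ch' p) (ls' ! k) (ls ! k)) *
             \<Phi> ch (snd ch p) us' ls'))"

section \<open>Exterior algebra at a point\<close>

text \<open>A \<open>k\<close>-form at a point is given by its components \<open>\<alpha> [i\<^sub>1, \<dots>, i\<^sub>k]\<close>, normalised by
  \<open>\<alpha> = 1/k! \<alpha>\<^bsub>i\<^sub>1\<dots>i\<^sub>k\<^esub> dx\<^bsup>i\<^sub>1\<^esup> \<and> \<dots> \<and> dx\<^bsup>i\<^sub>k\<^esup>\<close>.\<close>
definition alternating :: "nat \<Rightarrow> ('n list \<Rightarrow> real) \<Rightarrow> bool" where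
  "alternating k \<alpha> \<longleftrightarrow>
     (\<forall>is \<sigma>. length is = k \<longrightarrow> \<sigma> permutes {..<k} \<longrightarrow>
        \<alpha> (permute_list \<sigma> is) = of_int (sign \<sigma>) * \<alpha> is)"

definition diff_form ::
  "('a, 'n::finite) chart set \<Rightarrow> nat \<Rightarrow> (('a, 'n) chart \<Rightarrow> 'n tfield) \<Rightarrow> bool" where
  "diff_form A k \<Phi> \<longleftrightarrow> tensor_field A 0 k \<Phi> \<and>
     (\<forall>ch\<in>A. \<forall>x\<in>chart_image ch. alternating k (\<Phi> ch x []))"

definition wedge :: "nat \<Rightarrow> nat \<Rightarrow> ('n list \<Rightarrow> real) \<Rightarrow> ('n list \<Rightarrow> real) \<Rightarrow> 'n list \<Rightarrow> real" where
  "wedge k l \<alpha> \<beta> is =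
     (\<Sum>\<sigma> | \<sigma> permutes {..<k + l}.
        of_int (sign \<sigma>) * \<alpha> (take k (permute_list \<sigma> is)) * \<beta> (drop k (permute_list \<sigma> is)))
     / (fact k * fact l)"

definition interior_prod :: "real ^ 'n \<Rightarrow> ('n::finite list \<Rightarrow> real) \<Rightarrow> 'n list \<Rightarrow> real" where
  "interior_prod u \<alpha> is = (\<Sum>i\<in>UNIV. u $ i * \<alpha> (i # is))"

text \<open>the components of \<open>e\<^bsup>i\<^sub>1\<^esup> \<and> \<dots> \<and> e\<^bsup>i\<^sub>k\<^esup>\<close> for \<open>is = [i\<^sub>1, \<dots>, i\<^sub>k]\<close>\<close>
definition basis_form :: "'n list \<Rightarrow> 'n list \<Rightarrow> real" where
  "basis_form is js =
     (\<Sum>\<sigma> | \<sigma> permutes {..<length is}. if permute_list \<sigma> is = js then of_int (sign \<sigma>) else 0)"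

section \<open>Riemannian geometry in a chart\<close>

definition metric_matrix :: "'n tfield \<Rightarrow> real ^ 'n \<Rightarrow> real ^ 'n ^ 'n" where
  "metric_matrix g x = (\<chi> i j. g x [] [i, j])"

definition ginv :: "'n::finite tfield \<Rightarrow> real ^ 'n \<Rightarrow> 'n \<Rightarrow> 'n \<Rightarrow> real" where
  "ginv g x i j = matrix_inv (metric_matrix g x) $ i $ j"

definition riemannian_metric ::
  "('a, 'n::finite) chart set \<Rightarrow> (('a, 'n) chart \<Rightarrow> 'n tfield) \<Rightarrow> bool" where
  "riemannian_metric A g \<longleftrightarrow> tensor_field A 0 2 g \<and>
     (\<forall>ch\<in>A. \<forall>x\<in>chart_image ch.
        (\<forall>i j. g ch x [] [i, j] = g ch x [] [j, i]) \<and>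
        (\<forall>v. v \<noteq> 0 \<longrightarrow> v \<bullet> (metric_matrix (g ch) x *v v) > 0))"

text \<open>\<open>\<Gamma>\<^sup>k\<^sub>i\<^sub>j\<close> of the Levi-Civita connection; it is torsion-free and metric, and the only such
  connection, by the lemmas at the end of this section.\<close>
definition christoffel :: "'n::finite tfield \<Rightarrow> real ^ 'n \<Rightarrow> 'n \<Rightarrow> 'n \<Rightarrow> 'n \<Rightarrow> real" where
  "christoffel g x k i j =
     (\<Sum>l\<in>UNIV. ginv g x k l *
        (partial i (\<lambda>y. g y [] [j, l]) x + partial j (\<lambda>y. g y [] [i, l]) x
         - partial l (\<lambda>y. g y [] [i, j]) x)) / 2"

text \<open>The covariant derivative \<open>\<nabla>\<^sub>i B\<close> along the \<open>i\<close>-th coordinate vector field, again a tensor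
  field (in this chart) of the same type as \<open>B\<close>.\<close>
definition nabla :: "'n::finite tfield \<Rightarrow> 'n \<Rightarrow> 'n tfield \<Rightarrow> 'n tfield" where
  "nabla g i B x us ls =
     partial i (\<lambda>y. B y us ls) x
     + (\<Sum>r<length us. \<Sum>p\<in>UNIV. christoffel g x (us ! r) i p * B x (us[r := p]) ls)
     - (\<Sum>r<length ls. \<Sum>p\<in>UNIV. christoffel g x p i (ls ! r) * B x us (ls[r := p]))"

definition coord_field :: "'n \<Rightarrow> 'n tfield" where
  "coord_field k x us ls = (if us = [k] then 1 else 0)"

text \<open>\<open>R\<^sup>m\<^sub>i\<^sub>j\<^sub>k \<partial>\<^sub>m = (\<nabla>\<^sub>i\<nabla>\<^sub>j - \<nabla>\<^sub>j\<nabla>\<^sub>i) \<partial>\<^sub>k\<close>\<close>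
definition riemann_up :: "'n::finite tfield \<Rightarrow> real ^ 'n \<Rightarrow> 'n \<Rightarrow> 'n \<Rightarrow> 'n \<Rightarrow> 'n \<Rightarrow> real" where
  "riemann_up g x m i j k =
     nabla g i (nabla g j (coord_field k)) x [m] [] - nabla g j (nabla g i (coord_field k)) x [m] []"

definition riemann :: "'n::finite tfield \<Rightarrow> real ^ 'n \<Rightarrow> 'n \<Rightarrow> 'n \<Rightarrow> 'n \<Rightarrow> 'n \<Rightarrow> real" where
  "riemann g x i j k l = (\<Sum>m\<in>UNIV. riemann_up g x m i j k * g x [] [m, l])"

definition ricci :: "'n::finite tfield \<Rightarrow> real ^ 'n \<Rightarrow> 'n \<Rightarrow> 'n \<Rightarrow> real" where
  "ricci g x j k = (\<Sum>i\<in>UNIV. \<Sum>l\<in>UNIV. riemann g x i j k l * ginv g x i l)"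

definition trace :: "'n::finite tfield \<Rightarrow> 'n tfield \<Rightarrow> real ^ 'n \<Rightarrow> real" where
  "trace g B x = (\<Sum>i\<in>UNIV. \<Sum>j\<in>UNIV. ginv g x i j * B x [] [i, j])"

text \<open>The Hodge star of a \<open>k\<close>-form:
  \<open>(*\<alpha>)\<^sub>J = 1/k! \<alpha>\<^bsub>i\<^sub>1\<dots>i\<^sub>k\<^esub> g\<^bsup>i\<^sub>1m\<^sub>1\<^esup> \<dots> g\<^bsup>i\<^sub>km\<^sub>k\<^esup> vol\<^bsub>m\<^sub>1\<dots>m\<^sub>k J\<^esub>\<close>,
  so that \<open>\<alpha> \<and> *\<beta> = g(\<alpha>, \<beta>) vol\<close>.\<close>
definition hodge_star :: "nat \<Rightarrow> 'n::finite tfield \<Rightarrow> 'n tfield \<Rightarrow> 'n tfield \<Rightarrow> 'n tfield" where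
  "hodge_star k g vol \<alpha> x us js =
     (\<Sum>is | length is = k. \<Sum>ms | length ms = k.
        \<alpha> x [] is * (\<Prod>r<k. ginv g x (is ! r) (ms ! r)) * vol x [] (ms @ js)) / fact k"

lemma matrix_inv_mult:
  fixes B :: "real ^ 'n ^ 'n::finite"
  assumes "invertible B"
  shows matrix_inv_right: "B ** matrix_inv B = mat 1"
    and matrix_inv_left: "matrix_inv B ** B = mat 1"
  using assms someI_ex[of "\<lambda>C. B ** C = mat 1 \<and> C ** B = mat 1"]
  unfolding invertible_def matrix_inv_def by auto

lemma partial_cong_open:
  fixes f h :: "real ^ 'n::finite \<Rightarrow> real"
  assumes "open S" "x \<in> S" "\<And>y. y \<in> S \<Longrightarrow> f y = h y"
  shows "partial i f x = partial i h x"
proof -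
  have "(f has_derivative D) (at x) \<longleftrightarrow> (h has_derivative D) (at x)" for D
    using has_derivative_transform_within_open[OF _ assms(1,2), of f D UNIV h]
      has_derivative_transform_within_open[OF _ assms(1,2), of h D UNIV f] assms(3) by auto
  then show ?thesis by (simp add: partial_def frechet_derivative_def)
qed

lemma christoffel_torsion_free:
  assumes "open S" "x \<in> S" "\<And>y i j. y \<in> S \<Longrightarrow> g y [] [i, j] = g y [] [j, i]"
  shows "christoffel g x k i j = christoffel g x k j i"
proof -
  have "partial l (\<lambda>y. g y [] [i, j]) x = partial l (\<lambda>y. g y [] [j, i]) x" for l
    by (rule partial_cong_open[OF assms(1,2)]) (rule assms(3))
  then show ?thesis by (simp add: christoffel_def add.commute)
qed

lemma metric_matrix_invertible:
  assumes "\<And>v. v \<noteq> 0 \<Longrightarrow> v \<bullet> (metric_matrix g x *v v) > 0"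
  shows "invertible (metric_matrix g x)"
  by (metis assms inner_zero_right invertible_left_inverse less_irrefl matrix_left_invertible_ker)

lemma christoffel_lower:
  fixes g :: "'n::finite tfield"
  assumes inv: "invertible (metric_matrix g x)"
  shows "(\<Sum>k\<in>UNIV. g x [] [m, k] * christoffel g x k i j) =
    (partial i (\<lambda>y. g y [] [j, m]) x + partial j (\<lambda>y. g y [] [i, m]) x
         - partial m (\<lambda>y. g y [] [i, j]) x) / 2"
proof -
  define D where "D = (\<lambda>l. partial i (\<lambda>y. g y [] [j, l]) x + partial j (\<lambda>y. g y [] [i, l]) x
         - partial l (\<lambda>y. g y [] [i, j]) x)"
  have 1: "(\<Sum>k\<in>UNIV. g x [] [m, k] * ginv g x k l) = (if m = l then 1 else 0)" for l
    using arg_cong[OF matrix_inv_right[OF inv], of "\<lambda>B. B $ m $ l"]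
    by (simp add: matrix_matrix_mult_def ginv_def metric_matrix_def mat_def)
  have "(\<Sum>k\<in>UNIV. g x [] [m, k] * christoffel g x k i j) =
      (\<Sum>k\<in>UNIV. \<Sum>l\<in>UNIV. g x [] [m, k] * ginv g x k l * D l) / 2"
    by (simp add: christoffel_def D_def sum_divide_distrib sum_distrib_left mult.assoc)
  also have "\<dots> = (\<Sum>l\<in>UNIV. (\<Sum>k\<in>UNIV. g x [] [m, k] * ginv g x k l) * D l) / 2"
    by (subst sum.swap) (simp add: sum_distrib_right)
  also have "\<dots> = D m / 2"
    by (simp add: 1 if_distrib[of "\<lambda>c. c * _"] cong: if_cong)
  finally show ?thesis by (simp add: D_def)
qed

lemma nabla_metric:
  fixes g :: "'n::finite tfield"
  assumes S: "open S" "x \<in> S"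
    and sym: "\<And>y i j. y \<in> S \<Longrightarrow> g y [] [i, j] = g y [] [j, i]"
    and inv: "invertible (metric_matrix g x)"
  shows "nabla g i g x [] [j, k] = 0"
proof -
  have 1: "(\<Sum>p\<in>UNIV. christoffel g x p i j * g x [] [p, k]) =
      (\<Sum>p\<in>UNIV. g x [] [k, p] * christoffel g x p i j)"
    by (intro sum.cong) (auto simp: sym[OF S(2), of _ k])
  have 2: "(\<Sum>p\<in>UNIV. christoffel g x p i k * g x [] [j, p]) =
      (\<Sum>p\<in>UNIV. g x [] [j, p] * christoffel g x p i k)"
    by (intro sum.cong) auto
  have 3: "partial l (\<lambda>y. g y [] [a, b]) x = partial l (\<lambda>y. g y [] [b, a]) x" for l a b
    by (rule partial_cong_open[OF S]) (rule sym)
  have "nabla g i g x [] [j, k] = partial i (\<lambda>y. g y [] [j, k]) x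
      - ((\<Sum>p\<in>UNIV. christoffel g x p i j * g x [] [p, k])
         + (\<Sum>p\<in>UNIV. christoffel g x p i k * g x [] [j, p]))"
    by (simp add: nabla_def lessThan_Suc)
  then show ?thesis
    unfolding 1 2 christoffel_lower[OF inv] using 3[of i k j] 3[of k j i] 3[of j k i]
    by (simp add: field_simps)
qed

lemma christoffel_unique:
  fixes g :: "'n::finite tfield"
  assumes S: "open S" "x \<in> S"
    and sym: "\<And>y i j. y \<in> S \<Longrightarrow> g y [] [i, j] = g y [] [j, i]"
    and inv: "invertible (metric_matrix g x)"
    and tf: "\<And>k i j. \<Gamma> k i j = \<Gamma> k j i"
    and met: "\<And>i j k. partial i (\<lambda>y. g y [] [j, k]) x =
       (\<Sum>p\<in>UNIV. \<Gamma> p i j * g x [] [p, k]) + (\<Sum>p\<in>UNIV. \<Gamma> p i k * g x [] [j, p])"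
  shows "\<Gamma> k i j = christoffel g x k i j"
proof -
  define L where "L m i j = (\<Sum>p\<in>UNIV. g x [] [m, p] * \<Gamma> p i j)" for m i j
  have L_sym: "L m i j = L m j i" for m i j
    unfolding L_def by (intro sum.cong) (auto simp: tf[of _ i j])
  have met': "partial i (\<lambda>y. g y [] [j, k]) x = L k i j + L j i k" for i j k
    unfolding met L_def by (intro arg_cong2[of _ _ _ _ "(+)"] sum.cong) (auto simp: sym[OF S(2), of _ k])
  have inv_l: "(\<Sum>l\<in>UNIV. ginv g x k l * g x [] [l, p]) = (if k = p then 1 else 0)" for p
    using arg_cong[OF matrix_inv_left[OF inv], of "\<lambda>B. B $ k $ p"]
    by (simp add: matrix_matrix_mult_def ginv_def metric_matrix_def mat_def)
  have "L l i j + L j i l + (L l j i + L i j l) - (L j l i + L i l j) = 2 * L l i j" for l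
    using L_sym[of l j i] L_sym[of j l i] L_sym[of i l j] by simp
  then have "christoffel g x k i j = (\<Sum>l\<in>UNIV. ginv g x k l * (2 * L l i j)) / 2"
    by (simp only: christoffel_def met')
  also have "\<dots> = (\<Sum>l\<in>UNIV. ginv g x k l * L l i j)"
    by (simp add: sum_divide_distrib)
  also have "\<dots> = (\<Sum>l\<in>UNIV. \<Sum>p\<in>UNIV. ginv g x k l * g x [] [l, p] * \<Gamma> p i j)"
    by (simp add: L_def sum_distrib_left mult.assoc)
  also have "\<dots> = (\<Sum>p\<in>UNIV. (\<Sum>l\<in>UNIV. ginv g x k l * g x [] [l, p]) * \<Gamma> p i j)"
    by (subst sum.swap) (simp add: sum_distrib_right)
  also have "\<dots> = \<Gamma> k i j"
    by (simp add: inv_l if_distrib[of "\<lambda>c. c * _"] cong: if_cong)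
  finally show ?thesis by simp
qed

section \<open>\<open>G\<^sub>2\<close>-structures\<close>

text \<open>In the index type \<open>7\<close> the numerals \<open>1, \<dots>, 7\<close> are the seven distinct elements (\<open>7 = 0\<close>).\<close>
definition g2_model_form :: "7 list \<Rightarrow> real" where
  "g2_model_form is =
     basis_form [1,2,3] is + basis_form [1,4,5] is + basis_form [1,6,7] is + basis_form [2,4,6] is
     - basis_form [2,5,7] is - basis_form [3,4,7] is - basis_form [3,5,6] is"

text \<open>The components of the pullback of the model form by the isomorphism with matrix \<open>P\<close> are
  \<open>P\<^sub>i\<^sub>a P\<^sub>j\<^sub>b P\<^sub>k\<^sub>c (\<phi>\<^sub>0)\<^sub>i\<^sub>j\<^sub>k\<close>.\<close>
definition g2_structure :: "('a, 7) chart set \<Rightarrow> (('a, 7) chart \<Rightarrow> 7 tfield) \<Rightarrow> bool" where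
  "g2_structure A \<phi> \<longleftrightarrow> diff_form A 3 \<phi> \<and>
     (\<forall>ch\<in>A. \<forall>x\<in>chart_image ch. \<exists>P :: real ^ 7 ^ 7. invertible P \<and>
        (\<forall>a b c. \<phi> ch x [] [a, b, c] =
           (\<Sum>i\<in>UNIV. \<Sum>j\<in>UNIV. \<Sum>k\<in>UNIV. P $ i $ a * P $ j $ b * P $ k $ c * g2_model_form [i, j, k])))"

text \<open>The volume form of \<open>g\<close> for one of the orientations: in each chart
  \<open>\<plusminus> sqrt (det g) dx\<^sup>1 \<and> \<dots> \<and> dx\<^sup>7\<close>.  The orientation is the one for which \<open>vol\<close> is positive.\<close>
definition volume_form ::
  "('a, 7) chart set \<Rightarrow> (('a, 7) chart \<Rightarrow> 7 tfield) \<Rightarrow> (('a, 7) chart \<Rightarrow> 7 tfield) \<Rightarrow> bool" where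
  "volume_form A g vol \<longleftrightarrow> diff_form A 7 vol \<and>
     (\<forall>ch\<in>A. \<forall>x\<in>chart_image ch.
        \<bar>vol ch x [] [1,2,3,4,5,6,7]\<bar> = sqrt (det (metric_matrix (g ch) x)))"

text \<open>\<open>g\<close> and \<open>vol\<close> are the metric and the volume form determined by \<open>\<phi>\<close>:
  \<open>(u \<lrcorner> \<phi>) \<and> (v \<lrcorner> \<phi>) \<and> \<phi> = -6 g(u, v) vol\<close>\<close>
definition g2_metric ::
  "('a, 7) chart set \<Rightarrow> (('a, 7) chart \<Rightarrow> 7 tfield) \<Rightarrow> (('a, 7) chart \<Rightarrow> 7 tfield) \<Rightarrow>
     (('a, 7) chart \<Rightarrow> 7 tfield) \<Rightarrow> bool" where
  "g2_metric A \<phi> g vol \<longleftrightarrow> riemannian_metric A g \<and> volume_form A g vol \<and>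
     (\<forall>ch\<in>A. \<forall>x\<in>chart_image ch. \<forall>u v is. length is = 7 \<longrightarrow>
        wedge 4 3 (wedge 2 2 (interior_prod u (\<phi> ch x [])) (interior_prod v (\<phi> ch x [])))
          (\<phi> ch x []) is
        = -6 * (\<Sum>i\<in>UNIV. \<Sum>j\<in>UNIV. g ch x [] [i, j] * u $ i * v $ j) * vol ch x [] is)"

text \<open>\<open>\<nabla>\<^sub>l \<phi>\<^sub>a\<^sub>b\<^sub>c = T\<^sub>l\<^sub>m g\<^sup>m\<^sup>n \<psi>\<^sub>n\<^sub>a\<^sub>b\<^sub>c\<close>\<close>
definition full_torsion ::
  "('a, 7) chart set \<Rightarrow> (('a, 7) chart \<Rightarrow> 7 tfield) \<Rightarrow> (('a, 7) chart \<Rightarrow> 7 tfield) \<Rightarrow>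
     (('a, 7) chart \<Rightarrow> 7 tfield) \<Rightarrow> (('a, 7) chart \<Rightarrow> 7 tfield) \<Rightarrow> bool" where
  "full_torsion A \<phi> g \<psi> T \<longleftrightarrow> tensor_field A 0 2 T \<and>
     (\<forall>ch\<in>A. \<forall>x\<in>chart_image ch. \<forall>l a b c.
        nabla (g ch) l (\<phi> ch) x [] [a, b, c] =
          (\<Sum>m\<in>UNIV. \<Sum>n\<in>UNIV. T ch x [] [l, m] * ginv (g ch) x m n * \<psi> ch x [] [n, a, b, c]))"

end

(* With S_ijm = nabla_i T_jm - nabla_j T_im, the Ricci identity for phi expresses
   [nabla_i, nabla_j] phi through the curvature, while nabla phi = T . psi expresses it through S, T and
   nabla psi.  Contracting the result with psi solves for S (a G2 form of the Bianchi identity), and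
   contracting S with phi turns the curvature term into twice the Ricci tensor, because the remaining
   term pairs the curvature with the alternating psi and vanishes by the first Bianchi identity.
   All contractions follow from the single identity
   phi_abm phi_cdn g^mn = g_ac g_bd - g_ad g_bc - psi_abcd and the skew symmetry of phi and psi; it also
   gives nabla psi, since the metric is parallel.  The identity is verified for the model form and
   transported by the pointwise isomorphism, after the relation defining g and vol has been used to
   see that this isomorphism is an isometry and reverses the standard orientation. *)
theory Submission
  imports Defs
begin

section \<open>Partial derivatives\<close>

text \<open>\<open>nabla\<close> differentiates along a fixed coordinate field, so the direction is
  a parameter and not a slot: \<open>nabla g i (nabla g j B)\<close> differs from the second
  covariant derivative by a Christoffel term in i and j. It is symmetric in i and j, hence absent
  from the commutator. The constant -6 fixes all signs. If \<phi> is the pullback of the model form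
  by P, the relation gives g = c P^T P with c = - det P / vol; comparing determinants yields c^9 =
  1, so c = 1 and vol = - det P. Therefore \<psi> is the pullback of minus the standard Hodge star
  of the model form, which is \<open>g2_model_dual\<close>, and \<psi> enters the contraction
  identity with a minus sign. Since that identity expresses \<psi> by g and \<phi>, no derivative of
  the volume form is ever taken. In the second form of the result the product rule also
  differentiates \<phi>. This gives two extra terms quadratic in T, together -2 times the last term
  of the formula, which turns its sign from minus to plus.\<close>

lemma partial_eqI:
  "(f has_derivative f') (at x) \<Longrightarrow> partial i f x = f' (axis i 1)"
  unfolding partial_def by (metis frechet_derivative_at)

lemma partial_const [simp]: "partial i (\<lambda>y. c) x = 0"
  by (simp add: partial_eqI[OF has_derivative_const])

lemma partial_diff:
  assumes "f differentiable (at x)" "h differentiable (at x)"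
  shows "partial i (\<lambda>y. f y - h y) x = partial i f x - partial i h x"
  using partial_eqI[OF has_derivative_diff[OF assms[unfolded frechet_derivative_works]]]
  by (simp add: partial_def)

lemma partial_mult:
  assumes "f differentiable (at x)" "h differentiable (at x)"
  shows "partial i (\<lambda>y. f y * h y) x = partial i f x * h x + f x * partial i h x"
  using partial_eqI[OF has_derivative_mult[OF assms[unfolded frechet_derivative_works]]]
  by (simp add: partial_def)

lemma partial_sum:
  assumes "\<And>a. a \<in> K \<Longrightarrow> f a differentiable (at x)"
  shows "partial i (\<lambda>y. \<Sum>a\<in>K. f a y) x = (\<Sum>a\<in>K. partial i (f a) x)"
  using partial_eqI[OF has_derivative_sum[of K f "\<lambda>a. frechet_derivative (f a) (at x)"]]
    assms[unfolded frechet_derivative_works]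
  by (simp add: partial_def)

lemma differentiable_cong_open:
  assumes "open S" "x \<in> S" "\<And>y. y \<in> S \<Longrightarrow> f y = h y" "h differentiable (at x)"
  shows "f differentiable (at x)"
proof -
  obtain D where "(h has_derivative D) (at x)" using assms(4) differentiable_def by blast
  then have "(f has_derivative D) (at x)"
    by (rule has_derivative_transform_within_open[OF _ assms(1,2)]) (simp add: assms(3))
  then show ?thesis unfolding differentiable_def by blast
qed

lemma differentiable_prod_real:
  fixes f :: "'i \<Rightarrow> 'a::real_normed_vector \<Rightarrow> real"
  assumes "finite K" "\<And>a. a \<in> K \<Longrightarrow> f a differentiable (at x)"
  shows "(\<lambda>y. \<Prod>a\<in>K. f a y) differentiable (at x)"
  using assms by induction auto

section \<open>Differentiability of the inverse of a matrix-valued function\<close>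

lemma det_differentiable:
  fixes B :: "'a::real_normed_vector \<Rightarrow> real ^ 'n ^ 'n::finite"
  assumes "\<And>a b. (\<lambda>y. B y $ a $ b) differentiable (at x)"
  shows "(\<lambda>y. det (B y)) differentiable (at x)"
  unfolding det_def
proof (rule differentiable_sum)
  show "\<forall>p\<in>{p. p permutes UNIV}. (\<lambda>y. of_int (sign p) * (\<Prod>i\<in>UNIV. B y $ i $ p i)) differentiable (at x)"
    by (intro ballI differentiable_mult differentiable_const differentiable_prod_real assms finite)
qed (simp add: finite_permutations)

text \<open>Cramer's rule exhibits the entries of the inverse as quotients of determinants, which
  makes them differentiable wherever the entries of the matrix are.\<close>

lemma matrix_inv_cramer:
  fixes B :: "real ^ 'n ^ 'n::finite"
  assumes "invertible B"
  shows "matrix_inv B $ i $ j =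
    det (\<chi> a b. if b = i then axis j 1 $ a else B $ a $ b) / det B"
proof -
  have "B *v column j (matrix_inv B) = B *v (matrix_inv B *v axis j 1)"
    by (simp only: matrix_vector_mult_basis)
  also have "\<dots> = axis j 1"
    by (simp only: matrix_vector_mul_assoc matrix_inv_right[OF assms] matrix_vector_mul_lid)
  finally have 1: "B *v column j (matrix_inv B) = axis j 1" .
  have "det B \<noteq> 0"
    using assms invertible_det_nz by blast
  from cramer[THEN iffD1, OF this 1]
  have "column j (matrix_inv B) =
      (\<chi> k. det (\<chi> a b. if b = k then axis j 1 $ a else B $ a $ b) / det B)" .
  then have "column j (matrix_inv B) $ i =
      det (\<chi> a b. if b = i then axis j 1 $ a else B $ a $ b) / det B"
    by simp
  then show ?thesis by (simp add: column_def)
qed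

section \<open>Smooth functions and the symmetry of second partial derivatives\<close>

lemma smooth_on_differentiable:
  "smooth_on S f \<Longrightarrow> x \<in> S \<Longrightarrow> f differentiable (at x)"
  unfolding smooth_on_def by (metis iter_partial.simps(1))

lemma smooth_on_partial: "smooth_on S f \<Longrightarrow> smooth_on S (partial i f)"
proof -
  \<comment> \<open>The head of the list is the derivative taken last, so one taken beforehand goes
    to the end.\<close>
  have "iter_partial is (partial i f) = iter_partial (is @ [i]) f" for "is"
    by (induction "is") auto
  then show "smooth_on S f \<Longrightarrow> smooth_on S (partial i f)"
    unfolding smooth_on_def by metis
qed

lemma line_DERIV:
  fixes f :: "real ^ 'n::finite \<Rightarrow> real"
  assumes "f differentiable (at (p + t *\<^sub>R axis i 1))"
  shows "((\<lambda>t. f (p + t *\<^sub>R axis i 1)) has_real_derivative partial i f (p + t *\<^sub>R axis i 1)) (at t)"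
proof -
  let ?D = "frechet_derivative f (at (p + t *\<^sub>R axis i 1))"
  have "(f has_derivative ?D) (at (p + t *\<^sub>R axis i 1))"
    using assms frechet_derivative_works by blast
  moreover have "((\<lambda>t. p + t *\<^sub>R axis i 1) has_derivative (\<lambda>h. h *\<^sub>R axis i 1)) (at t)"
    by (auto intro!: derivative_eq_intros)
  ultimately have "((\<lambda>t. f (p + t *\<^sub>R axis i 1)) has_derivative (\<lambda>h. ?D (h *\<^sub>R axis i 1))) (at t)"
    using has_derivative_compose by fastforce
  moreover have "?D (h *\<^sub>R axis i 1) = partial i f (p + t *\<^sub>R axis i 1) * h" for h
    using linear_frechet_derivative[OF assms] by (simp add: partial_def linear_cmul)
  ultimately show ?thesis
    by (simp add: has_field_derivative_def)
qed

text \<open>The mean value theorem in direction i turns the second difference into h times a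
  difference of values of \<open>partial i f\<close>; differentiability of
  \<open>partial i f\<close> at the single point x then gives the limit. Continuity of second
  derivatives does not enter the argument.\<close>

lemma second_difference_tendsto:
  fixes f :: "real ^ 'n::finite \<Rightarrow> real"
  assumes S: "open S" "x \<in> S"
    and f: "\<And>y. y \<in> S \<Longrightarrow> f differentiable (at y)"
    and fi: "partial i f differentiable (at x)"
  shows "((\<lambda>h. (f (x + h *\<^sub>R axis i 1 + h *\<^sub>R axis j 1) - f (x + h *\<^sub>R axis i 1)
      - f (x + h *\<^sub>R axis j 1) + f x) / h\<^sup>2) \<longlongrightarrow> partial j (partial i f) x) (at_right 0)"
    (is "(?q \<longlongrightarrow> ?L) _")
proof (rule tendstoI)
  fix e :: real assume "e > 0"
  let ?D = "frechet_derivative (partial i f) (at x)"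
  have lin: "linear ?D" by (rule linear_frechet_derivative[OF fi])
  have "(partial i f has_derivative ?D) (at x)" using fi frechet_derivative_works by blast
  then obtain d where d: "d > 0"
    "\<And>y. norm (y - x) < d \<Longrightarrow> norm (partial i f y - partial i f x - ?D (y - x)) \<le> e / 4 * norm (y - x)"
    using \<open>e > 0\<close> unfolding has_derivative_at_alt by (meson divide_pos_pos zero_less_numeral)
  obtain r where r: "r > 0" "ball x r \<subseteq> S" using S open_contains_ball by blast
  \<comment> \<open>The displacements used below have norm at most 2h, hence the bound on h by half
    of d and r.\<close>
  have "dist (?q h) ?L < e" if h: "0 < h" "h < min d r / 2" for h
  proof -
    define F where "F t = f (x + h *\<^sub>R axis j 1 + t *\<^sub>R axis i 1) - f (x + t *\<^sub>R axis i 1)" for t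
    have n1: "norm (t *\<^sub>R axis i 1 :: real ^ 'n) \<le> h" if "0 \<le> t" "t \<le> h" for t
      using that by simp
    have n2: "norm (h *\<^sub>R axis j 1 + t *\<^sub>R axis i 1 :: real ^ 'n) \<le> 2 * h" if "0 \<le> t" "t \<le> h" for t
      using norm_triangle_ineq[of "h *\<^sub>R axis j 1" "t *\<^sub>R axis i 1 :: real ^ 'n"] n1[OF that] h by simp
    have in_S: "x + v \<in> S" if "norm v \<le> 2 * h" for v
      using that r h by (auto simp: dist_norm)
    have der: "(F has_real_derivative
        partial i f (x + h *\<^sub>R axis j 1 + t *\<^sub>R axis i 1) - partial i f (x + t *\<^sub>R axis i 1)) (at t)"
      if "0 \<le> t" "t \<le> h" for t
      unfolding F_def
      by (intro DERIV_diff line_DERIV f)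
        (use in_S[OF n2[OF that]] in_S[of "t *\<^sub>R axis i 1"] n1[OF that] h in \<open>auto simp: add.assoc\<close>)
    obtain t where t: "0 < t" "t < h" "F h - F 0 = (h - 0) *
        (partial i f (x + h *\<^sub>R axis j 1 + t *\<^sub>R axis i 1) - partial i f (x + t *\<^sub>R axis i 1))"
      using MVT2[OF h(1) der] by blast
    let ?u = "h *\<^sub>R axis j 1 + t *\<^sub>R axis i 1 :: real ^ 'n" and ?v = "t *\<^sub>R axis i 1 :: real ^ 'n"
    have *: "?q h = (partial i f (x + ?u) - partial i f (x + ?v)) / h"
    proof -
      have "?q h = (F h - F 0) / h\<^sup>2" by (simp add: F_def algebra_simps)
      also have "\<dots> = (partial i f (x + ?u) - partial i f (x + ?v)) / h"
        unfolding t(3) using h by (simp add: power2_eq_square add.assoc)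
      finally show ?thesis .
    qed
    \<comment> \<open>\<open>?u\<close> and \<open>?v\<close> differ by h in direction j, so the
      linear parts give exactly the limit; what remains are the errors e/4 * 2h and e/4 * h.\<close>
    have Du: "?D ?u - ?D ?v = h * ?L"
      by (simp add: linear_add[OF lin] linear_cmul[OF lin] partial_def)
    have u: "\<bar>partial i f (x + ?u) - partial i f x - ?D ?u\<bar> \<le> e / 4 * (2 * h)"
    proof -
      have "\<bar>partial i f (x + ?u) - partial i f x - ?D ?u\<bar> \<le> e / 4 * norm ?u"
        using d(2)[of "x + ?u"] n2[of t] t h by auto
      also have "\<dots> \<le> e / 4 * (2 * h)"
        using n2[of t] t \<open>e > 0\<close> by (intro mult_left_mono) auto
      finally show ?thesis .
    qed
    have v: "\<bar>partial i f (x + ?v) - partial i f x - ?D ?v\<bar> \<le> e / 4 * h"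
    proof -
      have "\<bar>partial i f (x + ?v) - partial i f x - ?D ?v\<bar> \<le> e / 4 * norm ?v"
        using d(2)[of "x + ?v"] n1[of t] t h by auto
      also have "\<dots> \<le> e / 4 * h"
        using n1[of t] t \<open>e > 0\<close> by (intro mult_left_mono) auto
      finally show ?thesis .
    qed
    have "partial i f (x + ?u) - partial i f (x + ?v) - h * ?L =
        (partial i f (x + ?u) - partial i f x - ?D ?u) - (partial i f (x + ?v) - partial i f x - ?D ?v)"
      using Du by linarith
    then have "\<bar>partial i f (x + ?u) - partial i f (x + ?v) - h * ?L\<bar> \<le> 3 / 4 * (e * h)"
      using abs_triangle_ineq4[of "partial i f (x + ?u) - partial i f x - ?D ?u"
          "partial i f (x + ?v) - partial i f x - ?D ?v"] u v by linarith
    also have "\<dots> < e * h" using \<open>e > 0\<close> h by simp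
    finally have "\<bar>(partial i f (x + ?u) - partial i f (x + ?v) - h * ?L) / h\<bar> < e"
      using h by (simp add: abs_divide pos_divide_less_eq)
    then show ?thesis
      unfolding * dist_real_def using h by (simp add: diff_divide_distrib)
  qed
  then show "\<forall>\<^sub>F h in at_right 0. dist (?q h) ?L < e"
    using d(1) r(1) unfolding eventually_at_right_field
    by (metis half_gt_zero min_less_iff_conj)
qed

text \<open>The second difference quotient is symmetric in i and j, and its limit is unique.\<close>

lemma partial_commute:
  fixes f :: "real ^ 'n::finite \<Rightarrow> real"
  assumes "open S" "x \<in> S" "smooth_on S f"
  shows "partial i (partial j f) x = partial j (partial i f) x"
proof -
  note d = smooth_on_differentiable[OF assms(3)]
    smooth_on_differentiable[OF smooth_on_partial[OF assms(3)] assms(2)]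
  let ?q = "\<lambda>i j h. (f (x + h *\<^sub>R axis i 1 + h *\<^sub>R axis j 1) - f (x + h *\<^sub>R axis i 1)
      - f (x + h *\<^sub>R axis j 1) + f x) / h\<^sup>2"
  have comm: "x + h *\<^sub>R axis i 1 + h *\<^sub>R axis j 1 = x + h *\<^sub>R axis j 1 + h *\<^sub>R axis i 1" for h
    by (simp only: add.assoc add.commute[of "h *\<^sub>R axis i 1"])
  have "?q i j = ?q j i"
    by (rule ext, unfold comm) (simp add: diff_diff_eq add.commute)
  then have "(?q j i \<longlongrightarrow> partial j (partial i f) x) (at_right 0)"
    using second_difference_tendsto[OF assms(1,2) d, where i = i and j = j] by simp
  from tendsto_unique[OF _ second_difference_tendsto[OF assms(1,2) d, where i = j and j = i] this]
  show ?thesis by simp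
qed

section \<open>Curvature of the Levi-Civita connection\<close>

lemma sum_delta_left [simp]:
  fixes f :: "'n::finite \<Rightarrow> real"
  shows "(\<Sum>p\<in>UNIV. (if k = p then 1 else 0) * f p) = f k"
  by (simp add: if_distrib[of "\<lambda>c. c * _"] cong: if_cong)

text \<open>Values at lists of other lengths are arbitrary, and list updates preserve lengths, so
  agreement on one pair of lengths is enough. This allows a tensor to be rewritten with
  \<open>ls ! 0\<close>, \<open>drop 2 ls\<close> and the like.\<close>

lemma nabla_cong_open:
  assumes "open S" "x \<in> S" "\<And>y us ls. y \<in> S \<Longrightarrow> length us = m \<Longrightarrow> length ls = n \<Longrightarrow> B y us ls = B' y us ls"
    and "length us = m" "length ls = n"
  shows "nabla g i B x us ls = nabla g i B' x us ls"
proof -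
  have "partial i (\<lambda>y. B y us ls) x = partial i (\<lambda>y. B' y us ls) x"
    by (rule partial_cong_open[OF assms(1,2)]) (simp add: assms)
  then show ?thesis by (simp add: nabla_def assms)
qed

locale riemannian_chart =
  fixes S :: "(real ^ 'n::finite) set" and g :: "'n tfield"
  assumes open_S: "open S"
    and g_smooth: "\<And>i j. smooth_on S (\<lambda>y. g y [] [i, j])"
    and g_sym: "\<And>y i j. y \<in> S \<Longrightarrow> g y [] [i, j] = g y [] [j, i]"
    and g_inv: "\<And>y. y \<in> S \<Longrightarrow> invertible (metric_matrix g y)"
begin

abbreviation "\<Gamma> \<equiv> christoffel g"

lemma ginv_left: "y \<in> S \<Longrightarrow> (\<Sum>l\<in>UNIV. ginv g y k l * g y [] [l, p]) = (if k = p then 1 else 0)"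
  using arg_cong[OF matrix_inv_left[OF g_inv], of y "\<lambda>B. B $ k $ p"]
  by (simp add: matrix_matrix_mult_def ginv_def metric_matrix_def mat_def)

lemma ginv_right: "y \<in> S \<Longrightarrow> (\<Sum>l\<in>UNIV. g y [] [k, l] * ginv g y l p) = (if k = p then 1 else 0)"
  using arg_cong[OF matrix_inv_right[OF g_inv], of y "\<lambda>B. B $ k $ p"]
  by (simp add: matrix_matrix_mult_def ginv_def metric_matrix_def mat_def)

lemma g_differentiable: "y \<in> S \<Longrightarrow> (\<lambda>y. g y [] [i, j]) differentiable (at y)"
  using smooth_on_differentiable[OF g_smooth] .

lemma ginv_differentiable:
  assumes "x \<in> S"
  shows "(\<lambda>y. ginv g y i j) differentiable (at x)"
proof (rule differentiable_cong_open[OF open_S assms])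
  show "ginv g y i j = det (\<chi> a b. if b = i then axis j 1 $ a else metric_matrix g y $ a $ b)
      / det (metric_matrix g y)" if "y \<in> S" for y
    unfolding ginv_def using matrix_inv_cramer[OF g_inv[OF that]] .
  have m: "(\<lambda>y. metric_matrix g y $ a $ b) differentiable (at x)" for a b
    using g_differentiable[OF assms] by (simp add: metric_matrix_def)
  have m': "(\<lambda>y. (\<chi> a b. if b = i then axis j 1 $ a else metric_matrix g y $ a $ b) $ a $ b)
      differentiable (at x)" for a b
    by (cases "b = i") (simp_all add: m)
  have "det (metric_matrix g x) \<noteq> 0"
    using g_inv[OF assms] invertible_det_nz by blast
  then show "(\<lambda>y. det (\<chi> a b. if b = i then axis j 1 $ a else metric_matrix g y $ a $ b)
      / det (metric_matrix g y)) differentiable (at x)"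
    by (intro differentiable_divide det_differentiable m m')
qed

lemma \<Gamma>_differentiable:
  assumes "x \<in> S"
  shows "(\<lambda>y. \<Gamma> y k i j) differentiable (at x)"
proof -
  have "(\<lambda>y. partial l (\<lambda>y. g y [] [a, b]) y) differentiable (at x)" for l a b
    using smooth_on_differentiable[OF smooth_on_partial[OF g_smooth] assms] by simp
  then show ?thesis
    unfolding christoffel_def
    by (intro differentiable_divide differentiable_const differentiable_sum ballI
        differentiable_mult differentiable_add differentiable_diff ginv_differentiable[OF assms])
      auto
qed

lemma \<Gamma>_sym: "x \<in> S \<Longrightarrow> \<Gamma> x k i j = \<Gamma> x k j i"
  using christoffel_torsion_free[OF open_S] g_sym by blast

lemma nabla_g: "x \<in> S \<Longrightarrow> nabla g i g x [] [j, k] = 0"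
  using nabla_metric[OF open_S] g_sym g_inv by blast

lemma partial_g:
  assumes "x \<in> S"
  shows "partial i (\<lambda>y. g y [] [j, k]) x =
    (\<Sum>p\<in>UNIV. \<Gamma> x p i j * g x [] [p, k]) + (\<Sum>p\<in>UNIV. \<Gamma> x p i k * g x [] [j, p])"
  using nabla_g[OF assms, of i j k] by (simp add: nabla_def lessThan_Suc)

lemma ginv_sym:
  assumes "x \<in> S"
  shows "ginv g x i j = ginv g x j i"
proof -
  have "ginv g x i j = (\<Sum>p\<in>UNIV. (if j = p then 1 else 0) * ginv g x i p)" by (rule sum_delta_left[symmetric])
  also have "\<dots> = (\<Sum>p\<in>UNIV. \<Sum>l\<in>UNIV. ginv g x j l * g x [] [l, p] * ginv g x i p)"
    by (simp add: ginv_left[OF assms, symmetric] sum_distrib_right)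
  also have "\<dots> = (\<Sum>l\<in>UNIV. \<Sum>p\<in>UNIV. ginv g x i p * g x [] [p, l] * ginv g x j l)"
    by (subst sum.swap) (auto intro!: sum.cong simp: g_sym[OF assms])
  also have "\<dots> = (\<Sum>l\<in>UNIV. (if i = l then 1 else 0) * ginv g x j l)"
    by (simp add: ginv_left[OF assms, symmetric] sum_distrib_right)
  also have "\<dots> = ginv g x j i" by (rule sum_delta_left)
  finally show ?thesis .
qed

text \<open>This is the vanishing of the covariant derivative of the inverse metric: differentiate
  the constant product of \<open>ginv\<close> and g, insert \<open>partial_g\<close>, and multiply
  by \<open>ginv\<close> on the right.\<close>

lemma partial_ginv:
  assumes x: "x \<in> S"
  shows "partial i (\<lambda>y. ginv g y a b) x =
    - (\<Sum>p\<in>UNIV. \<Gamma> x a i p * ginv g x p b) - (\<Sum>p\<in>UNIV. \<Gamma> x b i p * ginv g x a p)"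
proof -
  let ?G = "ginv g x" and ?dG = "\<lambda>l. partial i (\<lambda>y. ginv g y a l) x"
  have 1: "(\<Sum>l\<in>UNIV. ?dG l * g x [] [l, c]) =
      - \<Gamma> x a i c - (\<Sum>l\<in>UNIV. \<Sum>p\<in>UNIV. ?G a l * (\<Gamma> x p i l * g x [] [p, c]))" for c
  proof -
    have "0 = partial i (\<lambda>y. if a = c then 1 else 0 :: real) x" by simp
    also have "\<dots> = partial i (\<lambda>y. \<Sum>l\<in>UNIV. ginv g y a l * g y [] [l, c]) x"
      by (rule partial_cong_open[OF open_S x]) (simp add: ginv_left)
    also have "\<dots> = (\<Sum>l\<in>UNIV. ?dG l * g x [] [l, c] + ?G a l * partial i (\<lambda>y. g y [] [l, c]) x)"
      by (simp add: partial_sum partial_mult g_differentiable[OF x] ginv_differentiable[OF x])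
    also have "\<dots> = (\<Sum>l\<in>UNIV. ?dG l * g x [] [l, c])
        + (\<Sum>l\<in>UNIV. \<Sum>p\<in>UNIV. ?G a l * (\<Gamma> x p i l * g x [] [p, c]))
        + (\<Sum>l\<in>UNIV. \<Sum>p\<in>UNIV. ?G a l * g x [] [l, p] * \<Gamma> x p i c)"
      by (simp add: partial_g[OF x] sum.distrib ring_distribs sum_distrib_left mult_ac)
    also have "(\<Sum>l\<in>UNIV. \<Sum>p\<in>UNIV. ?G a l * g x [] [l, p] * \<Gamma> x p i c) =
        (\<Sum>p\<in>UNIV. (\<Sum>l\<in>UNIV. ?G a l * g x [] [l, p]) * \<Gamma> x p i c)"
      by (subst sum.swap) (simp add: sum_distrib_right)
    also have "\<dots> = \<Gamma> x a i c" by (simp only: ginv_left[OF x] sum_delta_left)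
    finally show ?thesis by linarith
  qed
  have "?dG b = (\<Sum>l\<in>UNIV. (if b = l then 1 else 0) * ?dG l)" by (rule sum_delta_left[symmetric])
  also have "\<dots> = (\<Sum>l\<in>UNIV. ?dG l * (\<Sum>c\<in>UNIV. g x [] [l, c] * ?G c b))"
    by (intro sum.cong) (auto simp: ginv_right[OF x])
  also have "\<dots> = (\<Sum>c\<in>UNIV. (\<Sum>l\<in>UNIV. ?dG l * g x [] [l, c]) * ?G c b)"
    unfolding sum_distrib_left sum_distrib_right
    by (subst sum.swap) (simp add: mult.assoc)
  also have "\<dots> = - (\<Sum>c\<in>UNIV. \<Gamma> x a i c * ?G c b)
      - (\<Sum>c\<in>UNIV. \<Sum>l\<in>UNIV. \<Sum>p\<in>UNIV. ?G a l * (\<Gamma> x p i l * g x [] [p, c]) * ?G c b)"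
    unfolding 1 by (simp add: left_diff_distrib sum_subtractf sum_negf sum_distrib_right)
  also have "(\<Sum>c\<in>UNIV. \<Sum>l\<in>UNIV. \<Sum>p\<in>UNIV. ?G a l * (\<Gamma> x p i l * g x [] [p, c]) * ?G c b)
      = (\<Sum>l\<in>UNIV. \<Sum>p\<in>UNIV. \<Sum>c\<in>UNIV. ?G a l * \<Gamma> x p i l * (g x [] [p, c] * ?G c b))"
    by (subst sum.swap, rule sum.cong[OF refl], subst sum.swap) (simp add: mult_ac)
  also have "\<dots> = (\<Sum>l\<in>UNIV. \<Sum>p\<in>UNIV. (if b = p then 1 else 0) * (?G a l * \<Gamma> x p i l))"
    by (simp only: sum_distrib_left[symmetric] ginv_right[OF x])
      (intro sum.cong refl, auto)
  also have "\<dots> = (\<Sum>l\<in>UNIV. \<Gamma> x b i l * ?G a l)"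
    unfolding sum_delta_left by (simp add: mult.commute)
  finally show ?thesis .
qed

lemma riemann_up_eq:
  assumes "x \<in> S"
  shows "riemann_up g x m i j k =
    partial i (\<lambda>y. \<Gamma> y m j k) x - partial j (\<lambda>y. \<Gamma> y m i k) x
    + (\<Sum>p\<in>UNIV. \<Gamma> x m i p * \<Gamma> x p j k) - (\<Sum>p\<in>UNIV. \<Gamma> x m j p * \<Gamma> x p i k)"
proof -
  have 1: "nabla g j (coord_field k) y [m] [] = \<Gamma> y m j k" for j y m
    by (simp add: nabla_def coord_field_def if_distrib[of "\<lambda>c. _ * c"] cong: if_cong)
  have "nabla g i (nabla g j (coord_field k)) x [m] [] =
      partial i (\<lambda>y. \<Gamma> y m j k) x + (\<Sum>p\<in>UNIV. \<Gamma> x m i p * \<Gamma> x p j k)" for i j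
    by (simp add: nabla_def[of g i "nabla g j (coord_field k)"] 1)
  then show ?thesis by (simp add: riemann_up_def)
qed

lemma riemann_up_skew: "riemann_up g x m i j k = - riemann_up g x m j i k"
  by (simp add: riemann_up_def)

lemma riemann_up_bianchi:
  assumes "x \<in> S"
  shows "riemann_up g x m i j k + riemann_up g x m j k i + riemann_up g x m k i j = 0"
proof -
  have "partial l (\<lambda>y. \<Gamma> y m a b) x = partial l (\<lambda>y. \<Gamma> y m b a) x" for l a b
    by (rule partial_cong_open[OF open_S assms]) (rule \<Gamma>_sym)
  from this[of i j k] this[of j k i] this[of k i j] show ?thesis
    unfolding riemann_up_eq[OF assms] \<Gamma>_sym[OF assms, of _ k] \<Gamma>_sym[OF assms, of _ j i]
    by (simp add: \<Gamma>_sym[OF assms, of _ j i] \<Gamma>_sym[OF assms, of _ j k] \<Gamma>_sym[OF assms, of _ i k])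
qed

text \<open>Of two successive corrections, the second acts either on the slot just replaced or on
  another one. The first kind yields curvature, the second is symmetric in the two
  directions.\<close>

lemma sum_list_update_split:
  fixes F :: "nat \<Rightarrow> 'n \<Rightarrow> nat \<Rightarrow> 'n \<Rightarrow> real"
  shows "(\<Sum>r<s. \<Sum>p\<in>UNIV. \<Sum>t<s. \<Sum>q\<in>UNIV. F r p t q) =
    (\<Sum>r<s. \<Sum>p\<in>UNIV. \<Sum>q\<in>UNIV. F r p r q) +
    (\<Sum>r<s. \<Sum>t\<in>{..<s} - {r}. \<Sum>p\<in>UNIV. \<Sum>q\<in>UNIV. F r p t q)"
proof -
  have "(\<Sum>p\<in>UNIV. \<Sum>t<s. \<Sum>q\<in>UNIV. F r p t q) =
      (\<Sum>p\<in>UNIV. \<Sum>q\<in>UNIV. F r p r q) + (\<Sum>t\<in>{..<s} - {r}. \<Sum>p\<in>UNIV. \<Sum>q\<in>UNIV. F r p t q)"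
    if "r < s" for r
    by (subst sum.swap) (rule sum.remove, use that in auto)
  then show ?thesis by (simp add: sum.distrib)
qed

text \<open>The terms of the second covariant derivative in which two different slots are corrected are
  symmetric under exchanging the directions, so only the single-slot terms survive.\<close>
lemma ricci_identity:
  assumes x: "x \<in> S" and B: "\<And>ls. length ls = s \<Longrightarrow> smooth_on S (\<lambda>y. B y [] ls)"
    and ls: "length ls = s"
  shows "nabla g i (nabla g j B) x [] ls - nabla g j (nabla g i B) x [] ls =
    - (\<Sum>r<s. \<Sum>p\<in>UNIV. riemann_up g x p i j (ls ! r) * B x [] (ls[r := p]))"
proof -
  let ?B = "B x []"
  have dB: "(\<lambda>y. B y [] ls') differentiable (at x)" if "length ls' = s" for ls'
    using smooth_on_differentiable[OF B[OF that] x] .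
  have dpB: "(\<lambda>y. partial j (\<lambda>y. B y [] ls') y) differentiable (at x)" if "length ls' = s" for ls' j
    using smooth_on_differentiable[OF smooth_on_partial[OF B[OF that]] x] by simp
  \<comment> \<open>The second covariant derivative is sorted by what is differentiated: B twice
    (\<open>dd\<close>), B once (\<open>A\<close>), a Christoffel symbol (\<open>E\<close>), nothing
    (\<open>Q\<close>). The terms \<open>dd\<close> and \<open>A i j + A j i\<close> are symmetric
    in i and j and leave the commutator.\<close>
  define dd where "dd i j = partial i (\<lambda>y. partial j (\<lambda>y. B y [] ls) y) x" for i j
  define A where "A i j = (\<Sum>r<s. \<Sum>p\<in>UNIV. \<Gamma> x p i (ls ! r) * partial j (\<lambda>y. B y [] (ls[r := p])) x)" for i j
  define E where "E i j = (\<Sum>r<s. \<Sum>p\<in>UNIV. partial i (\<lambda>y. \<Gamma> y p j (ls ! r)) x * ?B (ls[r := p]))" for i j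
  define F where "F i j r p t q = \<Gamma> x p i (ls ! r) * (\<Gamma> x q j (ls[r := p] ! t) * ?B (ls[r := p, t := q]))" for i j r p t q
  define Q where "Q i j = (\<Sum>r<s. \<Sum>p\<in>UNIV. \<Sum>t<s. \<Sum>q\<in>UNIV. F i j r p t q)" for i j
  have main: "nabla g i (nabla g j B) x [] ls = dd i j - E i j - A j i - (A i j - Q i j)" for i j
  proof -
    have "partial i (\<lambda>y. nabla g j B y [] ls) x = dd i j - (E i j + A j i)"
      by (simp add: nabla_def ls partial_diff partial_sum partial_mult dB dpB \<Gamma>_differentiable[OF x]
          differentiable_sum differentiable_mult dd_def E_def A_def sum.distrib)
    moreover have "(\<Sum>r<s. \<Sum>p\<in>UNIV. \<Gamma> x p i (ls ! r) * nabla g j B x [] (ls[r := p])) = A i j - Q i j"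
      by (simp add: nabla_def ls A_def Q_def F_def right_diff_distrib sum_subtractf sum_distrib_left)
    ultimately show ?thesis
      by (simp add: nabla_def[of g i "nabla g j B"] ls)
  qed
  have off: "(\<Sum>r<s. \<Sum>t\<in>{..<s} - {r}. \<Sum>p\<in>UNIV. \<Sum>q\<in>UNIV. F i j r p t q) =
     (\<Sum>r<s. \<Sum>t\<in>{..<s} - {r}. \<Sum>p\<in>UNIV. \<Sum>q\<in>UNIV. F j i r p t q)" for i j
  proof -
    \<comment> \<open>Updates of different slots commute, so exchanging the directions amounts to
      exchanging the two slots.\<close>
    have F: "F i j r p t q = F j i t q r p" if "r \<noteq> t" for r p t q
      using that by (simp add: F_def list_update_swap)
    have "(\<Sum>r<s. \<Sum>t\<in>{..<s} - {r}. \<Sum>p\<in>UNIV. \<Sum>q\<in>UNIV. F i j r p t q) =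
       (\<Sum>r<s. \<Sum>t\<in>{t. t < s \<and> r \<noteq> t}. \<Sum>p\<in>UNIV. \<Sum>q\<in>UNIV. F j i t q r p)"
      by (intro sum.cong) (auto simp: F)
    also have "\<dots> = (\<Sum>t<s. \<Sum>r\<in>{r. r < s \<and> r \<noteq> t}. \<Sum>p\<in>UNIV. \<Sum>q\<in>UNIV. F j i t q r p)"
      using sum.swap_restrict[of "{..<s}" "{..<s}" "\<lambda>r t. \<Sum>p\<in>UNIV. \<Sum>q\<in>UNIV. F j i t q r p" "(\<noteq>)"]
      by simp
    also have "\<dots> = (\<Sum>r<s. \<Sum>t\<in>{..<s} - {r}. \<Sum>p\<in>UNIV. \<Sum>q\<in>UNIV. F j i r p t q)"
      by (rule sum.cong[OF refl], rule sum.cong) (auto intro: sum.swap)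
    finally show ?thesis .
  qed
  have Q: "Q i j - Q j i = (\<Sum>r<s. \<Sum>q\<in>UNIV. \<Sum>p\<in>UNIV.
      (\<Gamma> x p i (ls ! r) * \<Gamma> x q j p - \<Gamma> x p j (ls ! r) * \<Gamma> x q i p) * ?B (ls[r := q]))"
  proof -
    have "Q i j - Q j i = (\<Sum>r<s. \<Sum>p\<in>UNIV. \<Sum>q\<in>UNIV. F i j r p r q - F j i r p r q)"
      by (simp add: Q_def sum_list_update_split off[of i j] sum_subtractf)
    also have "\<dots> = (\<Sum>r<s. \<Sum>p\<in>UNIV. \<Sum>q\<in>UNIV.
      (\<Gamma> x p i (ls ! r) * \<Gamma> x q j p - \<Gamma> x p j (ls ! r) * \<Gamma> x q i p) * ?B (ls[r := q]))"
      by (intro sum.cong refl) (simp add: F_def ls algebra_simps)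
    also have "\<dots> = (\<Sum>r<s. \<Sum>q\<in>UNIV. \<Sum>p\<in>UNIV.
      (\<Gamma> x p i (ls ! r) * \<Gamma> x q j p - \<Gamma> x p j (ls ! r) * \<Gamma> x q i p) * ?B (ls[r := q]))"
      by (intro sum.cong refl sum.swap)
    finally show ?thesis .
  qed
  have "dd i j = dd j i"
    unfolding dd_def using partial_commute[OF open_S x B[OF ls], of i j] by simp
  then have "nabla g i (nabla g j B) x [] ls - nabla g j (nabla g i B) x [] ls =
      - (E i j - E j i) + (Q i j - Q j i)"
    unfolding main by simp
  also have "\<dots> = - (\<Sum>r<s. \<Sum>p\<in>UNIV. riemann_up g x p i j (ls ! r) * ?B (ls[r := p]))"
    unfolding Q E_def riemann_up_eq[OF x]
    by (simp add: sum_subtractf sum_negf sum.distrib sum_distrib_right sum_distrib_left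
        ring_distribs mult_ac)
  finally show ?thesis .
qed

lemma riemann_skew: "riemann g x i j k l = - riemann g x j i k l"
  unfolding riemann_def by (subst riemann_up_skew) (simp add: sum_negf)

lemma riemann_bianchi:
  assumes "x \<in> S"
  shows "riemann g x i j k l + riemann g x j k i l + riemann g x k i j l = 0"
  using riemann_up_bianchi[OF assms]
  by (simp add: riemann_def sum.distrib[symmetric] ring_distribs[symmetric])

text \<open>The Ricci identity is applied to the metric itself, which is parallel, so its left side
  vanishes.\<close>

lemma riemann_skew':
  assumes x: "x \<in> S"
  shows "riemann g x i j k l = - riemann g x i j l k"
proof -
  have 0: "nabla g i (nabla g j g) x [] [k, l] = 0" for i j
  proof -
    \<comment> \<open>The inner derivative is differentiated again, so it has to vanish on a
      neighbourhood and not only at x.\<close>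
    have "nabla g i (nabla g j g) x [] [k, l] = nabla g i (\<lambda>y us ls. 0) x [] [k, l]"
    proof (rule nabla_cong_open[OF open_S x, of 0 2])
      fix y and us ls :: "'n list"
      assume "y \<in> S" "length us = 0" "length ls = 2"
      then show "nabla g j g y us ls = 0"
        using nabla_g[of y j "ls ! 0" "ls ! 1"]
        by (auto simp: length_Suc_conv numeral_2_eq_2)
    qed auto
    then show ?thesis by (simp add: nabla_def)
  qed
  have "smooth_on S (\<lambda>y. g y [] ls)" if "length ls = 2" for ls
    using that g_smooth by (auto simp: length_Suc_conv numeral_2_eq_2)
  from ricci_identity[where B = g and s = 2, OF x this, of "[k, l]" i j]
  have "riemann g x i j k l + riemann g x i j l k = 0"
    by (simp add: 0 numeral_2_eq_2 lessThan_Suc riemann_def g_sym[OF x, of k])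
  then show ?thesis by simp
qed

text \<open>The usual combination of four cyclic Bianchi identities with skewness in each
  pair.\<close>

lemma riemann_pair:
  assumes x: "x \<in> S"
  shows "riemann g x i j k l = riemann g x k l i j"
  using riemann_bianchi[OF x, of i j k l] riemann_bianchi[OF x, of j k l i]
    riemann_bianchi[OF x, of k l i j] riemann_bianchi[OF x, of l i j k]
    riemann_skew riemann_skew'[OF x] by smt

end

section \<open>Covariant derivatives of products and contractions\<close>

text \<open>A pair of indices contracted by the inverse metric is treated as one linear operator, so
  that later calculations never open the double sums.\<close>

definition contr :: "('n::finite \<Rightarrow> 'n \<Rightarrow> real) \<Rightarrow> ('n \<Rightarrow> 'n \<Rightarrow> real) \<Rightarrow> real" where
  "contr G F = (\<Sum>a\<in>UNIV. \<Sum>b\<in>UNIV. G a b * F a b)"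

lemma contr_add: "contr G (\<lambda>a b. F a b + H a b) = contr G F + contr G H"
  and contr_diff: "contr G (\<lambda>a b. F a b - H a b) = contr G F - contr G H"
  and contr_uminus: "contr G (\<lambda>a b. - F a b) = - contr G F"
  and contr_cmult: "contr G (\<lambda>a b. c * F a b) = c * contr G F"
  and contr_multc: "contr G (\<lambda>a b. F a b * c) = contr G F * c"
  by (simp_all add: contr_def ring_distribs sum.distrib sum_subtractf sum_negf sum_distrib_left
      mult_ac)

lemma contr_zero [simp]: "contr G (\<lambda>a b. 0) = 0"
  by (simp add: contr_def)

lemma contr_sum: "contr G (\<lambda>a b. \<Sum>k\<in>K. F k a b) = (\<Sum>k\<in>K. contr G (F k))"
proof -
  have "contr G (\<lambda>a b. \<Sum>k\<in>K. F k a b) = (\<Sum>a\<in>UNIV. \<Sum>k\<in>K. \<Sum>b\<in>UNIV. G a b * F k a b)"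
    unfolding contr_def sum_distrib_left by (rule sum.cong[OF refl], rule sum.swap)
  also have "\<dots> = (\<Sum>k\<in>K. contr G (F k))"
    unfolding contr_def by (rule sum.swap)
  finally show ?thesis .
qed

lemma contr_swap: "contr G (\<lambda>a b. contr H (\<lambda>c d. F a b c d)) = contr H (\<lambda>c d. contr G (\<lambda>a b. F a b c d))"
proof -
  have "contr G (\<lambda>a b. contr H (\<lambda>c d. F a b c d)) =
      contr G (\<lambda>a b. \<Sum>c\<in>UNIV. \<Sum>d\<in>UNIV. H c d * F a b c d)"
    by (simp add: contr_def)
  also have "\<dots> = contr H (\<lambda>c d. contr G (\<lambda>a b. F a b c d))"
    unfolding contr_sum contr_cmult by (simp add: contr_def)
  finally show ?thesis .
qed

lemma nabla_diff:
  assumes "(\<lambda>y. B y us ls) differentiable (at x)" "(\<lambda>y. B' y us ls) differentiable (at x)"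
  shows "nabla g i (\<lambda>y us ls. B y us ls - B' y us ls) x us ls = nabla g i B x us ls - nabla g i B' x us ls"
  using assms by (simp add: nabla_def partial_diff sum_subtractf ring_distribs)

text \<open>A factor of a product sees only the slots listed in I; correcting one of them is an
  ordinary list update from the point of view of that factor.\<close>

lemma map_nth_list_update:
  assumes "distinct I" "set I \<subseteq> {..<length ls}" "k < length I"
  shows "map ((!) (ls[I ! k := p])) I = (map ((!) ls) I)[k := p]"
proof (rule nth_equalityI)
  have "I ! n < length ls" if "n < length I" for n
    using assms(2) nth_mem[OF that] by auto
  then show "map ((!) (ls[I ! k := p])) I ! n = (map ((!) ls) I)[k := p] ! n"
    if "n < length (map ((!) (ls[I ! k := p])) I)" for n
    using that assms(1,3) by (auto simp: nth_list_update nth_eq_iff_index_eq)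
qed simp

lemma map_nth_list_update_notin:
  assumes "r \<notin> set I"
  shows "map ((!) (ls[r := p])) I = map ((!) ls) I"
  using assms by (metis map_cong nth_list_update_neq)

text \<open>The slots of the product are distributed over the factors by the index lists \<open>I\<close> and \<open>J\<close>.\<close>
lemma nabla_mult:
  assumes I: "distinct (I @ J)" "set (I @ J) = {..<length ls}"
    and A: "(\<lambda>y. A y [] (map ((!) ls) I)) differentiable (at x)"
    and B: "(\<lambda>y. B y [] (map ((!) ls) J)) differentiable (at x)"
  shows "nabla g i (\<lambda>y us ls. A y [] (map ((!) ls) I) * B y [] (map ((!) ls) J)) x [] ls =
    nabla g i A x [] (map ((!) ls) I) * B x [] (map ((!) ls) J)
    + A x [] (map ((!) ls) I) * nabla g i B x [] (map ((!) ls) J)"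
proof -
  let ?a = "\<lambda>ls. A x [] (map ((!) ls) I)" and ?b = "\<lambda>ls. B x [] (map ((!) ls) J)"
  define f where "f r = (\<Sum>p\<in>UNIV. christoffel g x p i (ls ! r) * (?a (ls[r := p]) * ?b (ls[r := p])))" for r
  have I': "distinct I" "set I \<subseteq> {..<length ls}" and J': "distinct J" "set J \<subseteq> {..<length ls}"
    and disj: "set I \<inter> set J = {}"
    using I by auto
  have reindex: "(\<Sum>r\<in>set L. f r) = (\<Sum>k<length L. f (L ! k))" if "distinct L" for L
    using that by (simp add: sum_list_distinct_conv_sum_set[symmetric] sum_list_sum_nth atLeast0LessThan)
  \<comment> \<open>Every slot belongs to exactly one factor, and its correction leaves the other
    factor unchanged.\<close>
  have "(\<Sum>r<length ls. f r) = (\<Sum>r\<in>set I. f r) + (\<Sum>r\<in>set J. f r)"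
    unfolding I(2)[symmetric] using disj by (simp add: sum.union_disjoint)
  also have "(\<Sum>r\<in>set I. f r) = (\<Sum>k<length I. \<Sum>p\<in>UNIV. christoffel g x p i (map ((!) ls) I ! k) *
      A x [] ((map ((!) ls) I)[k := p])) * ?b ls"
  proof -
    have "I ! k \<notin> set J" if "k < length I" for k using nth_mem[OF that] disj by blast
    then show ?thesis
      unfolding reindex[OF I'(1)] unfolding f_def sum_distrib_right
      by (intro sum.cong refl)
        (simp add: map_nth_list_update[OF I'] map_nth_list_update_notin mult.assoc)
  qed
  also have "(\<Sum>r\<in>set J. f r) = ?a ls * (\<Sum>k<length J. \<Sum>p\<in>UNIV. christoffel g x p i (map ((!) ls) J ! k) *
      B x [] ((map ((!) ls) J)[k := p]))"
  proof -
    have "J ! k \<notin> set I" if "k < length J" for k using nth_mem[OF that] disj by blast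
    then show ?thesis
      unfolding reindex[OF J'(1)] unfolding f_def sum_distrib_left
      by (intro sum.cong refl)
        (simp add: map_nth_list_update[OF J'] map_nth_list_update_notin mult_ac)
  qed
  finally show ?thesis
    by (simp add: nabla_def f_def partial_mult[OF A B] algebra_simps)
qed

text \<open>Freezing a slot as a parameter drops its Christoffel correction, which has to be added
  back. It is needed because the direction j of a first derivative is such a parameter, while j is a
  slot of the torsion.\<close>

lemma nabla_fix_slot:
  "nabla g i (\<lambda>y us ls. B y us (j # ls)) x [] ls =
    nabla g i B x [] (j # ls) + (\<Sum>p\<in>UNIV. christoffel g x p i j * B x [] (p # ls))"
  by (simp add: nabla_def sum.lessThan_Suc_shift del: sum.lessThan_Suc)

context riemannian_chart
begin

text \<open>The Christoffel terms from differentiating \<open>ginv\<close> become, after renaming of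
  summation indices, the corrections for the two contracted slots of F.\<close>

lemma partial_contr:
  assumes x: "x \<in> S" and F: "\<And>a b. (\<lambda>y. F y a b) differentiable (at x)"
  shows "partial i (\<lambda>y. contr (ginv g y) (\<lambda>a b. F y a b)) x =
    contr (ginv g x) (\<lambda>a b. partial i (\<lambda>y. F y a b) x
      - (\<Sum>p\<in>UNIV. \<Gamma> x p i a * F x p b) - (\<Sum>p\<in>UNIV. \<Gamma> x p i b * F x a p))"
proof -
  let ?G = "ginv g x"
  have 1: "(\<Sum>a\<in>UNIV. \<Sum>b\<in>UNIV. \<Sum>p\<in>UNIV. \<Gamma> x a i p * ?G p b * F x a b) =
      contr ?G (\<lambda>a b. \<Sum>p\<in>UNIV. \<Gamma> x p i a * F x p b)"
  proof -
    have "(\<Sum>a\<in>UNIV. \<Sum>b\<in>UNIV. \<Sum>p\<in>UNIV. \<Gamma> x a i p * ?G p b * F x a b) =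
        (\<Sum>a\<in>UNIV. \<Sum>p\<in>UNIV. \<Sum>b\<in>UNIV. ?G p b * (\<Gamma> x a i p * F x a b))"
      by (rule sum.cong[OF refl], subst sum.swap) (simp add: mult_ac)
    also have "\<dots> = (\<Sum>p\<in>UNIV. \<Sum>a\<in>UNIV. \<Sum>b\<in>UNIV. ?G p b * (\<Gamma> x a i p * F x a b))"
      by (rule sum.swap)
    also have "\<dots> = (\<Sum>p\<in>UNIV. \<Sum>b\<in>UNIV. \<Sum>a\<in>UNIV. ?G p b * (\<Gamma> x a i p * F x a b))"
      by (rule sum.cong[OF refl], rule sum.swap)
    finally show ?thesis by (simp add: contr_def sum_distrib_left)
  qed
  have 2: "(\<Sum>a\<in>UNIV. \<Sum>b\<in>UNIV. \<Sum>p\<in>UNIV. \<Gamma> x b i p * ?G a p * F x a b) =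
      contr ?G (\<lambda>a b. \<Sum>p\<in>UNIV. \<Gamma> x p i b * F x a p)"
    unfolding contr_def sum_distrib_left
    by (rule sum.cong[OF refl], subst sum.swap) (simp add: mult_ac)
  have "partial i (\<lambda>y. contr (ginv g y) (\<lambda>a b. F y a b)) x =
     (\<Sum>a\<in>UNIV. \<Sum>b\<in>UNIV. partial i (\<lambda>y. ginv g y a b) x * F x a b + ?G a b * partial i (\<lambda>y. F y a b) x)"
    by (simp add: contr_def partial_sum partial_mult ginv_differentiable[OF x] F)
  also have "\<dots> = contr ?G (\<lambda>a b. partial i (\<lambda>y. F y a b) x)
     - (\<Sum>a\<in>UNIV. \<Sum>b\<in>UNIV. \<Sum>p\<in>UNIV. \<Gamma> x a i p * ?G p b * F x a b)
     - (\<Sum>a\<in>UNIV. \<Sum>b\<in>UNIV. \<Sum>p\<in>UNIV. \<Gamma> x b i p * ?G a p * F x a b)"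
    by (simp add: contr_def partial_ginv[OF x] ring_distribs sum.distrib sum_subtractf sum_negf
        sum_distrib_right)
  finally show ?thesis unfolding 1 2 by (simp add: contr_diff)
qed

text \<open>Contraction commutes with \<open>nabla\<close>. On the right the two contracted indices
  have become the leading slots of a tensor, so that they receive their corrections.\<close>

lemma nabla_contr:
  assumes x: "x \<in> S" and F: "\<And>a b. (\<lambda>y. F y a b ls) differentiable (at x)"
  shows "nabla g i (\<lambda>y us ls. contr (ginv g y) (\<lambda>a b. F y a b ls)) x [] ls =
    contr (ginv g x) (\<lambda>a b. nabla g i (\<lambda>y us ls. F y (ls ! 0) (ls ! 1) (drop 2 ls)) x [] (a # b # ls))"
  by (simp add: nabla_def partial_contr[OF x F] sum.lessThan_Suc_shift contr_diff contr_sum contr_cmult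
      contr_add del: sum.lessThan_Suc)

text \<open>Raising an index commutes with \<open>nabla\<close>, again because \<open>ginv\<close>
  is parallel. This serves the divergence in the second form of the result.\<close>

lemma nabla_raise:
  assumes x: "x \<in> S" and F: "\<And>l. (\<lambda>y. F y l ls) differentiable (at x)"
  shows "nabla g i (\<lambda>y us ls. \<Sum>l\<in>UNIV. ginv g y (us ! 0) l * F y l ls) x [u] ls =
    (\<Sum>l\<in>UNIV. ginv g x u l * nabla g i (\<lambda>y us ls. F y (ls ! 0) (drop 1 ls)) x [] (l # ls))"
proof -
  let ?G = "ginv g x"
  have 1: "(\<Sum>l\<in>UNIV. \<Sum>p\<in>UNIV. \<Gamma> x u i p * ?G p l * F x l ls) =
     (\<Sum>p\<in>UNIV. \<Gamma> x u i p * (\<Sum>l\<in>UNIV. ?G p l * F x l ls))"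
    by (subst sum.swap) (simp add: sum_distrib_left mult.assoc)
  have 2: "(\<Sum>l\<in>UNIV. \<Sum>p\<in>UNIV. \<Gamma> x l i p * ?G u p * F x l ls) =
     (\<Sum>l\<in>UNIV. \<Sum>p\<in>UNIV. ?G u l * (\<Gamma> x p i l * F x p ls))"
    by (subst sum.swap) (simp add: mult_ac)
  have 3: "(\<Sum>l\<in>UNIV. ?G u l * (\<Sum>r<length ls. \<Sum>p\<in>UNIV. \<Gamma> x p i (ls ! r) * F x l (ls[r := p]))) =
     (\<Sum>r<length ls. \<Sum>p\<in>UNIV. \<Gamma> x p i (ls ! r) * (\<Sum>l\<in>UNIV. ?G u l * F x l (ls[r := p])))"
    unfolding sum_distrib_left
    by (subst sum.swap, rule sum.cong[OF refl], subst sum.swap) (simp add: mult_ac)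
  have "partial i (\<lambda>y. \<Sum>l\<in>UNIV. ginv g y u l * F y l ls) x =
     (\<Sum>l\<in>UNIV. ?G u l * partial i (\<lambda>y. F y l ls) x)
     - (\<Sum>l\<in>UNIV. \<Sum>p\<in>UNIV. \<Gamma> x u i p * ?G p l * F x l ls)
     - (\<Sum>l\<in>UNIV. \<Sum>p\<in>UNIV. \<Gamma> x l i p * ?G u p * F x l ls)"
    by (simp add: partial_sum partial_mult ginv_differentiable[OF x] F partial_ginv[OF x]
        ring_distribs sum.distrib sum_subtractf sum_negf sum_distrib_right)
  then show ?thesis
    unfolding 1 2
    by (simp add: nabla_def sum.lessThan_Suc_shift ring_distribs sum.distrib sum_subtractf 3
        del: sum.lessThan_Suc) (simp add: sum_distrib_left)
qed

lemma contr_differentiable: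
  assumes x: "x \<in> S" and F: "\<And>a b. (\<lambda>y. F y a b) differentiable (at x)"
  shows "(\<lambda>y. contr (ginv g y) (\<lambda>a b. F y a b)) differentiable (at x)"
  unfolding contr_def
  by (intro differentiable_sum ballI finite differentiable_mult ginv_differentiable[OF x] F)

end

section \<open>Contraction identities\<close>

text \<open>Pointwise algebra; apart from the symmetries, \<phi>, \<psi> and g are linked only by
  the last assumption. It is interpreted for the model form, where its constants serve to determine
  g and vol, and later at each point of a chart.\<close>

locale g2_contraction =
  fixes G g :: "7 \<Rightarrow> 7 \<Rightarrow> real" and \<phi> :: "7 \<Rightarrow> 7 \<Rightarrow> 7 \<Rightarrow> real" and \<psi> :: "7 \<Rightarrow> 7 \<Rightarrow> 7 \<Rightarrow> 7 \<Rightarrow> real"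
  assumes G_sym: "G a b = G b a" and g_sym: "g a b = g b a"
    and G_g: "(\<Sum>b\<in>UNIV. G a b * g b c) = (if a = c then 1 else 0)"
    and \<phi>_12: "\<phi> b a c = - \<phi> a b c" and \<phi>_23: "\<phi> a c b = - \<phi> a b c"
    and \<psi>_12: "\<psi> b a c d = - \<psi> a b c d" and \<psi>_23: "\<psi> a c b d = - \<psi> a b c d"
    and \<psi>_34: "\<psi> a b d c = - \<psi> a b c d"
    and contr_\<phi>_\<phi>: "contr G (\<lambda>m n. \<phi> a b m * \<phi> c d n) = g a c * g b d - g a d * g b c - \<psi> a b c d"
begin

abbreviation "C \<equiv> contr G"

text \<open>Inner products on tensors with one, two and three slots, without factorials. Partial
  application makes \<open>\<phi> a b\<close>, \<open>\<phi> a\<close> and \<open>\<psi> a\<close>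
  into such tensors.\<close>

definition "dot1 u v = C (\<lambda>m n. u m * v n)"
definition "dot2 X Y = C (\<lambda>m n. dot1 (X m) (Y n))"
definition "dot3 X Y = C (\<lambda>m n. dot2 (X m) (Y n))"

section \<open>Formal rules for the pairings\<close>

lemma C_sym: "C (\<lambda>a b. F b a) = C F"
  unfolding contr_def by (subst sum.swap) (simp add: G_sym)

lemma dot1_commute: "dot1 u v = dot1 v u"
  unfolding dot1_def by (subst C_sym[symmetric]) (simp add: mult.commute)

lemma dot2_commute: "dot2 X Y = dot2 Y X"
  unfolding dot2_def by (subst C_sym[symmetric]) (simp add: dot1_commute)

lemma dot1_linear:
  "dot1 u (\<lambda>n. v n + w n) = dot1 u v + dot1 u w"
  "dot1 u (\<lambda>n. v n - w n) = dot1 u v - dot1 u w"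
  "dot1 u (\<lambda>n. - v n) = - dot1 u v"
  "dot1 u (\<lambda>n. c * v n) = c * dot1 u v"
  "dot1 u (\<lambda>n. v n * c) = dot1 u v * c"
  "dot1 u (\<lambda>n. 0) = 0"
  "dot1 (\<lambda>n. v n + w n) u = dot1 v u + dot1 w u"
  "dot1 (\<lambda>n. v n - w n) u = dot1 v u - dot1 w u"
  "dot1 (\<lambda>n. - v n) u = - dot1 v u"
  "dot1 (\<lambda>n. c * v n) u = c * dot1 v u"
  "dot1 (\<lambda>n. v n * c) u = dot1 v u * c"
  "dot1 (\<lambda>n. 0) u = 0"
  by (simp_all add: dot1_def ring_distribs contr_add contr_diff contr_uminus mult_ac
      contr_cmult contr_multc mult.left_commute[of _ c])

lemma dot1_divide: "dot1 (\<lambda>n. v n / c) u = dot1 v u / c"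
  unfolding divide_inverse by (rule dot1_linear)

lemma dot2_linear:
  "dot2 u (\<lambda>a b. v a b + w a b) = dot2 u v + dot2 u w"
  "dot2 u (\<lambda>a b. v a b - w a b) = dot2 u v - dot2 u w"
  "dot2 u (\<lambda>a b. - v a b) = - dot2 u v"
  "dot2 u (\<lambda>a b. c * v a b) = c * dot2 u v"
  "dot2 (\<lambda>a b. v a b + w a b) u = dot2 v u + dot2 w u"
  "dot2 (\<lambda>a b. - v a b) u = - dot2 v u"
  "dot2 (\<lambda>a b. 0) u = 0"
  by (simp_all add: dot2_def dot1_linear contr_add contr_diff contr_uminus contr_cmult)

lemma dot3_linear:
  "dot3 (\<lambda>a b c. v a b c + w a b c) u = dot3 v u + dot3 w u"
  "dot3 (\<lambda>a b c. v a b c - w a b c) u = dot3 v u - dot3 w u"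
  "dot3 (\<lambda>a b c. - v a b c) u = - dot3 v u"
  "dot3 u (\<lambda>a b c. - v a b c) = - dot3 u v"
  "dot3 (\<lambda>a b c. 0) u = 0"
  by (simp_all add: dot3_def dot2_def dot1_linear contr_add contr_diff contr_uminus contr_cmult)

lemma dot1_C: "dot1 u (\<lambda>e. C (\<lambda>a b. F e a b)) = C (\<lambda>a b. dot1 u (\<lambda>e. F e a b))"
  unfolding dot1_def by (subst contr_cmult[symmetric], subst contr_swap) (rule refl)

lemma dot1_dot1: "dot1 u (\<lambda>m. dot1 v (\<lambda>p. K m p)) = dot1 v (\<lambda>p. dot1 u (\<lambda>m. K m p))"
  by (subst (2) dot1_def, subst dot1_C) (simp add: dot1_linear dot1_def)

lemma dot1_dot1_left: "dot1 (\<lambda>b. dot1 u (\<lambda>e. K e b)) v = dot1 u (\<lambda>e. dot1 (K e) v)"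
  by (subst (1 2) dot1_commute[of _ v]) (rule dot1_dot1)

lemma dot2_dot1: "dot2 (\<lambda>b c. dot1 u (\<lambda>e. K e b c)) Y = dot1 u (\<lambda>e. dot2 (K e) Y)"
  unfolding dot2_def dot1_C dot1_dot1_left ..

lemma dot3_dot1: "dot3 (\<lambda>a b c. dot1 u (\<lambda>e. K e a b c)) Y = dot1 u (\<lambda>e. dot3 (K e) Y)"
  unfolding dot3_def dot1_C dot2_dot1 ..

lemma dot2_swap: "dot2 (\<lambda>a b. X b a) (\<lambda>a b. Y b a) = dot2 X Y"
  unfolding dot2_def dot1_def by (rule contr_swap)

lemma dot3_swap12: "dot3 (\<lambda>a b c. X b a c) (\<lambda>a b c. Y b a c) = dot3 X Y"
  unfolding dot3_def dot2_def by (rule contr_swap)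

lemma dot3_swap23: "dot3 (\<lambda>a b c. X a c b) (\<lambda>a b c. Y a c b) = dot3 X Y"
  unfolding dot3_def by (intro arg_cong[of _ _ C] ext dot2_swap)

lemma C_g: "C g = 7"
proof -
  have "C g = (\<Sum>a\<in>UNIV. \<Sum>b\<in>UNIV. G a b * g b a)"
    unfolding contr_def by (simp add: g_sym)
  then show ?thesis by (simp add: G_g)
qed

lemma dot1_g [simp]: "dot1 u (g a) = u a" "dot1 (g a) u = u a"
proof -
  have "dot1 u (g a) = (\<Sum>m\<in>UNIV. u m * (\<Sum>n\<in>UNIV. G m n * g n a))"
    unfolding dot1_def contr_def sum_distrib_left by (simp add: g_sym mult_ac)
  also have "\<dots> = u a"
    by (simp add: G_g if_distrib[of "\<lambda>c. _ * c"] cong: if_cong)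
  finally show "dot1 u (g a) = u a" .
  then show "dot1 (g a) u = u a" by (simp add: dot1_commute)
qed

lemma dot1_g' [simp]: "dot1 u (\<lambda>b. g b a) = u a"
  using dot1_g(1)[of u a] by (simp add: g_sym[of _ a])

lemma dot2_gg: "dot2 X (\<lambda>m n. g a m * g b n) = X a b" "dot2 X (\<lambda>m n. g a n * g b m) = X b a"
proof -
  have "dot2 X (\<lambda>m n. g a m * g b n) = C (\<lambda>m n. X m b * g a n)" for a b
    by (simp add: dot2_def dot1_linear mult.commute)
  then show *: "dot2 X (\<lambda>m n. g a m * g b n) = X a b" for a b
    by (simp add: dot1_def[symmetric])
  show "dot2 X (\<lambda>m n. g a n * g b m) = X b a"
    using *[of b a] by (simp add: mult.commute)
qed

section \<open>Contractions of \<phi> and \<psi> over one, two and three indices\<close>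

lemma \<phi>_cyclic: "\<phi> b c a = \<phi> a b c"
  using \<phi>_23[of b c a] \<phi>_12[of b a c] by simp

lemma \<phi>_cyclic_fun: "\<phi> b c = (\<lambda>e. \<phi> e b c)"
  by (rule ext) (rule \<phi>_cyclic)

lemma \<psi>_rotate3: "\<psi> a c d b = \<psi> a b c d"
  using \<psi>_34[of a c d b] \<psi>_23[of a c b d] by simp

lemma \<psi>_24: "\<psi> a d c b = - \<psi> a b c d"
  using \<psi>_rotate3[of a c d b] \<psi>_23[of a d c b] by simp

lemma \<psi>_rotate4: "\<psi> b c d a = - \<psi> a b c d"
  using \<psi>_34[of b c d a] \<psi>_23[of b c a d] \<psi>_12[of b a c d] by simp

lemma \<psi>_exchange: "\<psi> c d a b = \<psi> a b c d"
  using \<psi>_rotate4[of c d a b] \<psi>_rotate4[of b c d a] by simp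

lemma dot1_\<phi>_\<phi>: "dot1 (\<phi> a b) (\<phi> c d) = g a c * g b d - g a d * g b c - \<psi> a b c d"
  unfolding dot1_def by (rule contr_\<phi>_\<phi>)

lemma C_skew:
  assumes "\<And>a b. F b a = - F a b"
  shows "C F = 0"
proof -
  have "(\<lambda>a b. F b a) = (\<lambda>a b. - F a b)" by (intro ext assms)
  then show ?thesis using C_sym[of F] contr_uminus[of G F] by simp
qed

text \<open>Trace of the contraction identity: 6 = 7 - 1, and the trace of \<psi> over two of its
  slots vanishes by skewness.\<close>

lemma dot2_\<phi>_\<phi>: "dot2 (\<phi> p) (\<phi> m) = 6 * g p m"
proof -
  have "C (\<lambda>a b. g p b * g a m) = dot1 (\<lambda>a. g a m) (g p)"
    unfolding dot1_def by (simp only: mult.commute)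
  then have "dot2 (\<phi> p) (\<phi> m) = g p m * C g - g p m - C (\<lambda>a b. \<psi> p a m b)"
    unfolding dot2_def dot1_\<phi>_\<phi> contr_diff contr_cmult by simp
  moreover have "C (\<lambda>a b. \<psi> p a m b) = 0"
    by (rule C_skew) (rule \<psi>_24)
  ultimately show ?thesis by (simp add: C_g)
qed

lemma \<psi>_eq: "\<psi> a b c d = g a c * g b d - g a d * g b c - dot1 (\<phi> a b) (\<phi> c d)"
  unfolding dot1_\<phi>_\<phi> by simp

text \<open>Replacing \<psi> by the contraction identity reduces every double contraction against
  \<psi> to one against \<phi>.\<close>

lemma dot2_\<psi>: "dot2 X (\<psi> s a) = X s a - X a s - dot1 (\<phi> s a) (\<lambda>e. dot2 X (\<phi> e))"
proof -
  have "dot2 X (\<psi> s a) = dot2 X (\<lambda>b c. g s b * g a c - g s c * g a b - dot1 (\<phi> s a) (\<lambda>e. \<phi> e b c))"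
    by (intro arg_cong[of _ _ "dot2 X"] ext) (simp only: \<psi>_eq \<phi>_cyclic_fun[symmetric])
  also have "\<dots> = X s a - X a s - dot2 (\<lambda>b c. dot1 (\<phi> s a) (\<lambda>e. \<phi> e b c)) X"
    unfolding dot2_linear dot2_gg by (simp add: dot2_commute)
  finally show ?thesis unfolding dot2_dot1 by (simp add: dot2_commute)
qed

text \<open>-4 = 2 - 6: the metric terms give \<phi> twice, the remaining one is
  \<open>dot2_\<phi>_\<phi>\<close>.\<close>

lemma dot2_\<phi>_\<psi>: "dot2 (\<phi> p) (\<psi> s a) = - 4 * \<phi> p s a"
  using \<phi>_23[of p s a] \<phi>_cyclic[of s a p] unfolding dot2_\<psi> dot2_\<phi>_\<phi> dot1_linear by simp

lemma dot2_\<psi>_\<psi>: "dot2 (\<psi> p e) (\<psi> s a) = 4 * (g p s * g e a - g p a * g e s) - 2 * \<psi> p e s a"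
proof -
  have "dot2 (\<psi> p e) (\<phi> n) = - 4 * \<phi> p e n" for n
    unfolding dot2_commute[of "\<psi> p e"] dot2_\<phi>_\<psi> using \<phi>_cyclic[of p e n] by simp
  then have "dot2 (\<psi> p e) (\<psi> s a) = \<psi> p e s a - \<psi> p e a s + 4 * dot1 (\<phi> s a) (\<phi> p e)"
    unfolding dot2_\<psi> by (simp add: dot1_linear)
  then show ?thesis
    unfolding dot1_\<phi>_\<phi> \<psi>_exchange[of s a p e]
    by (simp add: \<psi>_34[of p e s a] g_sym[of s] g_sym[of a] algebra_simps)
qed

text \<open>24 = 4 * (7 - 1), the trace of the double contraction. It is what allows an equation
  contracted with \<psi> to be solved for a vector.\<close>

lemma dot3_\<psi>_\<psi>: "dot3 (\<psi> p) (\<psi> s) = 24 * g p s"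
proof -
  have "C (\<lambda>a b. \<psi> p a s b) = 0"
    by (rule C_skew) (rule \<psi>_24)
  moreover have "C (\<lambda>a b. g p b * g a s) = g p s"
    using dot1_g(1)[of "g s" p] by (simp add: dot1_def mult.commute g_sym)
  ultimately show ?thesis
    unfolding dot3_def dot2_\<psi>_\<psi> by (simp add: contr_diff contr_cmult C_g)
qed

text \<open>The curvature acts on each slot of \<phi> in turn. By skewness of \<phi> and \<psi> the
  three terms contribute equally, each -4 times the pairing of r with \<phi>.\<close>

lemma dot3_curvature:
  "dot3 (\<lambda>a b c. dot1 (r a) (\<lambda>p. \<phi> p b c) + dot1 (r b) (\<lambda>p. \<phi> a p c) + dot1 (r c) (\<lambda>p. \<phi> a b p)) (\<psi> s)
    = - 12 * dot2 r (\<phi> s)"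
proof -
  let ?X = "\<lambda>a b c. dot1 (r a) (\<lambda>p. \<phi> p b c)"
  have 1: "dot3 ?X (\<psi> s) = - 4 * dot2 r (\<phi> s)"
  proof -
    have "dot3 ?X (\<psi> s) = C (\<lambda>a a'. dot1 (r a) (\<lambda>p. - 4 * \<phi> s a' p))"
      unfolding dot3_def dot2_dot1 dot2_\<phi>_\<psi> using \<phi>_cyclic[of s] by simp
    then show ?thesis by (simp add: dot1_linear contr_uminus contr_cmult dot2_def)
  qed
  have 2: "dot3 (\<lambda>a b c. dot1 (r b) (\<lambda>p. \<phi> a p c)) (\<psi> s) = dot3 ?X (\<psi> s)"
  proof -
    have h1: "dot1 (r b) (\<lambda>p. \<phi> a p c) = - ?X b a c" for a b c
      unfolding dot1_linear(3)[symmetric] by (intro arg_cong[of _ _ "dot1 (r b)"] ext \<phi>_12)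
    have h2: "\<psi> s = (\<lambda>a b c. - \<psi> s b a c)"
      by (intro ext \<psi>_23)
    have "dot3 (\<lambda>a b c. dot1 (r b) (\<lambda>p. \<phi> a p c)) (\<psi> s) = dot3 (\<lambda>a b c. - ?X b a c) (\<lambda>a b c. - \<psi> s b a c)"
      by (rule arg_cong2[of _ _ _ _ dot3, OF _ h2]) (intro ext h1)
    then show ?thesis using dot3_swap12[of ?X "\<psi> s"] by (simp add: dot3_linear)
  qed
  have 3: "dot3 (\<lambda>a b c. dot1 (r c) (\<lambda>p. \<phi> a b p)) (\<psi> s) = dot3 (\<lambda>a b c. dot1 (r b) (\<lambda>p. \<phi> a p c)) (\<psi> s)"
  proof -
    let ?Y = "\<lambda>a b c. dot1 (r b) (\<lambda>p. \<phi> a p c)"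
    have h1: "dot1 (r c) (\<lambda>p. \<phi> a b p) = - ?Y a c b" for a b c
      unfolding dot1_linear(3)[symmetric] by (intro arg_cong[of _ _ "dot1 (r c)"] ext \<phi>_23)
    have h2: "\<psi> s = (\<lambda>a b c. - \<psi> s a c b)"
      by (intro ext \<psi>_34)
    have "dot3 (\<lambda>a b c. dot1 (r c) (\<lambda>p. \<phi> a b p)) (\<psi> s) = dot3 (\<lambda>a b c. - ?Y a c b) (\<lambda>a b c. - \<psi> s a c b)"
      by (rule arg_cong2[of _ _ _ _ dot3, OF _ h2]) (intro ext h1)
    then show ?thesis using dot3_swap23[of ?Y "\<psi> s"] by (simp add: dot3_linear)
  qed
  show ?thesis unfolding dot3_linear 1 2 3 by simp
qed

text \<open>Here t is a row of the torsion, d the derivative of \<phi> in that direction, and the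
  first argument of \<open>dot3\<close> the derivative of \<psi> computed from the contraction
  identity. The constant is -(16 - 4).\<close>

lemma dot3_nabla_\<psi>:
  fixes t :: "7 \<Rightarrow> real" and m :: 7
  defines "d \<equiv> \<lambda>a b c. dot1 t (\<lambda>p. \<psi> p a b c)"
  shows "dot3 (\<lambda>a b c. - (dot1 (d m a) (\<phi> b c) + dot1 (\<phi> m a) (d b c))) (\<psi> s)
    = - 12 * dot1 t (\<lambda>p. \<phi> s p m)"
proof -
  have 1: "dot3 (\<lambda>a b c. dot1 (d m a) (\<phi> b c)) (\<psi> s) = 16 * dot1 t (\<lambda>p. \<phi> s p m)"
  proof -
    have "dot3 (\<lambda>a b c. dot1 (d m a) (\<phi> b c)) (\<psi> s) = C (\<lambda>a a'. dot1 (d m a) (\<lambda>e. - 4 * \<phi> s a' e))"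
    proof -
      have "dot3 (\<lambda>a b c. dot1 (d m a) (\<phi> b c)) (\<psi> s) = dot3 (\<lambda>a b c. dot1 (d m a) (\<lambda>e. \<phi> e b c)) (\<psi> s)"
        by (simp only: \<phi>_cyclic_fun[symmetric])
      then show ?thesis unfolding dot3_def dot2_dot1 dot2_\<phi>_\<psi> using \<phi>_cyclic[of s] by simp
    qed
    also have "\<dots> = - 4 * dot2 (d m) (\<phi> s)"
      by (simp add: dot1_linear contr_uminus contr_cmult dot2_def)
    also have "dot2 (d m) (\<phi> s) = dot1 t (\<lambda>p. - 4 * \<phi> s p m)"
      unfolding d_def dot2_dot1 dot2_commute[of _ "\<phi> s"] dot2_\<phi>_\<psi> ..
    finally show ?thesis by (simp add: dot1_linear)
  qed
  have d_rot: "d b c e = dot1 t (\<lambda>p. \<psi> p e b c)" for b c e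
    unfolding d_def by (simp add: \<psi>_rotate3)
  have "dot2 (\<lambda>b c. d b c e) (\<psi> s a) =
      4 * (t s * g e a - t a * g e s) - 2 * dot1 t (\<lambda>p. \<psi> p e s a)" for e a
    unfolding d_rot dot2_dot1 dot2_\<psi>_\<psi> by (simp add: dot1_linear)
  note d\<psi> = this
  have "dot3 (\<lambda>a b c. dot1 (\<phi> m a) (d b c)) (\<psi> s) =
      C (\<lambda>a a'. dot1 (\<phi> m a) (\<lambda>e. dot2 (\<lambda>b c. d b c e) (\<psi> s a')))"
    unfolding dot3_def dot2_dot1 ..
  also have "\<dots> = C (\<lambda>a a'. 4 * (t s * \<phi> m a a' - t a' * \<phi> m a s))
      - 2 * C (\<lambda>a a'. dot1 (\<phi> m a) (\<lambda>e. dot1 t (\<lambda>p. \<psi> p e s a')))"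
    unfolding d\<psi> by (simp add: dot1_linear contr_diff contr_cmult)
  also have "C (\<lambda>a a'. 4 * (t s * \<phi> m a a' - t a' * \<phi> m a s)) = - 4 * dot1 t (\<lambda>p. \<phi> m p s)"
  proof -
    have "C (\<phi> m) = 0" by (rule C_skew) (rule \<phi>_23)
    moreover have "C (\<lambda>a a'. t a' * \<phi> m a s) = dot1 t (\<lambda>p. \<phi> m p s)"
      by (subst dot1_commute) (simp add: dot1_def mult.commute)
    ultimately show ?thesis by (simp add: contr_cmult contr_diff)
  qed
  \<comment> \<open>The order of contraction is changed so that two slots of \<phi> meet two slots
    of \<psi>, and \<open>dot2_\<phi>_\<psi>\<close> applies.\<close>
  also have "C (\<lambda>a a'. dot1 (\<phi> m a) (\<lambda>e. dot1 t (\<lambda>p. \<psi> p e s a'))) = - 4 * dot1 t (\<lambda>p. \<phi> m p s)"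
  proof -
    have "C (\<lambda>a a'. dot1 (\<phi> m a) (\<lambda>e. dot1 t (\<lambda>p. \<psi> p e s a'))) =
        dot1 t (\<lambda>p. dot2 (\<phi> m) (\<lambda>a e. \<psi> p e s a))"
      unfolding dot2_def dot1_C by (subst dot1_dot1) (rule refl)
    also have "\<dots> = dot1 t (\<lambda>p. dot2 (\<phi> m) (\<psi> p s))"
      by (simp only: \<psi>_rotate3[of _ s, symmetric])
    finally show ?thesis by (simp add: dot2_\<phi>_\<psi> dot1_linear)
  qed
  finally have 2: "dot3 (\<lambda>a b c. dot1 (\<phi> m a) (d b c)) (\<psi> s) = 4 * dot1 t (\<lambda>p. \<phi> m p s)" by simp
  have "\<phi> m p s = - \<phi> s p m" for p
    using \<phi>_cyclic[of m p s] \<phi>_23[of s m p] by simp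
  then have "dot1 t (\<lambda>p. \<phi> m p s) = - dot1 t (\<lambda>p. \<phi> s p m)"
    by (simp add: dot1_linear)
  then show ?thesis unfolding dot3_linear 1 2 by simp
qed

text \<open>Contracting the Ricci identity for \<open>\<phi>\<close> with \<open>\<psi>\<close> solves for the skew-symmetrised derivative
  of the torsion (here \<open>D\<close>, for fixed \<open>i\<close> and \<open>j\<close>).\<close>
lemma skew_torsion_derivative:
  fixes D t u :: "7 \<Rightarrow> real" and r :: "7 \<Rightarrow> 7 \<Rightarrow> real"
  defines "d \<equiv> \<lambda>t a b c. dot1 t (\<lambda>p. \<psi> p a b c)"
  defines "e \<equiv> \<lambda>t m a b c. - (dot1 (d t m a) (\<phi> b c) + dot1 (\<phi> m a) (d t b c))"
  assumes E: "\<And>a b c. dot1 D (\<lambda>n. \<psi> n a b c) + dot1 u (\<lambda>n. e t n a b c) - dot1 t (\<lambda>n. e u n a b c) =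
      - (dot1 (r a) (\<lambda>p. \<phi> p b c) + dot1 (r b) (\<lambda>p. \<phi> a p c) + dot1 (r c) (\<lambda>p. \<phi> a b p))"
  shows "D s = dot1 u (\<lambda>m. dot1 t (\<lambda>p. \<phi> s p m)) + dot2 r (\<phi> s) / 2"
proof -
  have e: "dot3 (e t m) (\<psi> s) = - 12 * dot1 t (\<lambda>p. \<phi> s p m)" for t m
    unfolding e_def d_def by (rule dot3_nabla_\<psi>)
  have "dot3 (\<lambda>a b c. dot1 D (\<lambda>n. \<psi> n a b c) + dot1 u (\<lambda>n. e t n a b c) - dot1 t (\<lambda>n. e u n a b c)) (\<psi> s)
      = 24 * D s - 12 * dot1 u (\<lambda>m. dot1 t (\<lambda>p. \<phi> s p m)) + 12 * dot1 t (\<lambda>m. dot1 u (\<lambda>p. \<phi> s p m))"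
    unfolding dot3_linear dot3_dot1 e dot3_\<psi>_\<psi> by (simp add: dot1_linear)
  \<comment> \<open>Because of this sign the two quadratic terms add up to 24 times one of them;
    dividing by 24 leaves the curvature term with 12/24 = 1/2.\<close>
  also have "dot1 t (\<lambda>m. dot1 u (\<lambda>p. \<phi> s p m)) = - dot1 u (\<lambda>m. dot1 t (\<lambda>p. \<phi> s p m))"
  proof -
    have "dot1 t (\<lambda>m. dot1 u (\<lambda>p. \<phi> s p m)) = dot1 u (\<lambda>p. dot1 t (\<lambda>m. - \<phi> s m p))"
      by (subst dot1_dot1) (simp add: \<phi>_23[symmetric])
    then show ?thesis by (simp add: dot1_linear)
  qed
  also have "dot3 (\<lambda>a b c. dot1 D (\<lambda>n. \<psi> n a b c) + dot1 u (\<lambda>n. e t n a b c) - dot1 t (\<lambda>n. e u n a b c)) (\<psi> s)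
      = 12 * dot2 r (\<phi> s)"
    unfolding E by (subst dot3_linear, subst dot3_curvature) simp
  finally show ?thesis by simp
qed

text \<open>Contracting S with \<phi> brings in the contraction identity in both terms of S. Its
  metric part gives the products of two torsions without \<psi>, and the curvature twice, which
  cancels the factor 1/2; its \<psi> part gives the last term and a pairing that must
  vanish.\<close>

lemma ricci_from_torsion:
  fixes R :: "7 \<Rightarrow> 7 \<Rightarrow> 7 \<Rightarrow> 7 \<Rightarrow> real" and T :: "7 \<Rightarrow> 7 \<Rightarrow> real" and S :: "7 \<Rightarrow> 7 \<Rightarrow> 7 \<Rightarrow> real"
  assumes S: "\<And>i j s. S i j s = dot1 (T j) (\<lambda>m. dot1 (T i) (\<lambda>p. \<phi> s p m)) + dot2 (R i j) (\<phi> s) / 2"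
    and R34: "\<And>i j k l. R i j l k = - R i j k l"
    and pair: "\<And>i j k l. R k l i j = R i j k l"
    and bianchi: "\<And>i j k l. R i j k l + R j k i l + R k i j l = 0"
  shows "C (\<lambda>i l. R i j k l) = C (\<lambda>i l. dot1 (S i j) (\<lambda>n. \<phi> n k l))
    - dot1 (T j) (\<lambda>i. T i k) + C T * T j k
    - C (\<lambda>i l. dot1 (T j) (\<lambda>q. dot1 (T i) (\<lambda>p. \<psi> l p q k)))"
proof -
  have \<phi>\<phi>: "dot1 (\<lambda>s. \<phi> s a b) (\<lambda>n. \<phi> n k l) = g a k * g b l - g a l * g b k - \<psi> a b k l" for a b l
    using dot1_\<phi>_\<phi>[of a b k l] by (simp only: \<phi>_cyclic_fun[symmetric])
  have "dot1 (S i j) (\<lambda>n. \<phi> n k l) =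
      dot1 (T j) (\<lambda>m. dot1 (T i) (\<lambda>p. g p k * g m l - g p l * g m k - \<psi> p m k l))
      + dot2 (R i j) (\<lambda>a b. g a k * g b l - g a l * g b k - \<psi> a b k l) / 2" for i l
  proof -
    have "S i j = (\<lambda>s. dot1 (T j) (\<lambda>m. dot1 (T i) (\<lambda>p. \<phi> s p m)) + dot2 (R i j) (\<phi> s) / 2)"
      by (simp add: S fun_eq_iff)
    moreover have "dot1 (\<lambda>s. dot2 (R i j) (\<phi> s)) (\<lambda>n. \<phi> n k l) =
        dot2 (R i j) (\<lambda>a b. dot1 (\<lambda>s. \<phi> s a b) (\<lambda>n. \<phi> n k l))"
      unfolding dot1_commute[of _ "\<lambda>n. \<phi> n k l"] dot2_commute[of "R i j"] dot2_dot1 ..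
    moreover have "dot1 (\<lambda>s. dot1 (T j) (\<lambda>m. dot1 (T i) (\<lambda>p. \<phi> s p m))) (\<lambda>n. \<phi> n k l) =
        dot1 (T j) (\<lambda>m. dot1 (T i) (\<lambda>p. dot1 (\<lambda>s. \<phi> s p m) (\<lambda>n. \<phi> n k l)))"
      unfolding dot1_dot1_left ..
    ultimately show ?thesis
      unfolding \<phi>\<phi> by (simp add: dot1_linear dot1_divide)
  qed
  also have "\<dots> i l = T i k * T j l - T i l * T j k + dot1 (T j) (\<lambda>q. dot1 (T i) (\<lambda>p. \<psi> l p q k))
      + R i j k l - 1 / 2 * dot2 (R i j) (\<psi> k l)" for i l
  proof -
    have "\<psi> p m k l = - \<psi> l p m k" for p m by (rule \<psi>_rotate4)
    moreover have "dot2 (R i j) (\<lambda>a b. \<psi> l a b k) = - dot2 (R i j) (\<psi> k l)"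
      unfolding dot2_linear(3)[symmetric] by (intro arg_cong[of _ _ "dot2 (R i j)"] ext \<psi>_rotate4)
    ultimately show ?thesis
      using dot2_gg[of "R i j" k l] R34[of i j k l]
      by (simp add: dot1_linear dot2_linear g_sym[of _ k] g_sym[of _ l] mult.commute)
  qed
  finally have "C (\<lambda>i l. dot1 (S i j) (\<lambda>n. \<phi> n k l)) =
      C (\<lambda>i l. T j l * T i k) - C T * T j k + C (\<lambda>i l. dot1 (T j) (\<lambda>q. dot1 (T i) (\<lambda>p. \<psi> l p q k)))
      + C (\<lambda>i l. R i j k l) - C (\<lambda>i l. dot2 (R i j) (\<psi> k l)) / 2"
    by (simp only: contr_add contr_diff contr_multc contr_cmult mult.commute[of "T _ k"])
  moreover have "C (\<lambda>i l. T j l * T i k) = dot1 (T j) (\<lambda>i. T i k)"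
    by (subst C_sym[symmetric]) (simp add: dot1_def)
  \<comment> \<open>For fixed j this is the pairing of \<open>?Q\<close> with
    \<open>\<psi> k\<close>. Cyclic rotation of three slots leaves \<open>\<psi> k\<close>
    invariant, while the cyclic sum of \<open>?Q\<close> is zero by the pair symmetry and the
    Bianchi identity; so three times the pairing is zero.\<close>
  moreover have "C (\<lambda>i l. dot2 (R i j) (\<psi> k l)) = 0"
  proof -
    let ?Q = "\<lambda>i a b. R i j a b"
    have rot: "dot3 (\<lambda>a b c. X b c a) (\<psi> k) = dot3 X (\<psi> k)" for X
    proof -
      have "dot3 (\<lambda>a b c. X b c a) (\<psi> k) = dot3 (\<lambda>a b c. X b c a) (\<lambda>a b c. \<psi> k b c a)"
        by (simp add: \<psi>_rotate3)
      also have "\<dots> = dot3 (\<lambda>a b c. X a c b) (\<lambda>a b c. \<psi> k a c b)"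
        by (rule dot3_swap12[of "\<lambda>a b c. X a c b" "\<lambda>a b c. \<psi> k a c b"])
      finally show ?thesis using dot3_swap23[of X "\<psi> k"] by simp
    qed
    have "?Q a b c + ?Q b c a + ?Q c a b = 0" for a b c
      using bianchi[of a b c j] pair[of b c a j] pair[of c a b j] pair[of a b c j] by linarith
    then have "dot3 (\<lambda>a b c. ?Q a b c + ?Q b c a + ?Q c a b) (\<psi> k) = 0"
      by (simp add: dot3_linear)
    then have "dot3 ?Q (\<psi> k) = 0"
      unfolding dot3_linear using rot[of ?Q] rot[of "\<lambda>a b c. ?Q b c a"] by simp
    then show ?thesis by (simp add: dot3_def)
  qed
  ultimately show ?thesis by simp
qed

end

section \<open>Alternating forms\<close>

lemma lists_Suc: "{xs :: 'n list. length xs = Suc n} = (\<lambda>(i, xs). i # xs) ` (UNIV \<times> {xs. length xs = n})"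
  by (auto simp: length_Suc_conv)

lemma sum_lists_Suc:
  "(\<Sum>is :: 'n::finite list | length is = Suc n. f is) = (\<Sum>i\<in>UNIV. \<Sum>is | length is = n. f (i # is))"
  unfolding lists_Suc
  by (subst sum.reindex) (auto simp: inj_on_def sum.cartesian_product case_prod_beta)

lemma sum_lists_0: "(\<Sum>is | length is = 0. f is) = f []"
  by simp

lemma sum_lists_permute:
  fixes f :: "'n list \<Rightarrow> 'b::comm_monoid_add"
  assumes "\<sigma> permutes {..<n}"
  shows "(\<Sum>is | length is = n. f (permute_list \<sigma> is)) = (\<Sum>is | length is = n. f is)"
proof (rule sum.reindex_bij_witness[where i = "permute_list (inv \<sigma>)" and j = "permute_list \<sigma>"])
  fix xs :: "'n list" assume "xs \<in> {xs. length xs = n}"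
  then have n: "length xs = n" by simp
  show "permute_list (inv \<sigma>) (permute_list \<sigma> xs) = xs"
    using permute_list_compose[of "inv \<sigma>" xs \<sigma>] permutes_inv[OF assms] permutes_inv_o[OF assms] n by simp
  show "permute_list \<sigma> (permute_list (inv \<sigma>) xs) = xs"
    using permute_list_compose[of \<sigma> xs "inv \<sigma>"] assms permutes_inv_o[OF assms] n by simp
qed auto

lemma permute_list_append_left:
  assumes "\<sigma> permutes {..<length xs}"
  shows "permute_list \<sigma> (xs @ ys) = permute_list \<sigma> xs @ ys"
proof (rule nth_equalityI)
  fix r assume r: "r < length (permute_list \<sigma> (xs @ ys))"
  have "\<sigma> permutes {..<length (xs @ ys)}" by (rule permutes_subset[OF assms]) auto
  then have "permute_list \<sigma> (xs @ ys) ! r = (xs @ ys) ! \<sigma> r"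
    using r by (simp add: permute_list_nth)
  also have "\<dots> = (permute_list \<sigma> xs @ ys) ! r"
  proof (cases "r < length xs")
    case True
    then have "\<sigma> r < length xs" using permutes_in_image[OF assms, of r] by simp
    then show ?thesis using True assms by (simp add: nth_append permute_list_nth)
  next
    case False
    then have "\<sigma> r = r" using permutes_not_in[OF assms, of r] by simp
    then show ?thesis using False by (simp add: nth_append)
  qed
  finally show "permute_list \<sigma> (xs @ ys) ! r = (permute_list \<sigma> xs @ ys) ! r" .
qed simp

lemma alternating_permute:
  "alternating k \<alpha> \<Longrightarrow> \<sigma> permutes {..<k} \<Longrightarrow> length is = k \<Longrightarrow>
    \<alpha> (permute_list \<sigma> is) = of_int (sign \<sigma>) * \<alpha> is"
  unfolding alternating_def by blast

lemma alternating_swap: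
  assumes "alternating k \<alpha>" "length is = k" "r < k" "s < k" "r \<noteq> s"
  shows "\<alpha> (is[r := is ! s, s := is ! r]) = - \<alpha> is"
proof -
  have p: "Transposition.transpose r s permutes {..<length is}" using assms by (simp add: permutes_swap_id)
  have "permute_list (Transposition.transpose r s) is = is[r := is ! s, s := is ! r]"
    by (rule nth_equalityI) (use assms in \<open>auto simp: permute_list_nth[OF p] nth_list_update Transposition.transpose_def\<close>)
  then show ?thesis
    using alternating_permute[OF assms(1), of "Transposition.transpose r s" "is"] p assms by (simp add: sign_swap_id)
qed

lemma alternating_not_distinct:
  assumes "alternating k \<alpha>" "length is = k" "\<not> distinct is"
  shows "\<alpha> is = 0"
proof -
  obtain r s where rs: "r < k" "s < k" "r \<noteq> s" "is ! r = is ! s"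
    using assms(2,3) by (auto simp: distinct_conv_nth)
  then have "is[r := is ! s, s := is ! r] = is" by (metis list_update_id)
  then show ?thesis using alternating_swap[OF assms(1,2) rs(1-3)] by simp
qed

lemma alternating_swaps:
  "alternating 3 \<alpha> \<Longrightarrow> \<alpha> [b, a, c] = - \<alpha> [a, b, c]"
  "alternating 3 \<alpha> \<Longrightarrow> \<alpha> [a, c, b] = - \<alpha> [a, b, c]"
  using alternating_swap[of 3 \<alpha> "[a, b, c]" 0 1] alternating_swap[of 3 \<alpha> "[a, b, c]" 1 2] by auto

lemma alternating_swaps7:
  assumes "alternating 7 \<alpha>"
  shows "\<alpha> [b, a, c, d, e, f, h] = - \<alpha> [a, b, c, d, e, f, h]"
    and "\<alpha> [a, c, b, d, e, f, h] = - \<alpha> [a, b, c, d, e, f, h]"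
    and "\<alpha> [a, b, d, c, e, f, h] = - \<alpha> [a, b, c, d, e, f, h]"
    and "\<alpha> [a, b, c, e, d, f, h] = - \<alpha> [a, b, c, d, e, f, h]"
    and "\<alpha> [a, b, c, d, f, e, h] = - \<alpha> [a, b, c, d, e, f, h]"
    and "\<alpha> [a, b, c, d, e, h, f] = - \<alpha> [a, b, c, d, e, f, h]"
  using alternating_swap[OF assms, of "[a, b, c, d, e, f, h]" 0 1]
    alternating_swap[OF assms, of "[a, b, c, d, e, f, h]" 1 2]
    alternating_swap[OF assms, of "[a, b, c, d, e, f, h]" 2 3]
    alternating_swap[OF assms, of "[a, b, c, d, e, f, h]" 3 4]
    alternating_swap[OF assms, of "[a, b, c, d, e, f, h]" 4 5]
    alternating_swap[OF assms, of "[a, b, c, d, e, f, h]" 5 6]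
  by (simp_all add: numeral_eq_Suc)

text \<open>The row index of P belongs to the space of \<alpha>. Peeling off one index at a time
  suits concrete lists and induction; \<open>pullback_eq\<close> is the closed form. With the
  inverse metric as matrix the same operation raises all indices at once.\<close>

fun pullback :: "('m \<Rightarrow> 'n \<Rightarrow> real) \<Rightarrow> ('m::finite list \<Rightarrow> real) \<Rightarrow> 'n list \<Rightarrow> real" where
  "pullback P \<alpha> [] = \<alpha> []"
| "pullback P \<alpha> (j # js) = (\<Sum>i\<in>UNIV. P i j * pullback P (\<lambda>is. \<alpha> (i # is)) js)"

lemma pullback_cong:
  "(\<And>is. length is = length js \<Longrightarrow> \<alpha> is = \<beta> is) \<Longrightarrow> pullback P \<alpha> js = pullback P \<beta> js"
proof (induction js arbitrary: \<alpha> \<beta>)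
  case (Cons j js)
  have "pullback P (\<lambda>is. \<alpha> (i # is)) js = pullback P (\<lambda>is. \<beta> (i # is)) js" for i
    by (rule Cons.IH) (simp add: Cons.prems)
  then show ?case by simp
qed simp

lemma pullback_sum: "pullback P (\<lambda>is. \<Sum>k\<in>K. \<alpha> k is) js = (\<Sum>k\<in>K. pullback P (\<alpha> k) js)"
proof (induction js arbitrary: \<alpha>)
  case (Cons j js)
  then show ?case by (simp add: sum_distrib_left) (rule sum.swap)
qed simp

lemma pullback_cmult: "pullback P (\<lambda>is. c * \<alpha> is) js = c * pullback P \<alpha> js"
  by (induction js arbitrary: \<alpha>) (auto simp: sum_distrib_left mult_ac)

lemma pullback_multc: "pullback P (\<lambda>is. \<alpha> is * c) js = pullback P \<alpha> js * c"
  using pullback_cmult[of P c \<alpha> js] by (simp add: mult.commute)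

lemma pullback_diff: "pullback P (\<lambda>is. \<alpha> is - \<beta> is) js = pullback P \<alpha> js - pullback P \<beta> js"
  by (induction js arbitrary: \<alpha> \<beta>) (auto simp: sum_subtractf right_diff_distrib)

lemma pullback_eq:
  "pullback P \<alpha> js = (\<Sum>is | length is = length js. (\<Prod>r<length js. P (is ! r) (js ! r)) * \<alpha> is)"
proof (induction js arbitrary: \<alpha>)
  case (Cons j js)
  then show ?case
    by (simp add: sum_lists_Suc prod.lessThan_Suc_shift sum_distrib_left mult.assoc
        del: prod.lessThan_Suc)
qed simp

lemma pullback_append:
  "pullback P \<alpha> (js @ ks) = pullback P (\<lambda>is. pullback P (\<lambda>ls. \<alpha> (is @ ls)) ks) js"
  by (induction js arbitrary: \<alpha>) auto

lemma pullback_tensor: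
  assumes "length js = k"
  shows "pullback P (\<lambda>is. \<alpha> (take k is) * \<beta> (drop k is)) (js @ ks) = pullback P \<alpha> js * pullback P \<beta> ks"
proof -
  have "pullback P (\<lambda>is. \<alpha> (take k is) * \<beta> (drop k is)) (js @ ks) =
      pullback P (\<lambda>is. pullback P (\<lambda>ls. \<alpha> is * \<beta> ls) ks) js"
    unfolding pullback_append by (rule pullback_cong) (simp add: assms)
  then show ?thesis by (simp add: pullback_cmult pullback_multc)
qed

lemma pullback_pullback:
  "pullback Q (pullback P \<alpha>) js = pullback (\<lambda>i j. \<Sum>k\<in>UNIV. P i k * Q k j) \<alpha> js"
proof (induction js arbitrary: \<alpha>)
  case (Cons j js)
  have "pullback Q (pullback P \<alpha>) (j # js) =
      (\<Sum>k\<in>UNIV. \<Sum>i\<in>UNIV. Q k j * (P i k * pullback Q (pullback P (\<lambda>is. \<alpha> (i # is))) js))"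
    by (simp add: pullback_sum pullback_cmult sum_distrib_left)
  also have "\<dots> = (\<Sum>i\<in>UNIV. (\<Sum>k\<in>UNIV. P i k * Q k j) * pullback Q (pullback P (\<lambda>is. \<alpha> (i # is))) js)"
    by (subst sum.swap) (simp add: sum_distrib_right mult_ac)
  finally show ?case by (simp add: Cons.IH)
qed simp

lemma pullback_ident: "pullback (\<lambda>i j. if i = j then 1 else 0) \<alpha> js = \<alpha> js"
proof (induction js arbitrary: \<alpha>)
  case (Cons j js)
  then show ?case by (simp add: if_distrib[of "\<lambda>c. c * _"] cong: if_cong)
qed simp

lemma pullback_alternating:
  fixes \<alpha> :: "'m::finite list \<Rightarrow> real" and P :: "'m \<Rightarrow> 'n \<Rightarrow> real"
  assumes "alternating k \<alpha>"
  shows "alternating k (pullback P \<alpha>)"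
  unfolding alternating_def
proof (intro allI impI)
  fix js :: "'n list" and \<sigma> assume js: "length js = k" and \<sigma>: "\<sigma> permutes {..<k}"
  have prod: "(\<Prod>r<k. P (permute_list \<sigma> is ! r) (permute_list \<sigma> js ! r)) = (\<Prod>r<k. P (is ! r) (js ! r))"
    if "length is = k" for "is" :: "'m list"
  proof -
    have "(\<Prod>r<k. P (permute_list \<sigma> is ! r) (permute_list \<sigma> js ! r)) = (\<Prod>r<k. P (is ! \<sigma> r) (js ! \<sigma> r))"
      using \<sigma> js that by (intro prod.cong) (auto simp: permute_list_nth)
    also have "\<dots> = (\<Prod>r<k. P (is ! r) (js ! r))"
      using prod.permute[OF \<sigma>, of "\<lambda>r. P (is ! r) (js ! r)"] by (simp add: o_def)
    finally show ?thesis .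
  qed
  have "pullback P \<alpha> (permute_list \<sigma> js) =
      (\<Sum>is | length is = k. (\<Prod>r<k. P (permute_list \<sigma> is ! r) (permute_list \<sigma> js ! r)) * \<alpha> (permute_list \<sigma> is))"
    unfolding pullback_eq using js by (simp add: sum_lists_permute[OF \<sigma>, of "\<lambda>is. (\<Prod>r<k. P (is ! r) (permute_list \<sigma> js ! r)) * \<alpha> is"])
  also have "\<dots> = (\<Sum>is | length is = k. of_int (sign \<sigma>) * ((\<Prod>r<k. P (is ! r) (js ! r)) * \<alpha> is))"
    by (intro sum.cong) (auto simp: prod alternating_permute[OF assms \<sigma>])
  finally show "pullback P \<alpha> (permute_list \<sigma> js) = of_int (sign \<sigma>) * pullback P \<alpha> js"
    unfolding pullback_eq using js by (simp add: sum_distrib_left)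
qed

section \<open>Forms of top degree in dimension seven\<close>

definition idx7 :: "7 list" where "idx7 = [1, 2, 3, 4, 5, 6, 7]"

lemma length_idx7 [simp]: "length idx7 = 7"
  and distinct_idx7: "distinct idx7"
  by (simp_all add: idx7_def)

lemma set_idx7: "set idx7 = UNIV"
  using distinct_card[OF distinct_idx7] by (intro card_subset_eq) auto

lemma UNIV_7: "(UNIV :: 7 set) = {1, 2, 3, 4, 5, 6, 7}"
  using set_idx7 by (simp add: idx7_def)

lemma forall_7: "(\<forall>i::7. P i) \<longleftrightarrow> P 1 \<and> P 2 \<and> P 3 \<and> P 4 \<and> P 5 \<and> P 6 \<and> P 7"
proof -
  have "(\<forall>i::7. P i) \<longleftrightarrow> (\<forall>i\<in>UNIV. P i)" by simp
  then show ?thesis unfolding UNIV_7 by simp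
qed

lemma bij_betw_nth_idx7: "bij_betw ((!) idx7) {..<7} UNIV"
  using bij_betw_nth[OF distinct_idx7, of "{..<7}" UNIV] by (simp add: set_idx7)

text \<open>Only lists without repetition contribute, and these are the rearrangements of
  \<open>idx7\<close>, each from exactly one permutation of positions.\<close>

lemma sum_alternating7:
  fixes F :: "7 list \<Rightarrow> real"
  assumes "alternating 7 \<alpha>"
  shows "(\<Sum>is | length is = 7. \<alpha> is * F is) =
    \<alpha> idx7 * (\<Sum>\<sigma> | \<sigma> permutes {..<7}. of_int (sign \<sigma>) * F (permute_list \<sigma> idx7))"
proof -
  have bij: "bij_betw (\<lambda>\<sigma>. permute_list \<sigma> idx7) {\<sigma>. \<sigma> permutes {..<7}} {is. length is = 7 \<and> distinct is}"
  proof (rule bij_betwI')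
    fix \<sigma> \<tau> assume "\<sigma> \<in> {\<sigma>. \<sigma> permutes {..<7::nat}}" "\<tau> \<in> {\<sigma>. \<sigma> permutes {..<7::nat}}"
    then have p: "\<sigma> permutes {..<length idx7}" "\<tau> permutes {..<length idx7}" by simp_all
    show "permute_list \<sigma> idx7 = permute_list \<tau> idx7 \<longleftrightarrow> \<sigma> = \<tau>"
    proof
      assume eq: "permute_list \<sigma> idx7 = permute_list \<tau> idx7"
      show "\<sigma> = \<tau>"
      proof
        fix r show "\<sigma> r = \<tau> r"
        proof (cases "r < length idx7")
          case True
          then have "idx7 ! \<sigma> r = idx7 ! \<tau> r"
            using permute_list_nth[OF p(1) True] permute_list_nth[OF p(2) True] eq by simp
          moreover have "\<sigma> r < length idx7" "\<tau> r < length idx7"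
            using True permutes_in_image[OF p(1), of r] permutes_in_image[OF p(2), of r] by auto
          ultimately show ?thesis using nth_eq_iff_index_eq[OF distinct_idx7] by blast
        next
          case False
          then show ?thesis using permutes_not_in[OF p(1)] permutes_not_in[OF p(2)] by simp
        qed
      qed
    qed simp
  next
    fix \<sigma> assume "\<sigma> \<in> {\<sigma>. \<sigma> permutes {..<7::nat}}"
    then have "\<sigma> permutes {..<length idx7}" by simp
    then have "mset (permute_list \<sigma> idx7) = mset idx7" by simp
    then have "distinct (permute_list \<sigma> idx7)"
      using mset_eq_imp_distinct_iff distinct_idx7 by blast
    then show "permute_list \<sigma> idx7 \<in> {is. length is = 7 \<and> distinct is}" by simp
  next
    fix xs :: "7 list" assume "xs \<in> {is. length is = 7 \<and> distinct is}"
    then have xs: "length xs = 7" "distinct xs" by auto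
    have "set xs = UNIV"
      using xs distinct_card[OF xs(2)] by (intro card_subset_eq) auto
    then have "mset xs = mset idx7"
      using xs(2) set_eq_iff_mset_eq_distinct[OF xs(2) distinct_idx7] by (simp add: set_idx7)
    from mset_eq_permutation[OF this] show "\<exists>\<sigma>\<in>{\<sigma>. \<sigma> permutes {..<7}}. xs = permute_list \<sigma> idx7"
      by (metis CollectI length_idx7)
  qed
  have "(\<Sum>is | length is = 7. \<alpha> is * F is) = (\<Sum>is | length is = 7 \<and> distinct is. \<alpha> is * F is)"
    by (rule sum.mono_neutral_right)
      (auto simp: alternating_not_distinct[OF assms] finite_list_length)
  also have "\<dots> = (\<Sum>\<sigma> | \<sigma> permutes {..<7}. \<alpha> (permute_list \<sigma> idx7) * F (permute_list \<sigma> idx7))"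
    by (rule sum.reindex_bij_betw[OF bij, symmetric])
  also have "\<dots> = (\<Sum>\<sigma> | \<sigma> permutes {..<7}. \<alpha> idx7 * (of_int (sign \<sigma>) * F (permute_list \<sigma> idx7)))"
    by (intro sum.cong) (auto simp: alternating_permute[OF assms])
  finally show ?thesis by (simp add: sum_distrib_left)
qed

text \<open>\<open>det\<close> sums over permutations of the index type, the form over permutations
  of positions. Transport along \<open>idx7\<close> identifies them and preserves signs; the result
  is the determinant of the transpose.\<close>

lemma pullback_top_form:
  fixes P :: "7 \<Rightarrow> 7 \<Rightarrow> real"
  assumes "alternating 7 \<alpha>"
  shows "pullback P \<alpha> idx7 = \<alpha> idx7 * det (\<chi> i j. P i j)"
proof -
  let ?h = "(!) idx7" and ?m = "map_permutation {..<7} ((!) idx7)"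
  have bij: "bij_betw ?m {\<sigma>. \<sigma> permutes {..<7}} {p. p permutes UNIV}"
  proof (rule bij_betwI[where g = "map_permutation UNIV (inv_into {..<7} ?h)"])
    note h = bij_betw_nth_idx7 and h' = bij_betw_inv_into[OF bij_betw_nth_idx7]
    show "?m \<in> {\<sigma>. \<sigma> permutes {..<7}} \<rightarrow> {p. p permutes UNIV}"
      using map_permutation_permutes[OF h] by auto
    show "map_permutation UNIV (inv_into {..<7} ?h) \<in> {p. p permutes UNIV} \<rightarrow> {\<sigma>. \<sigma> permutes {..<7}}"
      using map_permutation_permutes[OF h'] by auto
    show "map_permutation UNIV (inv_into {..<7} ?h) (?m \<sigma>) = \<sigma>" if "\<sigma> \<in> {\<sigma>. \<sigma> permutes {..<7}}" for \<sigma>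
      using that h by (intro map_permutation_compose_inv[OF h]) (auto simp: bij_betw_inv_into_left)
    show "?m (map_permutation UNIV (inv_into {..<7} ?h) p) = p" if "p \<in> {p. p permutes UNIV}" for p
      using that h by (intro map_permutation_compose_inv[OF h']) (auto simp: bij_betw_inv_into_right)
  qed
  have step: "of_int (sign (?m \<sigma>)) * (\<Prod>i\<in>UNIV. P (?m \<sigma> i) i) =
      of_int (sign \<sigma>) * (\<Prod>r<7. P (permute_list \<sigma> idx7 ! r) (idx7 ! r))"
    if \<sigma>: "\<sigma> permutes {..<7}" for \<sigma>
  proof -
    have inj: "inj_on ?h {..<7}" using bij_betw_nth_idx7 bij_betw_def by blast
    have "(\<Prod>i\<in>UNIV. P (?m \<sigma> i) i) = (\<Prod>r<7. P (?m \<sigma> (?h r)) (?h r))"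
      using prod.reindex_bij_betw[OF bij_betw_nth_idx7, of "\<lambda>i. P (?m \<sigma> i) i"] by simp
    also have "\<dots> = (\<Prod>r<7. P (permute_list \<sigma> idx7 ! r) (idx7 ! r))"
      using \<sigma> by (intro prod.cong) (simp_all add: map_permutation_apply[OF inj] permute_list_nth)
    finally show ?thesis by (simp add: sign_map_permutation[OF inj \<sigma>])
  qed
  have "pullback P \<alpha> idx7 = (\<Sum>is | length is = 7. \<alpha> is * (\<Prod>r<7. P (is ! r) (idx7 ! r)))"
    by (simp add: pullback_eq mult.commute)
  also have "\<dots> = \<alpha> idx7 * (\<Sum>\<sigma> | \<sigma> permutes {..<7}. of_int (sign (?m \<sigma>)) * (\<Prod>i\<in>UNIV. P (?m \<sigma> i) i))"
    unfolding sum_alternating7[OF assms] by (auto intro!: sum.cong simp: step)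
  also have "(\<Sum>\<sigma> | \<sigma> permutes {..<7}. of_int (sign (?m \<sigma>)) * (\<Prod>i\<in>UNIV. P (?m \<sigma> i) i)) =
      (\<Sum>p | p permutes UNIV. of_int (sign p) * (\<Prod>i\<in>UNIV. P (p i) i))"
    by (rule sum.reindex_bij_betw[OF bij])
  also have "\<dots> = det (transpose (\<chi> i j. P i j))"
    by (simp add: det_def transpose_def)
  finally show ?thesis by simp
qed

text \<open>The factor \<open>\<omega> idx7\<close> trades the antisymmetrisation for a contraction
  over all index lists, in which a linear map can be moved across by \<open>sum_pullback\<close>.
  The factor is cancelled at the end of \<open>wedge_pullback\<close>.\<close>

lemma wedge_idx7:
  assumes "alternating 7 \<omega>" and kl: "k + l = 7"
  shows "\<omega> idx7 * wedge k l \<alpha> \<beta> idx7 =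
    (\<Sum>is | length is = 7. \<omega> is * (\<alpha> (take k is) * \<beta> (drop k is))) / (fact k * fact l)"
  unfolding wedge_def kl sum_alternating7[OF assms(1)] by (simp add: mult.assoc)

text \<open>Against an alternating form the antisymmetrisation hidden in a wedge factor is redundant.\<close>
lemma sum_alternating_wedge:
  fixes \<omega> :: "'n::finite list \<Rightarrow> real"
  assumes \<omega>: "alternating n \<omega>" and kl: "k + l \<le> n"
  shows "(\<Sum>is | length is = n. \<omega> is * (wedge k l \<alpha> \<beta> (take (k + l) is) * \<gamma> (drop (k + l) is))) =
    fact (k + l) / (fact k * fact l) *
      (\<Sum>is | length is = n. \<omega> is * (\<alpha> (take k is) * \<beta> (take l (drop k is)) * \<gamma> (drop (k + l) is)))"
proof -
  define H where "H is = \<alpha> (take k is) * \<beta> (take l (drop k is)) * \<gamma> (drop (k + l) is)" for "is" :: "'n list"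
  have "(\<Sum>is | length is = n. \<omega> is * (wedge k l \<alpha> \<beta> (take (k + l) is) * \<gamma> (drop (k + l) is))) =
     (\<Sum>is | length is = n. \<Sum>\<sigma> | \<sigma> permutes {..<k + l}.
        \<omega> (permute_list \<sigma> is) * H (permute_list \<sigma> is) / (fact k * fact l))"
  proof (rule sum.cong[OF refl])
    fix xs :: "'n list" assume "xs \<in> {xs. length xs = n}"
    then have xs: "length xs = n" by simp
    have "\<omega> (permute_list \<sigma> xs) * H (permute_list \<sigma> xs) =
       \<omega> xs * (of_int (sign \<sigma>) * \<alpha> (take k (permute_list \<sigma> (take (k + l) xs))) *
         \<beta> (drop k (permute_list \<sigma> (take (k + l) xs))) * \<gamma> (drop (k + l) xs))"
      if \<sigma>: "\<sigma> permutes {..<k + l}" for \<sigma>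
    proof -
      have "permute_list \<sigma> (take (k + l) xs @ drop (k + l) xs) = permute_list \<sigma> (take (k + l) xs) @ drop (k + l) xs"
        by (rule permute_list_append_left) (use \<sigma> xs kl in simp)
      then have eq: "permute_list \<sigma> xs = permute_list \<sigma> (take (k + l) xs) @ drop (k + l) xs" by simp
      have "\<sigma> permutes {..<n}" by (rule permutes_subset[OF \<sigma>]) (use kl in auto)
      then have "\<omega> (permute_list \<sigma> xs) = of_int (sign \<sigma>) * \<omega> xs"
        using alternating_permute[OF \<omega>] xs by blast
      moreover have "H (permute_list \<sigma> xs) = \<alpha> (take k (permute_list \<sigma> (take (k + l) xs))) *
         \<beta> (drop k (permute_list \<sigma> (take (k + l) xs))) * \<gamma> (drop (k + l) xs)"
        unfolding H_def eq using xs kl by (simp add: min_def)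
      ultimately show ?thesis by simp
    qed
    then show "\<omega> xs * (wedge k l \<alpha> \<beta> (take (k + l) xs) * \<gamma> (drop (k + l) xs)) =
      (\<Sum>\<sigma> | \<sigma> permutes {..<k + l}. \<omega> (permute_list \<sigma> xs) * H (permute_list \<sigma> xs) / (fact k * fact l))"
      by (simp add: wedge_def sum_divide_distrib[symmetric] sum_distrib_left sum_distrib_right)
  qed
  also have "\<dots> = (\<Sum>\<sigma> | \<sigma> permutes {..<k + l}. \<Sum>is | length is = n.
        \<omega> (permute_list \<sigma> is) * H (permute_list \<sigma> is) / (fact k * fact l))"
    by (rule sum.swap)
  \<comment> \<open>Reindexing the lists by the permutation makes all (k + l)! inner sums
    equal.\<close>
  also have "\<dots> = (\<Sum>\<sigma> | \<sigma> permutes {..<k + l}. \<Sum>is | length is = n. \<omega> is * H is / (fact k * fact l))"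
  proof (rule sum.cong[OF refl])
    fix \<sigma> assume "\<sigma> \<in> {\<sigma>. \<sigma> permutes {..<k + l}}"
    then have "\<sigma> permutes {..<n}" using permutes_subset[of \<sigma> "{..<k + l}" "{..<n}"] kl by auto
    from sum_lists_permute[OF this, of "\<lambda>is. \<omega> is * H is / (fact k * fact l)"]
    show "(\<Sum>is | length is = n. \<omega> (permute_list \<sigma> is) * H (permute_list \<sigma> is) / (fact k * fact l)) =
      (\<Sum>is | length is = n. \<omega> is * H is / (fact k * fact l))" .
  qed
  also have "\<dots> = fact (k + l) / (fact k * fact l) * (\<Sum>is | length is = n. \<omega> is * H is)"
    by (simp add: card_permutations sum_divide_distrib[symmetric])
  finally show ?thesis unfolding H_def .
qed

text \<open>The adjoint of a pullback is the pullback by the transposed matrix.\<close>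

lemma sum_pullback:
  fixes \<omega> F :: "'n::finite list \<Rightarrow> real"
  shows "(\<Sum>is | length is = n. \<omega> is * pullback P F is) =
    (\<Sum>as | length as = n. pullback (\<lambda>i j. P j i) \<omega> as * F as)"
proof -
  have "(\<Sum>is | length is = n. \<omega> is * pullback P F is) =
      (\<Sum>is | length is = n. \<Sum>as | length as = n. \<omega> is * (\<Prod>r<n. P (as ! r) (is ! r)) * F as)"
    by (intro sum.cong) (auto simp: pullback_eq sum_distrib_left mult.assoc)
  also have "\<dots> = (\<Sum>as | length as = n. \<Sum>is | length is = n. \<omega> is * (\<Prod>r<n. P (as ! r) (is ! r)) * F as)"
    by (rule sum.swap)
  also have "\<dots> = (\<Sum>as | length as = n. pullback (\<lambda>i j. P j i) \<omega> as * F as)"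
    by (intro sum.cong) (auto simp: pullback_eq sum_distrib_left sum_distrib_right mult_ac)
  finally show ?thesis .
qed

section \<open>The model form\<close>

definition delta :: "'n \<Rightarrow> 'n \<Rightarrow> real" where "delta a b = (if a = b then 1 else 0)"

lemma sum_permutes_3:
  "(\<Sum>\<sigma> | \<sigma> permutes {..<3::nat}. f \<sigma>) =
     f id + f (Transposition.transpose 1 2) + f (Transposition.transpose 0 1)
     + f (Transposition.transpose 0 1 \<circ> Transposition.transpose 1 2) + f (Transposition.transpose 0 2)
     + f (Transposition.transpose 0 2 \<circ> Transposition.transpose 1 2)"
proof -
  have s: "{..<3} = insert 0 (insert 1 {2::nat})" by auto
  have f: "finite {1, 2::nat}" "(0::nat) \<notin> {1, 2}" "finite {2::nat}" "(1::nat) \<notin> {2}" by auto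
  show ?thesis
    unfolding s sum_over_permutations_insert[OF f(1,2)] sum_over_permutations_insert[OF f(3,4)]
      permutes_sing singleton_conv
    using f by (simp add: add.assoc)
qed

lemma basis_form_3:
  "basis_form [p, q, r] [i, j, k] =
     delta p i * (delta q j * delta r k - delta q k * delta r j)
     - delta p j * (delta q i * delta r k - delta q k * delta r i)
     + delta p k * (delta q i * delta r j - delta q j * delta r i)"
proof -
  have s: "{..<length [p, q, r]} = {..<3::nat}" by auto
  have u: "[0..<3] = [0, 1, 2::nat]" by (simp add: upt_rec numeral_3_eq_3 numeral_2_eq_2)
  have l:
    "permute_list (Transposition.transpose 1 2) [p, q, r] = [p, r, q]"
    "permute_list (Transposition.transpose 0 1) [p, q, r] = [q, p, r]"
    "permute_list (Transposition.transpose 0 1 \<circ> Transposition.transpose 1 2) [p, q, r] = [q, r, p]"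
    "permute_list (Transposition.transpose 0 2) [p, q, r] = [r, q, p]"
    "permute_list (Transposition.transpose 0 2 \<circ> Transposition.transpose 1 2) [p, q, r] = [r, p, q]"
    by (simp_all add: permute_list_def u Transposition.transpose_def)
  have sg: "sign (Transposition.transpose (1::nat) 2) = -1"
    "sign (Transposition.transpose (0::nat) 1) = -1"
    "sign (Transposition.transpose (0::nat) 1 \<circ> Transposition.transpose 1 2) = 1"
    "sign (Transposition.transpose (0::nat) 2) = -1"
    "sign (Transposition.transpose (0::nat) 2 \<circ> Transposition.transpose 1 2) = 1"
    by (simp_all add: sign_compose sign_swap_id permutation_swap_id)
  have eq: "(if [x, y, z] = [i, j, k] then c else 0) = delta x i * delta y j * delta z k * c" for x y z c
    by (simp add: delta_def)
  show ?thesis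
    unfolding basis_form_def s sum_permutes_3 l sg sign_id permute_list_id eq
    by (simp add: algebra_simps)
qed

lemma g2_model_form_skew:
  "g2_model_form [b, a, c] = - g2_model_form [a, b, c]"
  "g2_model_form [a, c, b] = - g2_model_form [a, b, c]"
  by (simp_all add: g2_model_form_def basis_form_3 algebra_simps)

text \<open>The multiplication table of the cross product on R^7: two basis vectors determine at
  most one third, up to sign. Later finite checks rewrite with it.\<close>

lemma g2_model_form_table:
  "g2_model_form [1, 1, c] = 0"
  "g2_model_form [1, 2, c] = delta 3 c"
  "g2_model_form [1, 3, c] = - delta 2 c"
  "g2_model_form [1, 4, c] = delta 5 c"
  "g2_model_form [1, 5, c] = - delta 4 c"
  "g2_model_form [1, 6, c] = delta 7 c"
  "g2_model_form [1, 7, c] = - delta 6 c"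
  "g2_model_form [2, 1, c] = - delta 3 c"
  "g2_model_form [2, 2, c] = 0"
  "g2_model_form [2, 3, c] = delta 1 c"
  "g2_model_form [2, 4, c] = delta 6 c"
  "g2_model_form [2, 5, c] = - delta 7 c"
  "g2_model_form [2, 6, c] = - delta 4 c"
  "g2_model_form [2, 7, c] = delta 5 c"
  "g2_model_form [3, 1, c] = delta 2 c"
  "g2_model_form [3, 2, c] = - delta 1 c"
  "g2_model_form [3, 3, c] = 0"
  "g2_model_form [3, 4, c] = - delta 7 c"
  "g2_model_form [3, 5, c] = - delta 6 c"
  "g2_model_form [3, 6, c] = delta 5 c"
  "g2_model_form [3, 7, c] = delta 4 c"
  "g2_model_form [4, 1, c] = - delta 5 c"
  "g2_model_form [4, 2, c] = - delta 6 c"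
  "g2_model_form [4, 3, c] = delta 7 c"
  "g2_model_form [4, 4, c] = 0"
  "g2_model_form [4, 5, c] = delta 1 c"
  "g2_model_form [4, 6, c] = delta 2 c"
  "g2_model_form [4, 7, c] = - delta 3 c"
  "g2_model_form [5, 1, c] = delta 4 c"
  "g2_model_form [5, 2, c] = delta 7 c"
  "g2_model_form [5, 3, c] = delta 6 c"
  "g2_model_form [5, 4, c] = - delta 1 c"
  "g2_model_form [5, 5, c] = 0"
  "g2_model_form [5, 6, c] = - delta 3 c"
  "g2_model_form [5, 7, c] = - delta 2 c"
  "g2_model_form [6, 1, c] = - delta 7 c"
  "g2_model_form [6, 2, c] = delta 4 c"
  "g2_model_form [6, 3, c] = - delta 5 c"
  "g2_model_form [6, 4, c] = - delta 2 c"
  "g2_model_form [6, 5, c] = delta 3 c"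
  "g2_model_form [6, 6, c] = 0"
  "g2_model_form [6, 7, c] = delta 1 c"
  "g2_model_form [7, 1, c] = delta 6 c"
  "g2_model_form [7, 2, c] = - delta 5 c"
  "g2_model_form [7, 3, c] = - delta 4 c"
  "g2_model_form [7, 4, c] = delta 3 c"
  "g2_model_form [7, 5, c] = delta 2 c"
  "g2_model_form [7, 6, c] = - delta 1 c"
  "g2_model_form [7, 7, c] = 0"
  by (simp_all add: g2_model_form_def basis_form_3 delta_def)

text \<open>With this choice the contraction identity holds by definition. The content moves into
  the skewness in the middle slots and into the comparison with the Hodge star.\<close>

definition g2_model_dual :: "7 \<Rightarrow> 7 \<Rightarrow> 7 \<Rightarrow> 7 \<Rightarrow> real" where
  "g2_model_dual a b c d = delta a c * delta b d - delta a d * delta b c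
     - (\<Sum>m\<in>UNIV. g2_model_form [a, b, m] * g2_model_form [c, d, m])"

lemma delta_simps [simp]: "delta a a = 1" "a \<noteq> b \<Longrightarrow> delta a b = 0"
  by (simp_all add: delta_def)

lemma sum_delta_delta [simp]: "(\<Sum>m\<in>UNIV. delta a m * delta b (m::'n::finite)) = delta a b"
  by (simp add: delta_def if_distrib[of "\<lambda>c. c * _"] if_distrib[of "\<lambda>c. _ * c"] cong: if_cong)

lemma g2_model_dual_skew:
  "g2_model_dual b a c d = - g2_model_dual a b c d"
  "g2_model_dual a b d c = - g2_model_dual a b c d"
  by (simp_all add: g2_model_dual_def g2_model_form_skew(1)[of b a] g2_model_form_skew(1)[of d c] sum_negf)

text \<open>The one skewness that is not formal. For b = c it is the cross product rule b x (b x a)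
  = (a . b) b - |b|^2 a, so the signs of the model form matter; all index quadruples are checked
  with the table.\<close>

lemma g2_model_dual_skew_23: "g2_model_dual a c b d = - g2_model_dual a b c d"
proof -
  have "\<forall>a b c d. g2_model_dual a c b d = - g2_model_dual a b c d"
    unfolding g2_model_dual_def
    by (simp only: forall_7 g2_model_form_table)
      (simp add: sum_negf)
  then show ?thesis by blast
qed

text \<open>The least element is \<open>7 = 0\<close>.\<close>
lemma less_7_table:
  "(1::7) < 1 \<longleftrightarrow> False"
  "(1::7) < 2 \<longleftrightarrow> True"
  "(1::7) < 3 \<longleftrightarrow> True"
  "(1::7) < 4 \<longleftrightarrow> True"
  "(1::7) < 5 \<longleftrightarrow> True"
  "(1::7) < 6 \<longleftrightarrow> True"
  "(1::7) < 7 \<longleftrightarrow> False"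
  "(2::7) < 1 \<longleftrightarrow> False"
  "(2::7) < 2 \<longleftrightarrow> False"
  "(2::7) < 3 \<longleftrightarrow> True"
  "(2::7) < 4 \<longleftrightarrow> True"
  "(2::7) < 5 \<longleftrightarrow> True"
  "(2::7) < 6 \<longleftrightarrow> True"
  "(2::7) < 7 \<longleftrightarrow> False"
  "(3::7) < 1 \<longleftrightarrow> False"
  "(3::7) < 2 \<longleftrightarrow> False"
  "(3::7) < 3 \<longleftrightarrow> False"
  "(3::7) < 4 \<longleftrightarrow> True"
  "(3::7) < 5 \<longleftrightarrow> True"
  "(3::7) < 6 \<longleftrightarrow> True"
  "(3::7) < 7 \<longleftrightarrow> False"
  "(4::7) < 1 \<longleftrightarrow> False"
  "(4::7) < 2 \<longleftrightarrow> False"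
  "(4::7) < 3 \<longleftrightarrow> False"
  "(4::7) < 4 \<longleftrightarrow> False"
  "(4::7) < 5 \<longleftrightarrow> True"
  "(4::7) < 6 \<longleftrightarrow> True"
  "(4::7) < 7 \<longleftrightarrow> False"
  "(5::7) < 1 \<longleftrightarrow> False"
  "(5::7) < 2 \<longleftrightarrow> False"
  "(5::7) < 3 \<longleftrightarrow> False"
  "(5::7) < 4 \<longleftrightarrow> False"
  "(5::7) < 5 \<longleftrightarrow> False"
  "(5::7) < 6 \<longleftrightarrow> True"
  "(5::7) < 7 \<longleftrightarrow> False"
  "(6::7) < 1 \<longleftrightarrow> False"
  "(6::7) < 2 \<longleftrightarrow> False"
  "(6::7) < 3 \<longleftrightarrow> False"
  "(6::7) < 4 \<longleftrightarrow> False"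
  "(6::7) < 5 \<longleftrightarrow> False"
  "(6::7) < 6 \<longleftrightarrow> False"
  "(6::7) < 7 \<longleftrightarrow> False"
  "(7::7) < 1 \<longleftrightarrow> True"
  "(7::7) < 2 \<longleftrightarrow> True"
  "(7::7) < 3 \<longleftrightarrow> True"
  "(7::7) < 4 \<longleftrightarrow> True"
  "(7::7) < 5 \<longleftrightarrow> True"
  "(7::7) < 6 \<longleftrightarrow> True"
  "(7::7) < 7 \<longleftrightarrow> False"
  by (simp_all add: less_bit1_def bit1.Rep_numeral bit1.Rep_1)

lemma sum_delta3:
  fixes p q r :: "'n::finite"
  shows "(\<Sum>i\<in>UNIV. \<Sum>j\<in>UNIV. \<Sum>k\<in>UNIV. delta p i * delta q j * delta r k * X i j k) = X p q r"
proof -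
  have 1: "(\<Sum>i\<in>UNIV. delta p i * f i) = f p" for p :: 'n and f
    by (simp add: delta_def)
  show ?thesis by (simp add: mult.assoc sum_distrib_left[symmetric] 1)
qed

text \<open>6 = 3!: each basis form has six components, and by skewness of X all of them contribute
  the same.\<close>

lemma sum_basis_form_3:
  fixes X :: "'n::finite \<Rightarrow> 'n \<Rightarrow> 'n \<Rightarrow> real"
  assumes "\<And>i j k. X j i k = - X i j k" "\<And>i j k. X i k j = - X i j k"
  shows "(\<Sum>i\<in>UNIV. \<Sum>j\<in>UNIV. \<Sum>k\<in>UNIV. basis_form [p, q, r] [i, j, k] * X i j k) = 6 * X p q r"
proof -
  have "basis_form [p, q, r] [i, j, k] * X i j k =
      delta p i * delta q j * delta r k * X i j k - delta p i * delta r j * delta q k * X i j k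
      - delta q i * delta p j * delta r k * X i j k + delta r i * delta p j * delta q k * X i j k
      + delta q i * delta r j * delta p k * X i j k - delta r i * delta q j * delta p k * X i j k" for i j k
    by (simp add: basis_form_3 algebra_simps)
  then have "(\<Sum>i\<in>UNIV. \<Sum>j\<in>UNIV. \<Sum>k\<in>UNIV. basis_form [p, q, r] [i, j, k] * X i j k) =
      X p q r - X p r q - X q p r + X r p q + X q r p - X r q p"
    by (simp add: sum.distrib sum_subtractf sum_delta3)
  then show ?thesis
    using assms(1)[of p q r] assms(2)[of p q r] assms(1)[of q r p] assms(2)[of q p r]
      assms(1)[of p r q] assms(2)[of r p q] by simp
qed

text \<open>Sorting by adjacent transpositions reduces the 7^4 index quadruples of the application
  to 35 increasing ones. In the proof d is inserted into a sorted triple, then c into a sorted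
  pair.\<close>

lemma skew4_eq_zero:
  fixes h :: "'n::linorder \<Rightarrow> 'n \<Rightarrow> 'n \<Rightarrow> 'n \<Rightarrow> real"
  assumes s12: "\<And>a b c d. h b a c d = - h a b c d"
    and s23: "\<And>a b c d. h a c b d = - h a b c d"
    and s34: "\<And>a b c d. h a b d c = - h a b c d"
    and sorted: "\<And>a b c d. a < b \<Longrightarrow> b < c \<Longrightarrow> c < d \<Longrightarrow> h a b c d = 0"
  shows "h a b c d = 0"
proof -
  have eq12: "h a a c d = 0" for a c d using s12[of a a c d] by simp
  have eq23: "h a b b d = 0" for a b d using s23[of a b b d] by simp
  have eq34: "h a b c c = 0" for a b c using s34[of a b c c] by simp
  have 1: "h a b c d = 0" if "a < b" "b < c" for a b c d
  proof -
    have sw: "h a b c d = - h a b d c" "h a b d c = - h a d b c" "h a d b c = - h d a b c"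
      using s34[of a b d c] s23[of a d b c] s12[of d a b c] by simp_all
    consider "c < d" | "c = d" | "b < d" "d < c" | "b = d" | "a < d" "d < b" | "a = d" | "d < a"
      by (meson not_less_iff_gr_or_eq)
    then show ?thesis
      by cases (use that sw sorted eq12 eq23 eq34 in auto)
  qed
  have 2: "h a b c d = 0" if "a < b" for a b c d
  proof -
    have sw: "h a b c d = - h a c b d" "h a c b d = - h c a b d"
      using s23[of a c b d] s12[of c a b d] by simp_all
    consider "b < c" | "b = c" | "a < c" "c < b" | "a = c" | "c < a"
      by (meson not_less_iff_gr_or_eq)
    then show ?thesis
      by cases (use that sw 1 eq12 eq23 in auto)
  qed
  consider "a < b" | "a = b" | "b < a" by (meson not_less_iff_gr_or_eq)
  then show ?thesis by cases (use 2 eq12 s12[of b a c d] in auto)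
qed

lemma sum_g2_model_form:
  fixes X :: "7 \<Rightarrow> 7 \<Rightarrow> 7 \<Rightarrow> real"
  assumes "\<And>i j k. X j i k = - X i j k" "\<And>i j k. X i k j = - X i j k"
  shows "(\<Sum>a\<in>UNIV. \<Sum>b\<in>UNIV. \<Sum>c\<in>UNIV. g2_model_form [a, b, c] * X a b c) =
    6 * (X 1 2 3 + X 1 4 5 + X 1 6 7 + X 2 4 6 - X 2 5 7 - X 3 4 7 - X 3 5 6)"
  by (simp add: g2_model_form_def ring_distribs sum.distrib sum_subtractf sum_basis_form_3[of X, OF assms])

text \<open>The Hodge star of the model form; \<open>g2_model_dual\<close> is its negative for the standard orientation.\<close>
lemma contract_g2_model_form:
  assumes \<alpha>: "alternating 7 \<alpha>"
  shows "(\<Sum>a\<in>UNIV. \<Sum>b\<in>UNIV. \<Sum>c\<in>UNIV. g2_model_form [a, b, c] * \<alpha> [a, b, c, i, j, k, l]) =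
    - 6 * \<alpha> idx7 * g2_model_dual i j k l"
proof -
  note sw = alternating_swaps7[OF \<alpha>]
  define h where "h i j k l = (\<Sum>a\<in>UNIV. \<Sum>b\<in>UNIV. \<Sum>c\<in>UNIV. g2_model_form [a, b, c] * \<alpha> [a, b, c, i, j, k, l])
    + 6 * \<alpha> idx7 * g2_model_dual i j k l" for i j k l
  have h: "h i j k l = 6 * (\<alpha> [1,2,3,i,j,k,l] + \<alpha> [1,4,5,i,j,k,l] + \<alpha> [1,6,7,i,j,k,l] + \<alpha> [2,4,6,i,j,k,l]
      - \<alpha> [2,5,7,i,j,k,l] - \<alpha> [3,4,7,i,j,k,l] - \<alpha> [3,5,6,i,j,k,l]) + 6 * \<alpha> idx7 * g2_model_dual i j k l" for i j k l
    unfolding h_def by (subst sum_g2_model_form) (rule sw refl)+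
  \<comment> \<open>Conditional rewriting with these rules sorts the argument of \<alpha>, so all
    nonzero terms become multiples of one component. As 7 = 0 is least, \<open>idx7\<close> is
    itself sorted to begin with 7.\<close>
  have sort: "b < a \<Longrightarrow> \<alpha> [a, b, c, d, e, f, h] = - \<alpha> [b, a, c, d, e, f, h]"
     "c < b \<Longrightarrow> \<alpha> [a, b, c, d, e, f, h] = - \<alpha> [a, c, b, d, e, f, h]"
     "d < c \<Longrightarrow> \<alpha> [a, b, c, d, e, f, h] = - \<alpha> [a, b, d, c, e, f, h]"
     "e < d \<Longrightarrow> \<alpha> [a, b, c, d, e, f, h] = - \<alpha> [a, b, c, e, d, f, h]"
     "f < e \<Longrightarrow> \<alpha> [a, b, c, d, e, f, h] = - \<alpha> [a, b, c, d, f, e, h]"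
     "h < f \<Longrightarrow> \<alpha> [a, b, c, d, e, f, h] = - \<alpha> [a, b, c, d, e, h, f]" for a b c d e f h
    by (rule sw)+
  have zero: "\<alpha> [a, a, c, d, e, f, h] = 0" "\<alpha> [a, b, b, d, e, f, h] = 0" "\<alpha> [a, b, c, c, e, f, h] = 0"
    "\<alpha> [a, b, c, d, d, f, h] = 0" "\<alpha> [a, b, c, d, e, e, h] = 0" "\<alpha> [a, b, c, d, e, f, f] = 0" for a b c d e f h
    by (rule alternating_not_distinct[OF \<alpha>]; simp)+
  have "h i j k l = 0"
  proof (rule skew4_eq_zero[of h])
    show "h b a c d = - h a b c d" "h a c b d = - h a b c d" "h a b d c = - h a b c d" for a b c d
      unfolding h sw(4)[of _ _ _ b a] sw(5)[of _ _ _ _ c b] sw(6)[of _ _ _ _ _ d c]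
        g2_model_dual_skew(1)[of b a] g2_model_dual_skew(2)[of _ _ d c] g2_model_dual_skew_23[of _ c b]
      by simp_all
    have quads: "h 7 1 2 3 = 0"
      "h 7 1 2 4 = 0"
      "h 7 1 2 5 = 0"
      "h 7 1 2 6 = 0"
      "h 7 1 3 4 = 0"
      "h 7 1 3 5 = 0"
      "h 7 1 3 6 = 0"
      "h 7 1 4 5 = 0"
      "h 7 1 4 6 = 0"
      "h 7 1 5 6 = 0"
      "h 7 2 3 4 = 0"
      "h 7 2 3 5 = 0"
      "h 7 2 3 6 = 0"
      "h 7 2 4 5 = 0"
      "h 7 2 4 6 = 0"
      "h 7 2 5 6 = 0"
      "h 7 3 4 5 = 0"
      "h 7 3 4 6 = 0"
      "h 7 3 5 6 = 0"
      "h 7 4 5 6 = 0"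
      "h 1 2 3 4 = 0"
      "h 1 2 3 5 = 0"
      "h 1 2 3 6 = 0"
      "h 1 2 4 5 = 0"
      "h 1 2 4 6 = 0"
      "h 1 2 5 6 = 0"
      "h 1 3 4 5 = 0"
      "h 1 3 4 6 = 0"
      "h 1 3 5 6 = 0"
      "h 1 4 5 6 = 0"
      "h 2 3 4 5 = 0"
      "h 2 3 4 6 = 0"
      "h 2 3 5 6 = 0"
      "h 2 4 5 6 = 0"
      "h 3 4 5 6 = 0"
      by (simp_all add: h g2_model_dual_def less_7_table g2_model_form_table sum_negf sort zero idx7_def)
    have "\<forall>a b. a < b \<longrightarrow> (\<forall>c. b < c \<longrightarrow> (\<forall>d. c < d \<longrightarrow> h a b c d = 0))"
      by (simp only: forall_7 less_7_table quads simp_thms)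
    then show "h a b c d = 0" if "a < b" "b < c" "c < d" for a b c d
      using that by blast
  qed
  then show ?thesis unfolding h_def by simp
qed

lemma delta_sym: "delta a b = delta b a"
  by (simp add: delta_def)

lemma contr_delta: "contr delta F = (\<Sum>a\<in>UNIV. F a a)"
  by (simp add: contr_def delta_def if_distrib[of "\<lambda>c. c * _"] cong: if_cong)

text \<open>Makes the constants 6 and -4 of the double contractions available for the model form,
  before anything is known about g.\<close>

interpretation model: g2_contraction delta delta "\<lambda>a b c. g2_model_form [a, b, c]" g2_model_dual
proof
  show "(\<Sum>b\<in>UNIV. delta a b * delta b c) = (if a = c then 1 else 0)" for a c :: 7
    using sum_delta_delta[of a c] by (simp add: delta_sym[of _ c] delta_def)
  show "contr delta (\<lambda>m n. g2_model_form [a, b, m] * g2_model_form [c, d, n])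
      = delta a c * delta b d - delta a d * delta b c - g2_model_dual a b c d" for a b c d
    by (simp add: contr_delta g2_model_dual_def)
qed (rule delta_sym g2_model_form_skew g2_model_dual_skew g2_model_dual_skew_23)+

lemma model_dot2: "model.dot2 X Y = (\<Sum>a\<in>UNIV. \<Sum>b\<in>UNIV. X a b * Y a b)"
  by (simp add: model.dot2_def model.dot1_def contr_delta)

text \<open>Shifting seven entries cyclically by one takes six transpositions, hence is even; the
  claim iterates this.\<close>

lemma alternating7_rotate:
  assumes "alternating 7 \<alpha>"
  shows "\<alpha> [e, f, h, a, b, c, d] = \<alpha> [a, b, c, d, e, f, h]"
proof -
  have "\<alpha> [b, c, d, e, f, h, a] = \<alpha> [a, b, c, d, e, f, h]" for a b c d e f h
    using alternating_swaps7(1)[OF assms, of b a c d e f h] alternating_swaps7(2)[OF assms, of b c a d e f h]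
      alternating_swaps7(3)[OF assms, of b c d a e f h] alternating_swaps7(4)[OF assms, of b c d e a f h]
      alternating_swaps7(5)[OF assms, of b c d e f a h] alternating_swaps7(6)[OF assms, of b c d e f h a]
    by simp
  then show ?thesis by metis
qed

lemma sum_lists_7:
  "(\<Sum>is :: 'n::finite list | length is = 7. f is) = (\<Sum>a\<in>UNIV. \<Sum>b\<in>UNIV. \<Sum>c\<in>UNIV. \<Sum>d\<in>UNIV.
     \<Sum>e\<in>UNIV. \<Sum>i\<in>UNIV. \<Sum>j\<in>UNIV. f [a, b, c, d, e, i, j])"
proof -
  have "7 = Suc (Suc (Suc (Suc (Suc (Suc (Suc 0))))))" by simp
  then show ?thesis by (simp only: sum_lists_Suc sum_lists_0)
qed

text \<open>144 = (-6) * (-4) * 6: contracting \<omega> with the third factor gives the dual form,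
  contracting this with the second gives -4 times that factor, and the remaining pairing of two
  factors gives 6.\<close>

lemma model_wedge:
  assumes \<omega>: "alternating 7 \<omega>"
  shows "(\<Sum>is | length is = 7. \<omega> is * (interior_prod u g2_model_form (take 2 is)
      * interior_prod v g2_model_form (take 2 (drop 2 is)) * g2_model_form (drop 4 is)))
    = 144 * \<omega> idx7 * (u \<bullet> v)"
proof -
  let ?A = "\<lambda>u a b. interior_prod u g2_model_form [a, b]"
  have dot2_interior: "model.dot2 (?A u) Y = (\<Sum>p\<in>UNIV. u $ p * model.dot2 (\<lambda>a b. g2_model_form [p, a, b]) Y)" for u Y
  proof -
    have "model.dot2 (?A u) Y = (\<Sum>a\<in>UNIV. \<Sum>b\<in>UNIV. \<Sum>p\<in>UNIV. u $ p * (g2_model_form [p, a, b] * Y a b))"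
      by (simp add: model_dot2 interior_prod_def sum_distrib_right mult.assoc)
    also have "\<dots> = (\<Sum>a\<in>UNIV. \<Sum>p\<in>UNIV. \<Sum>b\<in>UNIV. u $ p * (g2_model_form [p, a, b] * Y a b))"
      by (rule sum.cong[OF refl], rule sum.swap)
    also have "\<dots> = (\<Sum>p\<in>UNIV. \<Sum>a\<in>UNIV. \<Sum>b\<in>UNIV. u $ p * (g2_model_form [p, a, b] * Y a b))"
      by (rule sum.swap)
    finally show ?thesis by (simp add: model_dot2 sum_distrib_left)
  qed
  have "(\<Sum>is | length is = 7. \<omega> is * (interior_prod u g2_model_form (take 2 is)
      * interior_prod v g2_model_form (take 2 (drop 2 is)) * g2_model_form (drop 4 is)))
    = (\<Sum>a\<in>UNIV. \<Sum>b\<in>UNIV. \<Sum>c\<in>UNIV. \<Sum>d\<in>UNIV. ?A u a b * (?A v c d *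
       (\<Sum>e\<in>UNIV. \<Sum>i\<in>UNIV. \<Sum>j\<in>UNIV. g2_model_form [e, i, j] * \<omega> [e, i, j, a, b, c, d])))"
    unfolding sum_lists_7 sum_distrib_left
    by (intro sum.cong refl) (simp add: alternating7_rotate[OF \<omega>] numeral_eq_Suc)
  also have "\<dots> = - 6 * \<omega> idx7 * model.dot2 (?A u) (\<lambda>a b. model.dot2 (?A v) (g2_model_dual a b))"
    unfolding contract_g2_model_form[OF \<omega>] by (simp add: model_dot2 sum_distrib_left mult_ac sum_negf)
  also have "(\<lambda>a b. model.dot2 (?A v) (g2_model_dual a b)) = (\<lambda>a b. - 4 * ?A v a b)"
    by (intro ext, simp only: dot2_interior model.dot2_\<phi>_\<psi>)
      (simp add: interior_prod_def sum_distrib_left sum_negf mult_ac)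
  also have "model.dot2 (?A u) (\<lambda>a b. - 4 * ?A v a b) = - 24 * (u \<bullet> v)"
  proof -
    have "model.dot2 (?A u) (?A v) = (\<Sum>p\<in>UNIV. u $ p * (\<Sum>q\<in>UNIV. v $ q * (6 * delta q p)))"
      by (simp only: dot2_interior model.dot2_commute[of _ "?A v"] model.dot2_\<phi>_\<phi>)
    also have "\<dots> = 6 * (u \<bullet> v)"
      by (simp add: delta_def inner_vec_def sum_distrib_left mult_ac if_distrib[of "\<lambda>c. _ * c"] cong: if_cong)
    finally show ?thesis unfolding model.dot2_linear by simp
  qed
  finally show ?thesis by simp
qed

lemma det_scaleR_matrix: "det (\<chi> i j. c * B i j :: real ^ 'n ^ 'n::finite) = c ^ CARD('n) * det (\<chi> i j. B i j)"
  by (simp add: det_def prod.distrib sum_distrib_left mult_ac)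

lemma pullback_interior_prod:
  "interior_prod u (pullback P \<alpha>) js = pullback P (interior_prod (\<chi> p. \<Sum>i\<in>UNIV. P p i * u $ i) \<alpha>) js"
proof -
  have "interior_prod u (pullback P \<alpha>) js = (\<Sum>i\<in>UNIV. \<Sum>p\<in>UNIV. u $ i * (P p i * pullback P (\<lambda>is. \<alpha> (p # is)) js))"
    by (simp add: interior_prod_def sum_distrib_left)
  also have "\<dots> = (\<Sum>p\<in>UNIV. (\<Sum>i\<in>UNIV. P p i * u $ i) * pullback P (\<lambda>is. \<alpha> (p # is)) js)"
    by (subst sum.swap) (simp add: sum_distrib_left sum_distrib_right mult_ac)
  also have "\<dots> = pullback P (interior_prod (\<chi> p. \<Sum>i\<in>UNIV. P p i * u $ i) \<alpha>) js"
    unfolding interior_prod_def pullback_sum pullback_cmult by simp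
  finally show ?thesis .
qed

lemma power9_eq_1: "(c::real) ^ 9 = 1 \<Longrightarrow> c = 1"
  using power_inject_base[of c 8 1] odd_power_less_zero[of c 4]
  by (cases "c \<ge> 0") auto

section \<open>\<open>G\<^sub>2\<close>-structures at a point\<close>

text \<open>The data at one point from which the isometry is deduced. The first index of p belongs
  to the model space, the second to the chart.\<close>

locale g2_point =
  fixes \<phi> \<omega> :: "7 list \<Rightarrow> real" and g :: "7 \<Rightarrow> 7 \<Rightarrow> real" and p :: "7 \<Rightarrow> 7 \<Rightarrow> real"
  assumes \<phi>: "\<And>a b c. \<phi> [a, b, c] = pullback p g2_model_form [a, b, c]"
    and p_inv: "det (\<chi> i j. p i j) \<noteq> 0"
    and g_inv: "det (\<chi> i j. g i j) \<noteq> 0"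
    and \<omega>: "alternating 7 \<omega>"
    and \<omega>_det: "\<bar>\<omega> idx7\<bar> = sqrt (det (\<chi> i j. g i j))"
    and wedge: "\<And>u v. wedge 4 3 (wedge 2 2 (interior_prod u \<phi>) (interior_prod v \<phi>)) \<phi> idx7
      = - 6 * (\<Sum>i\<in>UNIV. \<Sum>j\<in>UNIV. g i j * u $ i * v $ j) * \<omega> idx7"
begin

abbreviation "d \<equiv> det (\<chi> i j. p i j)"

lemma \<phi>_list: "length is = 3 \<Longrightarrow> \<phi> is = pullback p g2_model_form is"
  using \<phi> by (auto simp: length_Suc_conv numeral_3_eq_3)

lemma \<omega>_idx7: "\<omega> idx7 \<noteq> 0" "(\<omega> idx7)\<^sup>2 = det (\<chi> i j. g i j)"
proof -
  show "\<omega> idx7 \<noteq> 0" using \<omega>_det g_inv by auto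
  have "det (\<chi> i j. g i j) \<ge> 0" using \<omega>_det real_sqrt_ge_0_iff by (metis abs_ge_zero)
  then show "(\<omega> idx7)\<^sup>2 = det (\<chi> i j. g i j)" using \<omega>_det by (metis power2_abs real_sqrt_pow2)
qed

text \<open>Both wedges become a contraction with \<omega>, the linear map is moved over to
  \<omega>, where it produces its determinant, and \<open>model_wedge\<close> evaluates the
  rest.\<close>

lemma wedge_pullback: "d * (\<Sum>a\<in>UNIV. p a i * p a j) = - \<omega> idx7 * g i j"
proof -
  define L where "L u = (\<chi> a. \<Sum>i\<in>UNIV. p a i * u $ i)" for u :: "real ^ 7"
  let ?u = "axis i 1 :: real ^ 7" and ?v = "axis j 1 :: real ^ 7"
  define H where "H is = interior_prod (L ?v) g2_model_form (take 2 is) * g2_model_form (drop 2 is)" for "is"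
  define F where "F is = interior_prod (L ?u) g2_model_form (take 2 is) * H (drop 2 is)" for "is"
  have int: "interior_prod u \<phi> js = pullback p (interior_prod (L u) g2_model_form) js" if "length js = 2" for u js
  proof -
    have "interior_prod u \<phi> js = interior_prod u (pullback p g2_model_form) js"
      unfolding interior_prod_def by (intro sum.cong refl) (simp add: \<phi>_list that)
    then show ?thesis unfolding pullback_interior_prod L_def .
  qed
  have F: "interior_prod ?u \<phi> (take 2 is) * interior_prod ?v \<phi> (take 2 (drop 2 is)) * \<phi> (drop 4 is) = pullback p F is"
    if "length is = 7" for "is"
  proof -
    have "pullback p F (take 2 is @ drop 2 is) = pullback p (interior_prod (L ?u) g2_model_form) (take 2 is)
        * pullback p H (drop 2 is)"
      unfolding F_def by (rule pullback_tensor) (simp add: that)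
    also have "pullback p H (drop 2 is) =
        pullback p (interior_prod (L ?v) g2_model_form) (take 2 (drop 2 is)) * pullback p g2_model_form (drop 2 (drop 2 is))"
      using pullback_tensor[of "take 2 (drop 2 is)" 2 p "interior_prod (L ?v) g2_model_form" g2_model_form "drop 2 (drop 2 is)"]
        append_take_drop_id[of 2 "drop 2 is"] that
      by (simp add: H_def[abs_def])
    finally show ?thesis using that by (simp add: int \<phi>_list mult.assoc)
  qed
  have "\<omega> idx7 * (- 6 * g i j * \<omega> idx7) =
      \<omega> idx7 * wedge 4 3 (wedge 2 2 (interior_prod ?u \<phi>) (interior_prod ?v \<phi>)) \<phi> idx7"
    unfolding wedge by (simp add: axis_def if_distrib[of "\<lambda>c. _ * c"] cong: if_cong)
  also have "\<dots> = (\<Sum>is | length is = 7. \<omega> is * (wedge 2 2 (interior_prod ?u \<phi>) (interior_prod ?v \<phi>) (take 4 is) * \<phi> (drop 4 is))) / 144"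
    by (subst wedge_idx7[OF \<omega>]) (simp_all add: fact_numeral)
  \<comment> \<open>The outer wedge divides by 4! 3! = 144; removing the inner antisymmetrisation
    multiplies by 4!/(2! 2!) = 6, which leaves 24.\<close>
  also have "\<dots> = (\<Sum>is | length is = 7. \<omega> is * (interior_prod ?u \<phi> (take 2 is) * interior_prod ?v \<phi> (take 2 (drop 2 is)) * \<phi> (drop 4 is))) / 24"
    using sum_alternating_wedge[OF \<omega>, of 2 2 "interior_prod ?u \<phi>" "interior_prod ?v \<phi>" \<phi>]
    by (simp add: fact_numeral)
  also have "(\<Sum>is | length is = 7. \<omega> is * (interior_prod ?u \<phi> (take 2 is) * interior_prod ?v \<phi> (take 2 (drop 2 is)) * \<phi> (drop 4 is)))
      = (\<Sum>is | length is = 7. \<omega> is * pullback p F is)"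
    by (intro sum.cong) (simp_all add: F)
  also have "\<dots> = 144 * pullback (\<lambda>i j. p j i) \<omega> idx7 * (L ?u \<bullet> L ?v)"
    unfolding sum_pullback F_def H_def using model_wedge[OF pullback_alternating[OF \<omega>]] by (simp add: mult.assoc)
  also have "pullback (\<lambda>i j. p j i) \<omega> idx7 = \<omega> idx7 * d"
    using det_transpose[of "\<chi> i j. p i j"] by (simp add: pullback_top_form[OF \<omega>] transpose_def)
  also have "L ?u \<bullet> L ?v = (\<Sum>a\<in>UNIV. p a i * p a j)"
    by (simp add: L_def inner_vec_def axis_def if_distrib[of "\<lambda>c. _ * c"] cong: if_cong)
  finally have "\<omega> idx7 * (d * (\<Sum>a\<in>UNIV. p a i * p a j)) = \<omega> idx7 * (- \<omega> idx7 * g i j)" by simp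
  then show ?thesis using \<omega>_idx7(1) by (simp only: mult_cancel_left) simp
qed

lemma g_eq: "g i j = (\<Sum>a\<in>UNIV. p a i * p a j)" and \<omega>_eq: "\<omega> idx7 = - d"
proof -
  define c where "c = - d / \<omega> idx7"
  have d: "d = - c * \<omega> idx7" using \<omega>_idx7(1) by (simp add: c_def)
  have g: "g i j = c * (\<Sum>a\<in>UNIV. p a i * p a j)" for i j
    using wedge_pullback[of i j] \<omega>_idx7(1) by (simp add: c_def field_simps)
  have "(\<chi> i j. \<Sum>a\<in>UNIV. p a i * p a j) = transpose (\<chi> i j. p i j) ** (\<chi> i j. p i j)"
    by (simp add: matrix_matrix_mult_def transpose_def vec_eq_iff)
  \<comment> \<open>The determinant of g contains c seven times, once for each dimension, and d = -
    c * \<open>\<omega> idx7\<close> contributes two more; c is real, so the ninth power forces c =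
    1.\<close>
  then have "(\<omega> idx7)\<^sup>2 = c ^ 7 * d\<^sup>2"
    unfolding \<omega>_idx7(2) g det_scaleR_matrix by (simp add: det_mul power2_eq_square)
  then have "(\<omega> idx7)\<^sup>2 = c ^ 9 * (\<omega> idx7)\<^sup>2"
    by (simp add: d power_mult_distrib power_add[symmetric])
  then have "c ^ 9 = 1" using \<omega>_idx7(1) by simp
  then have "c = 1" by (rule power9_eq_1)
  then show "g i j = (\<Sum>a\<in>UNIV. p a i * p a j)" "\<omega> idx7 = - d" using g d by simp_all
qed

definition q :: "7 \<Rightarrow> 7 \<Rightarrow> real" where "q i j = matrix_inv (\<chi> i j. p i j) $ i $ j"

lemma p_q: "(\<Sum>k\<in>UNIV. p i k * q k j) = (if i = j then 1 else 0)"
  and q_p: "(\<Sum>k\<in>UNIV. q i k * p k j) = (if i = j then 1 else 0)"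
proof -
  have inv: "invertible (\<chi> i j. p i j)" using p_inv invertible_det_nz by blast
  show "(\<Sum>k\<in>UNIV. p i k * q k j) = (if i = j then 1 else 0)"
    using arg_cong[OF matrix_inv_right[OF inv], of "\<lambda>B. B $ i $ j"]
    by (simp add: matrix_matrix_mult_def mat_def q_def)
  show "(\<Sum>k\<in>UNIV. q i k * p k j) = (if i = j then 1 else 0)"
    using arg_cong[OF matrix_inv_left[OF inv], of "\<lambda>B. B $ i $ j"]
    by (simp add: matrix_matrix_mult_def mat_def q_def)
qed

lemma det_q: "d * det (\<chi> i j. q i j) = 1"
proof -
  have "(\<chi> i j. p i j) ** (\<chi> i j. q i j) = mat 1"
    by (simp add: matrix_matrix_mult_def mat_def vec_eq_iff p_q)
  then show ?thesis by (metis det_I det_mul)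
qed

text \<open>Since g = p^T p, its inverse is q q^T. Raising the indices of a pullback by p thus
  amounts to pulling back by the transpose of q.\<close>

lemma p_ginv:
  assumes G: "\<And>a c. (\<Sum>b\<in>UNIV. g a b * G b c) = (if a = c then 1 else 0)"
  shows "(\<Sum>k\<in>UNIV. p i k * G k j) = q j i"
proof -
  have *: "(\<Sum>i\<in>UNIV. p i m * (\<Sum>k\<in>UNIV. p i k * G k j)) = (if m = j then 1 else 0)" for m
  proof -
    have "(\<Sum>i\<in>UNIV. p i m * (\<Sum>k\<in>UNIV. p i k * G k j)) = (\<Sum>k\<in>UNIV. (\<Sum>i\<in>UNIV. p i m * p i k) * G k j)"
      unfolding sum_distrib_left sum_distrib_right by (subst sum.swap) (simp add: mult.assoc)
    then show ?thesis by (simp only: g_eq[symmetric] G)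
  qed
  have "q j i = (\<Sum>m\<in>UNIV. (if j = m then 1 else 0) * q m i)" by (rule sum_delta_left[symmetric])
  also have "\<dots> = (\<Sum>m\<in>UNIV. (\<Sum>n\<in>UNIV. p n m * (\<Sum>k\<in>UNIV. p n k * G k j)) * q m i)"
    by (intro sum.cong refl) (auto simp: *)
  also have "\<dots> = (\<Sum>n\<in>UNIV. (\<Sum>m\<in>UNIV. p n m * q m i) * (\<Sum>k\<in>UNIV. p n k * G k j))"
    unfolding sum_distrib_right by (subst sum.swap) (intro sum.cong refl, simp add: mult_ac)
  also have "\<dots> = (\<Sum>n\<in>UNIV. (if i = n then 1 else 0) * (\<Sum>k\<in>UNIV. p n k * G k j))"
    unfolding p_q by (intro sum.cong refl) auto
  also have "\<dots> = (\<Sum>k\<in>UNIV. p i k * G k j)" by (rule sum_delta_left)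
  finally show ?thesis by simp
qed

text \<open>Naturality of the Hodge star under the isometry p: q cancels p on the contracted slots
  of the volume form, and p survives on the four free ones.\<close>

lemma hodge_star_pullback:
  assumes G: "\<And>a c. (\<Sum>b\<in>UNIV. g a b * G b c) = (if a = c then 1 else 0)"
  shows "(\<Sum>is | length is = 3. \<Sum>ms | length ms = 3.
      \<phi> is * (\<Prod>r<3. G (is ! r) (ms ! r)) * \<omega> (ms @ [i, j, k, l])) / 6 =
    pullback p (\<lambda>as. g2_model_dual (as ! 0) (as ! 1) (as ! 2) (as ! 3)) [i, j, k, l]"
proof -
  let ?\<omega> = "pullback q \<omega>" and ?js = "[i, j, k, l]"
  have \<omega>_eq': "\<omega> = pullback p ?\<omega>"
    by (rule ext) (simp add: pullback_pullback q_p pullback_ident)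
  \<comment> \<open>In the model frame the volume form is minus the standard one, which cancels the
    minus sign in \<open>contract_g2_model_form\<close>.\<close>
  have top: "?\<omega> idx7 = - 1"
    using det_q by (simp add: pullback_top_form[OF \<omega>] \<omega>_eq)
  have swap: "pullback q (\<lambda>ms. \<omega> (ms @ ?js)) as = pullback p (\<lambda>bs. ?\<omega> (as @ bs)) ?js" for as
    by (subst \<omega>_eq', subst pullback_append)
      (simp only: pullback_pullback p_q pullback_ident)
  have "(\<Sum>is | length is = 3. \<Sum>ms | length ms = 3. \<phi> is * (\<Prod>r<3. G (is ! r) (ms ! r)) * \<omega> (ms @ ?js)) =
      (\<Sum>ms | length ms = 3. \<omega> (ms @ ?js) * pullback G (pullback p g2_model_form) ms)"
    by (subst sum.swap, intro sum.cong refl)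
      (auto simp: pullback_eq[of G] sum_distrib_left \<phi>_list mult_ac intro!: sum.cong)
  also have "\<dots> = (\<Sum>ms | length ms = 3. \<omega> (ms @ ?js) * pullback (\<lambda>i j. q j i) g2_model_form ms)"
    by (simp add: pullback_pullback p_ginv[OF G])
  also have "\<dots> = (\<Sum>as | length as = 3. pullback q (\<lambda>ms. \<omega> (ms @ ?js)) as * g2_model_form as)"
    by (rule sum_pullback)
  also have "\<dots> = (\<Sum>as | length as = 3. pullback p (\<lambda>bs. ?\<omega> (as @ bs)) ?js * g2_model_form as)"
    by (simp only: swap)
  also have "\<dots> =
      pullback p (\<lambda>bs. \<Sum>as | length as = 3. ?\<omega> (as @ bs) * g2_model_form as) ?js"
    by (simp only: pullback_sum pullback_multc)
  also have "\<dots> = pullback p (\<lambda>as. 6 * g2_model_dual (as ! 0) (as ! 1) (as ! 2) (as ! 3)) ?js"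
  proof (rule pullback_cong)
    fix bs :: "7 list" assume "length bs = length ?js"
    then obtain a b c d where bs: "bs = [a, b, c, d]" by (auto simp: length_Suc_conv)
    have 3: "3 = Suc (Suc (Suc 0))" by simp
    have "(\<Sum>as | length as = 3. ?\<omega> (as @ bs) * g2_model_form as) =
        (\<Sum>e\<in>UNIV. \<Sum>f\<in>UNIV. \<Sum>h\<in>UNIV. g2_model_form [e, f, h] * ?\<omega> [e, f, h, a, b, c, d])"
      unfolding 3 sum_lists_Suc sum_lists_0 bs by (simp add: mult.commute del: pullback.simps)
    then show "(\<Sum>as | length as = 3. ?\<omega> (as @ bs) * g2_model_form as) =
        6 * g2_model_dual (bs ! 0) (bs ! 1) (bs ! 2) (bs ! 3)"
      unfolding contract_g2_model_form[OF pullback_alternating[OF \<omega>]] top by (simp add: bs)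
  qed
  finally show ?thesis by (simp add: pullback_cmult del: pullback.simps)
qed

lemma contr_pullback:
  assumes G: "\<And>a c. (\<Sum>b\<in>UNIV. g a b * G b c) = (if a = c then 1 else 0)"
  shows "contr G (\<lambda>m n. \<phi> [i, j, m] * \<phi> [k, l, n]) = g i k * g j l - g i l * g j k
    - pullback p (\<lambda>as. g2_model_dual (as ! 0) (as ! 1) (as ! 2) (as ! 3)) [i, j, k, l]"
proof -
  \<comment> \<open>The third slot of \<phi> is left in the model frame. Contraction with G then
    becomes a plain sum over the model index, because p G p^T is the identity.\<close>
  define X where "X i j c = pullback p (\<lambda>as. g2_model_form (as @ [c])) [i, j]" for i j c
  have \<phi>_X: "\<phi> [i, j, m] = (\<Sum>c\<in>UNIV. p c m * X i j c)" for i j m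
  proof -
    have "\<phi> [i, j, m] = pullback p (\<lambda>is. pullback p (\<lambda>ls. g2_model_form (is @ ls)) [m]) [i, j]"
      using pullback_append[of p g2_model_form "[i, j]" "[m]"] by (simp add: \<phi> del: pullback.simps)
    also have "\<dots> = (\<Sum>c\<in>UNIV. p c m * X i j c)"
      unfolding X_def pullback.simps(2)[of p _ m] pullback.simps(1) pullback_sum pullback_cmult ..
    finally show ?thesis .
  qed
  have pGp: "contr G (\<lambda>m n. p c m * p e n) = (if c = e then 1 else 0)" for c e
  proof -
    have "contr G (\<lambda>m n. p c m * p e n) = (\<Sum>n\<in>UNIV. \<Sum>m\<in>UNIV. p c m * G m n * p e n)"
      unfolding contr_def by (subst sum.swap) (simp add: mult_ac)
    also have "\<dots> = (\<Sum>n\<in>UNIV. p e n * (\<Sum>m\<in>UNIV. p c m * G m n))"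
      by (simp add: sum_distrib_left mult_ac)
    finally show ?thesis unfolding p_ginv[OF G] p_q by auto
  qed
  have "contr G (\<lambda>m n. \<phi> [i, j, m] * \<phi> [k, l, n]) =
      contr G (\<lambda>m n. \<Sum>c\<in>UNIV. \<Sum>e\<in>UNIV. (X i j c * X k l e) * (p c m * p e n))"
    unfolding \<phi>_X sum_product by (intro arg_cong[of _ _ "contr G"] ext sum.cong refl) (simp add: mult_ac)
  also have "\<dots> = (\<Sum>c\<in>UNIV. X i j c * X k l c)"
    unfolding contr_sum contr_cmult pGp
    by (simp add: if_distrib[of "\<lambda>c. _ * c"] cong: if_cong)
  also have "\<dots> = (\<Sum>c\<in>UNIV. pullback p (\<lambda>as. g2_model_form (take 2 as @ [c]) * g2_model_form (drop 2 as @ [c])) [i, j, k, l])"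
  proof (rule sum.cong[OF refl])
    fix c show "X i j c * X k l c =
      pullback p (\<lambda>as. g2_model_form (take 2 as @ [c]) * g2_model_form (drop 2 as @ [c])) [i, j, k, l]"
      using pullback_tensor[of "[i, j]" 2 p "\<lambda>as. g2_model_form (as @ [c])" "\<lambda>as. g2_model_form (as @ [c])" "[k, l]"]
      by (simp add: X_def del: pullback.simps)
  qed
  also have "\<dots> = pullback p (\<lambda>as. delta (as ! 0) (as ! 2) * delta (as ! 1) (as ! 3)
      - delta (as ! 0) (as ! 3) * delta (as ! 1) (as ! 2)
      - g2_model_dual (as ! 0) (as ! 1) (as ! 2) (as ! 3)) [i, j, k, l]"
    unfolding pullback_sum[symmetric]
    by (rule pullback_cong) (auto simp: length_Suc_conv g2_model_dual_def)
  also have "\<dots> = g i k * g j l - g i l * g j k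
    - pullback p (\<lambda>as. g2_model_dual (as ! 0) (as ! 1) (as ! 2) (as ! 3)) [i, j, k, l]"
  proof -
    have "(\<Sum>c\<in>UNIV. p c k * (\<Sum>e\<in>UNIV. p e l * (delta a c * delta b e))) = p a k * p b l"
      "(\<Sum>c\<in>UNIV. p c k * (\<Sum>e\<in>UNIV. p e l * (delta a e * delta b c))) = p a l * p b k" for a b
    proof -
      have s: "(\<Sum>e\<in>UNIV. p e m * delta a e) = p a m" for a m
        by (simp add: delta_def if_distrib[of "\<lambda>c. _ * c"] cong: if_cong)
      have "(\<Sum>e\<in>UNIV. p e m * (delta a e * z)) = (\<Sum>e\<in>UNIV. p e m * delta a e) * z"
        "(\<Sum>e\<in>UNIV. p e m * (z * delta a e)) = (\<Sum>e\<in>UNIV. p e m * delta a e) * z" for a m z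
        by (simp_all only: sum_distrib_right mult.assoc mult.commute[of z])
      note s' = this[unfolded s]
      show "(\<Sum>c\<in>UNIV. p c k * (\<Sum>e\<in>UNIV. p e l * (delta a c * delta b e))) = p a k * p b l"
        "(\<Sum>c\<in>UNIV. p c k * (\<Sum>e\<in>UNIV. p e l * (delta a e * delta b c))) = p a l * p b k"
        by (simp_all only: s') (rule mult.commute)
    qed
    then have "pullback p (\<lambda>as. delta (as ! 0) (as ! 2) * delta (as ! 1) (as ! 3)) [i, j, k, l] = g i k * g j l"
      "pullback p (\<lambda>as. delta (as ! 0) (as ! 3) * delta (as ! 1) (as ! 2)) [i, j, k, l] = g i l * g j k"
      unfolding g_eq sum_product by (simp_all add: sum_distrib_left) (simp_all only: mult_ac)
    then show ?thesis by (simp add: pullback_diff del: pullback.simps)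
  qed
  finally show ?thesis .
qed

end

section \<open>The Ricci curvature\<close>

context riemannian_chart
begin

text \<open>Positions 0 and 1 of \<open>m # n # ls\<close> are the contracted pair; the lists I and
  J say which factor takes which slot. Each product rule below is an instance with explicit position
  lists.\<close>

lemma nabla_contr_mult:
  assumes x: "x \<in> S"
    and IJ: "distinct (I @ J)" "set (I @ J) = {..<length ls + 2}"
    and A: "\<And>m n. (\<lambda>y. A y [] (map ((!) (m # n # ls)) I)) differentiable (at x)"
    and B: "\<And>m n. (\<lambda>y. B y [] (map ((!) (m # n # ls)) J)) differentiable (at x)"
  shows "nabla g i (\<lambda>y us ls. contr (ginv g y) (\<lambda>m n.
      A y [] (map ((!) (m # n # ls)) I) * B y [] (map ((!) (m # n # ls)) J))) x [] ls =
    contr (ginv g x) (\<lambda>m n.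
      nabla g i A x [] (map ((!) (m # n # ls)) I) * B x [] (map ((!) (m # n # ls)) J)
      + A x [] (map ((!) (m # n # ls)) I) * nabla g i B x [] (map ((!) (m # n # ls)) J))"
proof -
  have "nabla g i (\<lambda>y us ls. A y [] (map ((!) (ls ! 0 # ls ! 1 # drop 2 ls)) I)
      * B y [] (map ((!) (ls ! 0 # ls ! 1 # drop 2 ls)) J)) x [] (m # n # ls) =
    nabla g i (\<lambda>y us ls. A y [] (map ((!) ls) I) * B y [] (map ((!) ls) J)) x [] (m # n # ls)" for m n
  proof (rule nabla_cong_open[OF open_S x, of 0 "length ls + 2"])
    fix y and us ks :: "'n list" assume "length ks = length ls + 2"
    then have "ks ! 0 # ks ! 1 # drop 2 ks = ks" by (auto simp: length_Suc_conv)
    then show "A y [] (map ((!) (ks ! 0 # ks ! 1 # drop 2 ks)) I) * B y [] (map ((!) (ks ! 0 # ks ! 1 # drop 2 ks)) J)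
      = A y [] (map ((!) ks) I) * B y [] (map ((!) ks) J)" by simp
  qed auto
  moreover have "nabla g i (\<lambda>y us ls. A y [] (map ((!) ls) I) * B y [] (map ((!) ls) J)) x [] (m # n # ls) =
      nabla g i A x [] (map ((!) (m # n # ls)) I) * B x [] (map ((!) (m # n # ls)) J)
      + A x [] (map ((!) (m # n # ls)) I) * nabla g i B x [] (map ((!) (m # n # ls)) J)" for m n
    by (rule nabla_mult) (use IJ A B in simp_all)
  ultimately show ?thesis
    by (subst nabla_contr[OF x]) (use A B in \<open>simp_all only: differentiable_mult\<close>)
qed

text \<open>The Ricci identity yields the curvature with an upper index; inserting the metric and
  its inverse brings it to the paired form used in the pointwise algebra.\<close>

lemma sum_riemann_up:
  assumes x: "x \<in> S"
  shows "(\<Sum>p\<in>UNIV. riemann_up g x p i j k * f p) = contr (ginv g x) (\<lambda>m n. riemann g x i j k m * f n)"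
proof -
  have "contr (ginv g x) (\<lambda>m n. riemann g x i j k m * f n) =
      (\<Sum>m\<in>UNIV. \<Sum>p\<in>UNIV. \<Sum>n\<in>UNIV. riemann_up g x p i j k * (g x [] [p, m] * ginv g x m n) * f n)"
    unfolding contr_def riemann_def sum_distrib_left sum_distrib_right
    by (rule sum.cong[OF refl], subst sum.swap) (simp add: mult_ac)
  also have "\<dots> = (\<Sum>p\<in>UNIV. \<Sum>m\<in>UNIV. \<Sum>n\<in>UNIV. riemann_up g x p i j k * (g x [] [p, m] * ginv g x m n) * f n)"
    by (rule sum.swap)
  also have "\<dots> = (\<Sum>p\<in>UNIV. \<Sum>n\<in>UNIV. \<Sum>m\<in>UNIV. riemann_up g x p i j k * (g x [] [p, m] * ginv g x m n) * f n)"
    by (rule sum.cong[OF refl], rule sum.swap)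
  also have "\<dots> = (\<Sum>p\<in>UNIV. \<Sum>n\<in>UNIV. riemann_up g x p i j k * (if p = n then 1 else 0) * f n)"
    by (simp only: sum_distrib_left[symmetric] sum_distrib_right[symmetric] ginv_right[OF x])
  also have "\<dots> = (\<Sum>p\<in>UNIV. riemann_up g x p i j k * f p)"
    by (simp only: mult.assoc sum_distrib_left[symmetric] sum_delta_left)
  finally show ?thesis by simp
qed

end

text \<open>The contraction identity is required on the whole chart, because it is differentiated;
  it also supplies the differentiability of \<psi>.\<close>

locale g2_chart = riemannian_chart S g for S and g :: "7 tfield" +
  fixes \<phi> \<psi> T :: "7 tfield"
  assumes \<phi>_smooth: "\<And>ls. length ls = 3 \<Longrightarrow> smooth_on S (\<lambda>y. \<phi> y [] ls)"
    and T_smooth: "\<And>ls. length ls = 2 \<Longrightarrow> smooth_on S (\<lambda>y. T y [] ls)"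
    and contraction: "\<And>y. y \<in> S \<Longrightarrow> g2_contraction (ginv g y) (\<lambda>a b. g y [] [a, b])
      (\<lambda>a b c. \<phi> y [] [a, b, c]) (\<lambda>a b c d. \<psi> y [] [a, b, c, d])"
    and torsion: "\<And>y l a b c. y \<in> S \<Longrightarrow> nabla g l \<phi> y [] [a, b, c] =
      contr (ginv g y) (\<lambda>m n. T y [] [l, m] * \<psi> y [] [n, a, b, c])"
begin

lemma \<phi>_diff: "x \<in> S \<Longrightarrow> (\<lambda>y. \<phi> y [] [a, b, c]) differentiable (at x)"
  using smooth_on_differentiable[OF \<phi>_smooth] by simp

lemma T_diff: "x \<in> S \<Longrightarrow> (\<lambda>y. T y [] [a, b]) differentiable (at x)"
  using smooth_on_differentiable[OF T_smooth] by simp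

lemma \<psi>_eq: "y \<in> S \<Longrightarrow> \<psi> y [] [a, b, c, d] = g y [] [a, c] * g y [] [b, d] - g y [] [a, d] * g y [] [b, c]
    - contr (ginv g y) (\<lambda>m n. \<phi> y [] [a, b, m] * \<phi> y [] [c, d, n])"
  using g2_contraction.contr_\<phi>_\<phi>[OF contraction] by simp

lemma \<psi>_diff:
  assumes x: "x \<in> S"
  shows "(\<lambda>y. \<psi> y [] [a, b, c, d]) differentiable (at x)"
  by (rule differentiable_cong_open[OF open_S x \<psi>_eq])
    (assumption | intro differentiable_diff differentiable_mult contr_differentiable x
      g_differentiable[OF x] \<phi>_diff[OF x])+

lemma nabla_\<psi>:
  assumes x: "x \<in> S"
  shows "nabla g i \<psi> x [] [a, b, c, d] = - contr (ginv g x) (\<lambda>m n.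
    nabla g i \<phi> x [] [a, b, m] * \<phi> x [] [c, d, n] + \<phi> x [] [a, b, m] * nabla g i \<phi> x [] [c, d, n])"
proof -
  let ?A = "\<lambda>y us ls :: 7 list. g y [] (map ((!) ls) [0, 2]) * g y [] (map ((!) ls) [1, 3])"
  let ?B = "\<lambda>y us ls :: 7 list. g y [] (map ((!) ls) [0, 3]) * g y [] (map ((!) ls) [1, 2])"
  \<comment> \<open>With ls = [a, b, c, d] the positions 2 to 5 are a to d, so the lists encode
    \<phi>_abm and \<phi>_cdn.\<close>
  let ?C = "\<lambda>y us ls :: 7 list. contr (ginv g y) (\<lambda>m n. \<phi> y [] (map ((!) (m # n # ls)) [2, 3, 0])
      * \<phi> y [] (map ((!) (m # n # ls)) [4, 5, 1]))"
  let ?ls = "[a, b, c, d]"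
  have "nabla g i \<psi> x [] ?ls = nabla g i (\<lambda>y us ls. ?A y us ls - ?B y us ls - ?C y us ls) x [] ?ls"
    by (rule nabla_cong_open[OF open_S x, of 0 4]) (auto simp: length_Suc_conv numeral_eq_Suc \<psi>_eq)
  also have "\<dots> = nabla g i ?A x [] ?ls - nabla g i ?B x [] ?ls - nabla g i ?C x [] ?ls"
  proof -
    have d: "(\<lambda>y. ?A y [] ?ls) differentiable (at x)" "(\<lambda>y. ?B y [] ?ls) differentiable (at x)"
      "(\<lambda>y. ?C y [] ?ls) differentiable (at x)"
      by (auto intro!: differentiable_mult contr_differentiable x g_differentiable[OF x] \<phi>_diff[OF x])
    show ?thesis
      by (subst nabla_diff[of "\<lambda>y us ls. ?A y us ls - ?B y us ls" "[]" ?ls x ?C, OF differentiable_diff[OF d(1,2)] d(3)],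
          subst nabla_diff[of ?A "[]" ?ls x ?B, OF d(1,2)]) (rule refl)
  qed
  also have "nabla g i ?A x [] ?ls = 0"
    by (subst nabla_mult[of "[0, 2]" "[1, 3]" ?ls g x g]) (auto simp: nabla_g[OF x] g_differentiable[OF x] lessThan_Suc numeral_eq_Suc)
  also have "nabla g i ?B x [] ?ls = 0"
    by (subst nabla_mult[of "[0, 3]" "[1, 2]" ?ls g x g]) (auto simp: nabla_g[OF x] g_differentiable[OF x] lessThan_Suc numeral_eq_Suc)
  also have "nabla g i ?C x [] ?ls = contr (ginv g x) (\<lambda>m n.
    nabla g i \<phi> x [] [a, b, m] * \<phi> x [] [c, d, n] + \<phi> x [] [a, b, m] * nabla g i \<phi> x [] [c, d, n])"
    by (subst nabla_contr_mult[OF x]) (auto simp: \<phi>_diff[OF x] lessThan_Suc numeral_eq_Suc)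
  finally show ?thesis by simp
qed

text \<open>In \<open>?B\<close> the direction j is a genuine slot. The Christoffel sum repairs the
  difference to a fixed direction and is symmetric in i and j.\<close>

lemma nabla_nabla_\<phi>:
  assumes x: "x \<in> S"
  shows "nabla g i (nabla g j \<phi>) x [] [a, b, c] = contr (ginv g x) (\<lambda>m n.
      nabla g i T x [] [j, m] * \<psi> x [] [n, a, b, c] + T x [] [j, m] * nabla g i \<psi> x [] [n, a, b, c])
    + (\<Sum>p\<in>UNIV. \<Gamma> x p i j * contr (ginv g x) (\<lambda>m n. T x [] [p, m] * \<psi> x [] [n, a, b, c]))"
proof -
  let ?B = "\<lambda>y us ls :: 7 list. contr (ginv g y) (\<lambda>m n. T y [] (map ((!) (m # n # ls)) [2, 0])
      * \<psi> y [] (map ((!) (m # n # ls)) [1, 3, 4, 5]))"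
  have "nabla g i (nabla g j \<phi>) x [] [a, b, c] = nabla g i (\<lambda>y us ls. ?B y us (j # ls)) x [] [a, b, c]"
    by (rule nabla_cong_open[OF open_S x, of 0 3]) (auto simp: length_Suc_conv torsion numeral_3_eq_3)
  also have "\<dots> = nabla g i ?B x [] [j, a, b, c] + (\<Sum>p\<in>UNIV. \<Gamma> x p i j * ?B x [] [p, a, b, c])"
    by (rule nabla_fix_slot)
  also have "nabla g i ?B x [] [j, a, b, c] = contr (ginv g x) (\<lambda>m n.
      nabla g i T x [] [j, m] * \<psi> x [] [n, a, b, c] + T x [] [j, m] * nabla g i \<psi> x [] [n, a, b, c])"
    by (subst nabla_contr_mult[OF x]) (auto simp: T_diff[OF x] \<psi>_diff[OF x] lessThan_Suc numeral_eq_Suc)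
  finally show ?thesis by simp
qed

lemma skew_nabla_T:
  assumes x: "x \<in> S"
  shows "nabla g i T x [] [j, s] - nabla g j T x [] [i, s] =
    contr (ginv g x) (\<lambda>m m'. T x [] [j, m] * contr (ginv g x) (\<lambda>p p'. T x [] [i, p] * \<phi> x [] [s, p', m']))
    + contr (ginv g x) (\<lambda>a a'. contr (ginv g x) (\<lambda>b b'. riemann g x i j a b * \<phi> x [] [s, a', b'])) / 2"
proof -
  interpret g2_contraction "ginv g x" "\<lambda>a b. g x [] [a, b]" "\<lambda>a b c. \<phi> x [] [a, b, c]"
      "\<lambda>a b c d. \<psi> x [] [a, b, c, d]"
    by (rule contraction[OF x])
  let ?T = "\<lambda>i m. T x [] [i, m]" and ?\<phi> = "\<lambda>a b c. \<phi> x [] [a, b, c]" and ?\<psi> = "\<lambda>a b c d. \<psi> x [] [a, b, c, d]"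
    and ?D = "\<lambda>i j m. nabla g i T x [] [j, m]" and ?R = "\<lambda>a b. riemann g x i j a b"
  let ?d = "\<lambda>i a b c. dot1 (?T i) (\<lambda>p. ?\<psi> p a b c)"
  let ?e = "\<lambda>i m a b c. - (dot1 (?d i m a) (?\<phi> b c) + dot1 (?\<phi> m a) (?d i b c))"
  have d: "nabla g i \<phi> x [] [a, b, c] = ?d i a b c" for i a b c
    unfolding torsion[OF x] dot1_def ..
  have e: "nabla g i \<psi> x [] [m, a, b, c] = ?e i m a b c" for i m a b c
    unfolding nabla_\<psi>[OF x] d contr_add by (simp only: dot1_def)
  have 1: "nabla g i (nabla g j \<phi>) x [] [a, b, c] = dot1 (?D i j) (\<lambda>n. ?\<psi> n a b c) + dot1 (?T j) (\<lambda>n. ?e i n a b c)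
      + (\<Sum>p\<in>UNIV. \<Gamma> x p i j * ?d p a b c)" for i j a b c
    unfolding nabla_nabla_\<phi>[OF x] e contr_add by (simp only: dot1_def)
  have "(\<Sum>p\<in>UNIV. riemann_up g x p i j k * f p) = dot1 (?R k) f" for k f
    unfolding sum_riemann_up[OF x] dot1_def ..
  then have 2: "nabla g i (nabla g j \<phi>) x [] [a, b, c] - nabla g j (nabla g i \<phi>) x [] [a, b, c] =
      - (dot1 (?R a) (\<lambda>p. ?\<phi> p b c) + dot1 (?R b) (\<lambda>p. ?\<phi> a p c) + dot1 (?R c) (\<lambda>p. ?\<phi> a b p))" for a b c
    by (simp add: ricci_identity[where s = 3 and ls = "[a, b, c]" and B = \<phi>, OF x \<phi>_smooth] numeral_3_eq_3 lessThan_Suc)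
  have "?D i j s - ?D j i s = dot1 (?T j) (\<lambda>m. dot1 (?T i) (\<lambda>p. ?\<phi> s p m)) + dot2 ?R (?\<phi> s) / 2"
  proof (rule skew_torsion_derivative[where D = "\<lambda>m. ?D i j m - ?D j i m" and t = "?T i" and u = "?T j" and r = ?R])
    fix a b c
    \<comment> \<open>Torsion-freeness cancels the two Christoffel sums in the commutator.\<close>
    have "\<Gamma> x p i j = \<Gamma> x p j i" for p by (rule \<Gamma>_sym[OF x])
    then show "dot1 (\<lambda>m. ?D i j m - ?D j i m) (\<lambda>n. ?\<psi> n a b c) + dot1 (?T j) (\<lambda>n. ?e i n a b c)
        - dot1 (?T i) (\<lambda>n. ?e j n a b c) =
      - (dot1 (?R a) (\<lambda>p. ?\<phi> p b c) + dot1 (?R b) (\<lambda>p. ?\<phi> a p c) + dot1 (?R c) (\<lambda>p. ?\<phi> a b p))"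
      using 2[of a b c] unfolding 1 dot1_linear(8) by simp
  qed
  then show ?thesis by (simp only: dot1_def dot2_def)
qed

lemma ricci_eq_contr:
  assumes x: "x \<in> S"
  defines "C \<equiv> contr (ginv g x)"
  shows "ricci g x j k = C (\<lambda>i l. C (\<lambda>m n. (nabla g i T x [] [j, m] - nabla g j T x [] [i, m]) * \<phi> x [] [n, k, l]))
    - C (\<lambda>l i. T x [] [j, l] * T x [] [i, k]) + C (\<lambda>i l. T x [] [i, l]) * T x [] [j, k]
    - C (\<lambda>i l. C (\<lambda>b q. T x [] [j, b] * C (\<lambda>a p. T x [] [i, a] * \<psi> x [] [l, p, q, k])))"
proof -
  interpret g2_contraction "ginv g x" "\<lambda>a b. g x [] [a, b]" "\<lambda>a b c. \<phi> x [] [a, b, c]"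
      "\<lambda>a b c d. \<psi> x [] [a, b, c, d]"
    by (rule contraction[OF x])
  have "ricci g x j k = contr (ginv g x) (\<lambda>i l. riemann g x i j k l)"
    by (simp add: ricci_def contr_def mult.commute)
  also have "\<dots> = contr (ginv g x) (\<lambda>i l. dot1 (\<lambda>m. nabla g i T x [] [j, m] - nabla g j T x [] [i, m]) (\<lambda>n. \<phi> x [] [n, k, l]))
    - dot1 (\<lambda>l. T x [] [j, l]) (\<lambda>i. T x [] [i, k]) + contr (ginv g x) (\<lambda>i l. T x [] [i, l]) * T x [] [j, k]
    - contr (ginv g x) (\<lambda>i l. dot1 (\<lambda>b. T x [] [j, b]) (\<lambda>q. dot1 (\<lambda>a. T x [] [i, a]) (\<lambda>p. \<psi> x [] [l, p, q, k])))"
  proof (rule ricci_from_torsion)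
    show "nabla g i T x [] [j, s] - nabla g j T x [] [i, s] =
        dot1 (\<lambda>b. T x [] [j, b]) (\<lambda>m. dot1 (\<lambda>b. T x [] [i, b]) (\<lambda>p. \<phi> x [] [s, p, m]))
        + dot2 (riemann g x i j) (\<lambda>b c. \<phi> x [] [s, b, c]) / 2" for i j s
      unfolding skew_nabla_T[OF x] by (simp only: dot1_def dot2_def)
  qed (rule riemann_skew'[OF x] riemann_pair[OF x] riemann_bianchi[OF x])+
  finally show ?thesis by (simp only: dot1_def C_def)
qed

lemma nabla_divergence:
  assumes x: "x \<in> S"
  shows "(\<Sum>i\<in>UNIV. nabla g i (\<lambda>y us ls. \<Sum>l\<in>UNIV. ginv g y (us ! 0) l *
      contr (ginv g y) (\<lambda>m n. T y [] [ls ! 0, m] * \<phi> y [] [n, ls ! 1, l])) x [i] [j, k]) =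
    contr (ginv g x) (\<lambda>i l. contr (ginv g x) (\<lambda>m n. nabla g i T x [] [j, m] * \<phi> x [] [n, k, l]
      + T x [] [j, m] * nabla g i \<phi> x [] [n, k, l]))"
proof -
  let ?F = "\<lambda>y l ls. contr (ginv g y) (\<lambda>m n. T y [] [ls ! 0, m] * \<phi> y [] [n, ls ! 1, l])"
  have "nabla g i (\<lambda>y us ls. \<Sum>l\<in>UNIV. ginv g y (us ! 0) l * ?F y l ls) x [i] [j, k] =
      (\<Sum>l\<in>UNIV. ginv g x i l * nabla g i (\<lambda>y us ls. ?F y (ls ! 0) (drop 1 ls)) x [] [l, j, k])" for i
    by (rule nabla_raise[OF x]) (auto intro!: contr_differentiable x differentiable_mult T_diff[OF x] \<phi>_diff[OF x])
  moreover have "nabla g i (\<lambda>y us ls. ?F y (ls ! 0) (drop 1 ls)) x [] [l, j, k] =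
    contr (ginv g x) (\<lambda>m n. nabla g i T x [] [j, m] * \<phi> x [] [n, k, l] + T x [] [j, m] * nabla g i \<phi> x [] [n, k, l])" for i l
  proof -
    let ?C = "\<lambda>y us ls :: 7 list. contr (ginv g y) (\<lambda>m n. T y [] (map ((!) (m # n # ls)) [3, 0])
      * \<phi> y [] (map ((!) (m # n # ls)) [1, 4, 2]))"
    have "nabla g i (\<lambda>y us ls. ?F y (ls ! 0) (drop 1 ls)) x [] [l, j, k] = nabla g i ?C x [] [l, j, k]"
      by (rule nabla_cong_open[OF open_S x, of 0 3]) (auto simp: length_Suc_conv numeral_eq_Suc)
    also have "\<dots> = contr (ginv g x) (\<lambda>m n. nabla g i T x [] [j, m] * \<phi> x [] [n, k, l] + T x [] [j, m] * nabla g i \<phi> x [] [n, k, l])"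
      by (subst nabla_contr_mult[OF x]) (auto simp: T_diff[OF x] \<phi>_diff[OF x] lessThan_Suc numeral_eq_Suc)
    finally show ?thesis .
  qed
  ultimately show ?thesis by (simp only: contr_def[of _ "\<lambda>i l. contr _ (_ i l)"])
qed

lemma nabla_trace:
  assumes x: "x \<in> S"
  shows "nabla g j (\<lambda>y us ls. contr (ginv g y) (\<lambda>i l. contr (ginv g y) (\<lambda>m n.
      T y [] [i, m] * \<phi> y [] [n, ls ! 0, l]))) x [] [k] =
    contr (ginv g x) (\<lambda>i l. contr (ginv g x) (\<lambda>m n. nabla g j T x [] [i, m] * \<phi> x [] [n, k, l]
      + T x [] [i, m] * nabla g j \<phi> x [] [n, k, l]))"
proof -
  let ?F = "\<lambda>y i l ls. contr (ginv g y) (\<lambda>m n. T y [] [i, m] * \<phi> y [] [n, ls ! 0, l])"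
  have "nabla g j (\<lambda>y us ls. contr (ginv g y) (\<lambda>i l. ?F y i l ls)) x [] [k] =
      contr (ginv g x) (\<lambda>i l. nabla g j (\<lambda>y us ls. ?F y (ls ! 0) (ls ! 1) (drop 2 ls)) x [] [i, l, k])"
    by (rule nabla_contr[OF x]) (auto intro!: contr_differentiable x differentiable_mult T_diff[OF x] \<phi>_diff[OF x])
  moreover have "nabla g j (\<lambda>y us ls. ?F y (ls ! 0) (ls ! 1) (drop 2 ls)) x [] [i, l, k] =
    contr (ginv g x) (\<lambda>m n. nabla g j T x [] [i, m] * \<phi> x [] [n, k, l] + T x [] [i, m] * nabla g j \<phi> x [] [n, k, l])" for i l
  proof -
    let ?C = "\<lambda>y us ls :: 7 list. contr (ginv g y) (\<lambda>m n. T y [] (map ((!) (m # n # ls)) [2, 0])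
      * \<phi> y [] (map ((!) (m # n # ls)) [1, 4, 3]))"
    have "nabla g j (\<lambda>y us ls. ?F y (ls ! 0) (ls ! 1) (drop 2 ls)) x [] [i, l, k] = nabla g j ?C x [] [i, l, k]"
      by (rule nabla_cong_open[OF open_S x, of 0 3]) (auto simp: length_Suc_conv numeral_eq_Suc)
    also have "\<dots> = contr (ginv g x) (\<lambda>m n. nabla g j T x [] [i, m] * \<phi> x [] [n, k, l] + T x [] [i, m] * nabla g j \<phi> x [] [n, k, l])"
      by (subst nabla_contr_mult[OF x]) (auto simp: T_diff[OF x] \<phi>_diff[OF x] lessThan_Suc numeral_eq_Suc)
    finally show ?thesis .
  qed
  ultimately show ?thesis by simp
qed

text \<open>By \<open>torsion\<close> the extra product-rule terms are contractions of two torsions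
  with \<psi>. Bringing \<psi> to the index order of the theorem gives -\<open>?\<Omega>\<close> for
  the first and \<open>?\<Omega>\<close> for the second, hence the factor -2.\<close>

lemma divergence_diff_trace:
  assumes x: "x \<in> S"
  defines "C \<equiv> contr (ginv g x)"
  shows "C (\<lambda>i l. C (\<lambda>m n. nabla g i T x [] [j, m] * \<phi> x [] [n, k, l] + T x [] [j, m] * nabla g i \<phi> x [] [n, k, l]))
    - C (\<lambda>i l. C (\<lambda>m n. nabla g j T x [] [i, m] * \<phi> x [] [n, k, l] + T x [] [i, m] * nabla g j \<phi> x [] [n, k, l]))
    = C (\<lambda>i l. C (\<lambda>m n. (nabla g i T x [] [j, m] - nabla g j T x [] [i, m]) * \<phi> x [] [n, k, l]))
    - 2 * C (\<lambda>i l. C (\<lambda>b q. T x [] [j, b] * C (\<lambda>a p. T x [] [i, a] * \<psi> x [] [l, p, q, k])))"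
proof -
  interpret g2_contraction "ginv g x" "\<lambda>a b. g x [] [a, b]" "\<lambda>a b c. \<phi> x [] [a, b, c]"
      "\<lambda>a b c d. \<psi> x [] [a, b, c, d]"
    by (rule contraction[OF x])
  let ?T = "\<lambda>i m. T x [] [i, m]" and ?\<psi> = "\<lambda>a b c d. \<psi> x [] [a, b, c, d]"
  let ?\<Omega> = "\<lambda>i l. dot1 (?T j) (\<lambda>q. dot1 (?T i) (\<lambda>p. ?\<psi> l p q k))"
  have 1: "dot1 (?T j) (\<lambda>n. dot1 (?T i) (\<lambda>p. ?\<psi> p n k l)) = - ?\<Omega> i l" for i l
    unfolding dot1_linear(3)[symmetric] by (intro arg_cong[of _ _ "dot1 _"] ext \<psi>_rotate4)
  have 2: "dot1 (?T i) (\<lambda>n. dot1 (?T j) (\<lambda>p. ?\<psi> p n k l)) = ?\<Omega> i l" for i l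
  proof -
    have "?\<psi> p n k l = ?\<psi> l n p k" for p n
      using \<psi>_rotate4[of p n k l] \<psi>_23[of l n p k] by simp
    then show ?thesis by (subst dot1_dot1) simp
  qed
  show ?thesis
    unfolding C_def torsion[OF x] dot1_def[symmetric] contr_add
    by (simp only: 1 2 dot1_linear(8) contr_add contr_diff contr_uminus)
qed

end

section \<open>Nested contractions in the summation order of the theorem\<close>

lemma sum_swap3: "(\<Sum>a\<in>A. \<Sum>b\<in>B. \<Sum>c\<in>C. f a b c) = (\<Sum>c\<in>C. \<Sum>a\<in>A. \<Sum>b\<in>B. f a b c)"
  by (rule trans[OF sum.cong[OF refl sum.swap] sum.swap])

lemma sum_contr:
  "(\<Sum>m\<in>UNIV. \<Sum>n\<in>UNIV. \<Sum>l\<in>UNIV. H m n l * G m n * u l) = (\<Sum>l\<in>UNIV. u l * contr G (\<lambda>m n. H m n l))"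
  unfolding contr_def sum_distrib_left by (subst sum_swap3) (simp add: mult_ac)

lemma sum_contr_contr:
  "(\<Sum>i\<in>UNIV. \<Sum>m\<in>UNIV. \<Sum>n\<in>UNIV. \<Sum>l\<in>UNIV. H i m n l * G m n * G i l) =
    contr G (\<lambda>i l. contr G (\<lambda>m n. H i m n l))"
  unfolding sum_contr contr_def[of G "\<lambda>i l. contr G (\<lambda>m n. H i m n l)"] ..

lemma sum_contr_contr_contr:
  "(\<Sum>b\<in>UNIV. \<Sum>i\<in>UNIV. \<Sum>a\<in>UNIV. \<Sum>l\<in>UNIV. \<Sum>p\<in>UNIV. \<Sum>q\<in>UNIV.
      u b * v i a * G i l * G a p * H l p q * G b q) =
    contr G (\<lambda>i l. contr G (\<lambda>b q. u b * contr G (\<lambda>a p. v i a * H l p q)))"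
proof -
  have "(\<Sum>b\<in>UNIV. \<Sum>i\<in>UNIV. \<Sum>a\<in>UNIV. \<Sum>l\<in>UNIV. \<Sum>p\<in>UNIV. \<Sum>q\<in>UNIV.
      u b * v i a * G i l * G a p * H l p q * G b q) =
    (\<Sum>i\<in>UNIV. \<Sum>b\<in>UNIV. \<Sum>a\<in>UNIV. \<Sum>l\<in>UNIV. \<Sum>q\<in>UNIV. \<Sum>p\<in>UNIV.
      u b * v i a * G i l * G a p * H l p q * G b q)"
    by (rule trans[OF sum.swap], rule sum.cong[OF refl], rule sum.cong[OF refl],
        rule sum.cong[OF refl], rule sum.cong[OF refl], rule sum.swap)
  also have "\<dots> = (\<Sum>i\<in>UNIV. \<Sum>l\<in>UNIV. \<Sum>b\<in>UNIV. \<Sum>a\<in>UNIV. \<Sum>q\<in>UNIV. \<Sum>p\<in>UNIV.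
      u b * v i a * G i l * G a p * H l p q * G b q)"
    by (rule sum.cong[OF refl], rule sum_swap3)
  also have "\<dots> = (\<Sum>i\<in>UNIV. \<Sum>l\<in>UNIV. \<Sum>b\<in>UNIV. \<Sum>q\<in>UNIV. \<Sum>a\<in>UNIV. \<Sum>p\<in>UNIV.
      u b * v i a * G i l * G a p * H l p q * G b q)"
    by (rule sum.cong[OF refl], rule sum.cong[OF refl], rule sum.cong[OF refl], rule sum.swap)
  also have "\<dots> = contr G (\<lambda>i l. contr G (\<lambda>b q. u b * contr G (\<lambda>a p. v i a * H l p q)))"
    by (simp add: contr_def sum_distrib_left mult_ac)
  finally show ?thesis .
qed

lemma tensor_field_smooth:
  "tensor_field A 0 s \<Phi> \<Longrightarrow> ch \<in> A \<Longrightarrow> length ls = s \<Longrightarrow> smooth_on (chart_image ch) (\<lambda>x. \<Phi> ch x [] ls)"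
  unfolding tensor_field_def by simp

text \<open>The free slots of the Hodge star are slots of the volume form and inherit its
  skewness.\<close>

lemma alternating_4_of_hodge_star:
  assumes vol: "alternating 7 (vol x [])"
  shows "hodge_star 3 g vol \<phi> x us [b, a, c, d] = - hodge_star 3 g vol \<phi> x us [a, b, c, d]"
    and "hodge_star 3 g vol \<phi> x us [a, c, b, d] = - hodge_star 3 g vol \<phi> x us [a, b, c, d]"
    and "hodge_star 3 g vol \<phi> x us [a, b, d, c] = - hodge_star 3 g vol \<phi> x us [a, b, c, d]"
proof -
  have "vol x [] (ms @ [b, a, c, d]) = - vol x [] (ms @ [a, b, c, d])"
    "vol x [] (ms @ [a, c, b, d]) = - vol x [] (ms @ [a, b, c, d])"
    "vol x [] (ms @ [a, b, d, c]) = - vol x [] (ms @ [a, b, c, d])" if len: "length ms = 3" for ms a b c d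
  proof -
    obtain p q r where ms: "ms = [p, q, r]" using len by (auto simp: length_Suc_conv numeral_3_eq_3)
    show "vol x [] (ms @ [b, a, c, d]) = - vol x [] (ms @ [a, b, c, d])"
      "vol x [] (ms @ [a, c, b, d]) = - vol x [] (ms @ [a, b, c, d])"
      "vol x [] (ms @ [a, b, d, c]) = - vol x [] (ms @ [a, b, c, d])"
      unfolding ms append.simps by (rule alternating_swaps7[OF vol])+
  qed
  note v = this
  have "hodge_star 3 g vol \<phi> x us js = - hodge_star 3 g vol \<phi> x us ks"
    if "\<And>ms. length ms = 3 \<Longrightarrow> vol x [] (ms @ js) = - vol x [] (ms @ ks)" for js ks
    unfolding hodge_star_def using that
    by (simp add: sum_negf[symmetric] minus_divide_left del: sum_negf)
  then show "hodge_star 3 g vol \<phi> x us [b, a, c, d] = - hodge_star 3 g vol \<phi> x us [a, b, c, d]"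
    "hodge_star 3 g vol \<phi> x us [a, c, b, d] = - hodge_star 3 g vol \<phi> x us [a, b, c, d]"
    "hodge_star 3 g vol \<phi> x us [a, b, d, c] = - hodge_star 3 g vol \<phi> x us [a, b, c, d]"
    using v by blast+
qed

lemma g2_chart_of_structure:
  assumes M: "smooth_manifold M A" and \<phi>: "g2_structure A \<phi>" and g: "g2_metric A \<phi> g vol"
    and \<psi>: "\<psi> = (\<lambda>c. hodge_star 3 (g c) (vol c) (\<phi> c))"
    and T: "full_torsion A \<phi> g \<psi> T" and ch: "ch \<in> A"
  shows "g2_chart (chart_image ch) (g ch) (\<phi> ch) (\<psi> ch) (T ch)"
proof -
  let ?S = "chart_image ch"
  have riem: "riemannian_metric A g" and vol: "volume_form A g vol" using g by (simp_all add: g2_metric_def)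
  have g_tf: "tensor_field A 0 2 g" using riem by (simp add: riemannian_metric_def)
  have g_sym: "g ch y [] [i, j] = g ch y [] [j, i]" if "y \<in> ?S" for y i j
    using riem ch that unfolding riemannian_metric_def by blast
  have g_inv: "invertible (metric_matrix (g ch) y)" if "y \<in> ?S" for y
    by (rule metric_matrix_invertible) (use riem ch that in \<open>auto simp: riemannian_metric_def\<close>)
  interpret riemannian_chart ?S "g ch"
  proof
    show "open ?S" using M ch by (simp add: smooth_manifold_def)
    show "smooth_on ?S (\<lambda>y. g ch y [] [i, j])" for i j
      using tensor_field_smooth[OF g_tf ch] by simp
  qed (fact g_sym g_inv)+
  have \<phi>_alt: "alternating 3 (\<phi> ch y [])" and vol_alt: "alternating 7 (vol ch y [])" if "y \<in> ?S" for y
    using \<phi> vol ch that by (auto simp: g2_structure_def volume_form_def diff_form_def)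
  show ?thesis
  proof (intro g2_chart.intro g2_chart_axioms.intro)
    show "riemannian_chart ?S (g ch)" by (rule riemannian_chart_axioms)
    show "smooth_on ?S (\<lambda>y. \<phi> ch y [] ls)" if "length ls = 3" for ls
      using \<phi> that by (auto simp: g2_structure_def diff_form_def intro: tensor_field_smooth[OF _ ch])
    show "smooth_on ?S (\<lambda>y. T ch y [] ls)" if "length ls = 2" for ls
      using T that by (auto simp: full_torsion_def intro: tensor_field_smooth[OF _ ch])
    show "nabla (g ch) l (\<phi> ch) y [] [a, b, c] =
        contr (ginv (g ch) y) (\<lambda>m n. T ch y [] [l, m] * \<psi> ch y [] [n, a, b, c])" if "y \<in> ?S" for y l a b c
    proof -
      have "nabla (g ch) l (\<phi> ch) y [] [a, b, c] =
          (\<Sum>m\<in>UNIV. \<Sum>n\<in>UNIV. T ch y [] [l, m] * ginv (g ch) y m n * \<psi> ch y [] [n, a, b, c])"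
        using T ch that unfolding full_torsion_def by blast
      then show ?thesis by (simp add: contr_def mult_ac)
    qed
    fix y assume y: "y \<in> ?S"
    obtain P :: "real ^ 7 ^ 7" where P: "invertible P"
      "\<And>a b c. \<phi> ch y [] [a, b, c] = (\<Sum>i\<in>UNIV. \<Sum>j\<in>UNIV. \<Sum>k\<in>UNIV.
          P $ i $ a * P $ j $ b * P $ k $ c * g2_model_form [i, j, k])"
      using \<phi> ch y unfolding g2_structure_def by blast
    \<comment> \<open>P is chosen separately at each point, with no regularity in y. Only identities
      between g, \<phi> and \<psi>, free of P, are carried on and later differentiated.\<close>
    interpret g2_point "\<phi> ch y []" "vol ch y []" "\<lambda>i j. g ch y [] [i, j]" "\<lambda>i j. P $ i $ j"
    proof
      show "\<phi> ch y [] [a, b, c] = pullback (\<lambda>i j. P $ i $ j) g2_model_form [a, b, c]" for a b c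
        by (simp add: P(2) sum_distrib_left mult.assoc)
      show "det (\<chi> i j. P $ i $ j) \<noteq> 0" using P(1) by (simp add: invertible_det_nz)
      show "det (\<chi> i j. g ch y [] [i, j]) \<noteq> 0"
        using g_inv[OF y] by (simp add: invertible_det_nz metric_matrix_def)
      show "alternating 7 (vol ch y [])" by (rule vol_alt[OF y])
      show "\<bar>vol ch y [] idx7\<bar> = sqrt (det (\<chi> i j. g ch y [] [i, j]))"
        using vol ch y unfolding volume_form_def idx7_def metric_matrix_def by blast
      show "wedge 4 3 (wedge 2 2 (interior_prod u (\<phi> ch y [])) (interior_prod v (\<phi> ch y []))) (\<phi> ch y []) idx7 =
        - 6 * (\<Sum>i\<in>UNIV. \<Sum>j\<in>UNIV. g ch y [] [i, j] * u $ i * v $ j) * vol ch y [] idx7" for u v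
      proof -
        have "length idx7 = 7" by simp
        then show ?thesis using g ch y unfolding g2_metric_def by blast
      qed
    qed
    have G: "(\<Sum>b\<in>UNIV. g ch y [] [a, b] * ginv (g ch) y b c) = (if a = c then 1 else 0)" for a c
      by (rule ginv_right[OF y])
    have dual: "\<psi> ch y [] [i, j, k, l] =
        pullback (\<lambda>i j. P $ i $ j) (\<lambda>as. g2_model_dual (as ! 0) (as ! 1) (as ! 2) (as ! 3)) [i, j, k, l]" for i j k l
      using hodge_star_pullback[OF G] by (simp add: \<psi> hodge_star_def fact_numeral del: pullback.simps)
    show "g2_contraction (ginv (g ch) y) (\<lambda>a b. g ch y [] [a, b]) (\<lambda>a b c. \<phi> ch y [] [a, b, c])
      (\<lambda>a b c d. \<psi> ch y [] [a, b, c, d])"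
    proof
      show "ginv (g ch) y a b = ginv (g ch) y b a" for a b by (rule ginv_sym[OF y])
      show "g ch y [] [a, b] = g ch y [] [b, a]" for a b by (rule g_sym[OF y])
      show "(\<Sum>b\<in>UNIV. ginv (g ch) y a b * g ch y [] [b, c]) = (if a = c then 1 else 0)" for a c
        by (rule ginv_left[OF y])
      show "contr (ginv (g ch) y) (\<lambda>m n. \<phi> ch y [] [a, b, m] * \<phi> ch y [] [c, d, n]) =
        g ch y [] [a, c] * g ch y [] [b, d] - g ch y [] [a, d] * g ch y [] [b, c] - \<psi> ch y [] [a, b, c, d]" for a b c d
        unfolding dual by (rule contr_pullback[OF G])
    qed (rule alternating_swaps[OF \<phi>_alt[OF y]],
        rule alternating_swaps[OF \<phi>_alt[OF y]],
        unfold \<psi>, (rule alternating_4_of_hodge_star[where vol = "vol ch" and x = y, OF vol_alt[OF y]])+)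
  qed
qed

theorem proposition4p15:
  fixes M :: "'a topology" and A :: "('a, 7) chart set"
    and \<phi> g vol \<psi> T :: "('a, 7) chart \<Rightarrow> 7 tfield"
    and ch :: "('a, 7) chart" and x :: "real ^ 7" and j k :: 7
  assumes "smooth_manifold M A"
    and "g2_structure A \<phi>"
    and "g2_metric A \<phi> g vol"
    and "\<psi> = (\<lambda>c. hodge_star 3 (g c) (vol c) (\<phi> c))"
    and "full_torsion A \<phi> g \<psi> T"
    and "ch \<in> A" and "x \<in> chart_image ch"
  shows
    "ricci (g ch) x j k =
       (\<Sum>i\<in>UNIV. \<Sum>m\<in>UNIV. \<Sum>n\<in>UNIV. \<Sum>l\<in>UNIV.
          (nabla (g ch) i (T ch) x [] [j, m] - nabla (g ch) j (T ch) x [] [i, m])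
            * \<phi> ch x [] [n, k, l] * ginv (g ch) x m n * ginv (g ch) x i l)
       - (\<Sum>l\<in>UNIV. \<Sum>i\<in>UNIV. T ch x [] [j, l] * ginv (g ch) x l i * T ch x [] [i, k])
       + trace (g ch) (T ch) x * T ch x [] [j, k]
       - (\<Sum>b\<in>UNIV. \<Sum>i\<in>UNIV. \<Sum>a\<in>UNIV. \<Sum>l\<in>UNIV. \<Sum>p\<in>UNIV. \<Sum>q\<in>UNIV.
            T ch x [] [j, b] * T ch x [] [i, a] * ginv (g ch) x i l * ginv (g ch) x a p
              * \<psi> ch x [] [l, p, q, k] * ginv (g ch) x b q)
     \<and>
     ricci (g ch) x j k =
       (\<Sum>i\<in>UNIV. nabla (g ch) i
          (\<lambda>y us ls. \<Sum>m\<in>UNIV. \<Sum>n\<in>UNIV. \<Sum>l\<in>UNIV.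
             T ch y [] [ls ! 0, m] * \<phi> ch y [] [n, ls ! 1, l]
               * ginv (g ch) y m n * ginv (g ch) y (us ! 0) l) x [i] [j, k])
       - nabla (g ch) j
          (\<lambda>y us ls. \<Sum>i\<in>UNIV. \<Sum>m\<in>UNIV. \<Sum>n\<in>UNIV. \<Sum>l\<in>UNIV.
             T ch y [] [i, m] * \<phi> ch y [] [n, ls ! 0, l]
               * ginv (g ch) y m n * ginv (g ch) y i l) x [] [k]
       - (\<Sum>l\<in>UNIV. \<Sum>i\<in>UNIV. T ch x [] [j, l] * ginv (g ch) x l i * T ch x [] [i, k])
       + trace (g ch) (T ch) x * T ch x [] [j, k]
       + (\<Sum>b\<in>UNIV. \<Sum>i\<in>UNIV. \<Sum>a\<in>UNIV. \<Sum>l\<in>UNIV. \<Sum>p\<in>UNIV. \<Sum>q\<in>UNIV.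
            T ch x [] [j, b] * T ch x [] [i, a] * ginv (g ch) x i l * ginv (g ch) x a p
              * \<psi> ch x [] [l, p, q, k] * ginv (g ch) x b q)"
proof -
  interpret g2_chart "chart_image ch" "g ch" "\<phi> ch" "\<psi> ch" "T ch"
    by (rule g2_chart_of_structure) fact+
  let ?G = "ginv (g ch)"
  let ?C = "contr (?G x)"
  let ?d = "\<lambda>i j m. nabla (g ch) i (T ch) x [] [j, m]"
  \<comment> \<open>These sums stand under \<open>nabla\<close>, so they are rearranged as functions
    of the point and not merely at x.\<close>
  have U: "(\<lambda>y us ls. \<Sum>m\<in>UNIV. \<Sum>n\<in>UNIV. \<Sum>l\<in>UNIV.
      T ch y [] [ls ! 0, m] * \<phi> ch y [] [n, ls ! 1, l] * ?G y m n * ?G y (us ! 0) l) =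
    (\<lambda>y us ls. \<Sum>l\<in>UNIV. ?G y (us ! 0) l *
      contr (?G y) (\<lambda>m n. T ch y [] [ls ! 0, m] * \<phi> ch y [] [n, ls ! 1, l]))"
    by (simp only: sum_contr)
  have V: "(\<lambda>y us ls. \<Sum>i\<in>UNIV. \<Sum>m\<in>UNIV. \<Sum>n\<in>UNIV. \<Sum>l\<in>UNIV.
      T ch y [] [i, m] * \<phi> ch y [] [n, ls ! 0, l] * ?G y m n * ?G y i l) =
    (\<lambda>y us ls. contr (?G y) (\<lambda>i l. contr (?G y) (\<lambda>m n. T ch y [] [i, m] * \<phi> ch y [] [n, ls ! 0, l])))"
    by (simp only: sum_contr_contr)
  have 1: "(\<Sum>i\<in>UNIV. \<Sum>m\<in>UNIV. \<Sum>n\<in>UNIV. \<Sum>l\<in>UNIV.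
      (?d i j m - ?d j i m) * \<phi> ch x [] [n, k, l] * ?G x m n * ?G x i l) =
    ?C (\<lambda>i l. ?C (\<lambda>m n. (?d i j m - ?d j i m) * \<phi> ch x [] [n, k, l]))"
    by (rule sum_contr_contr)
  have 2: "(\<Sum>l\<in>UNIV. \<Sum>i\<in>UNIV. T ch x [] [j, l] * ?G x l i * T ch x [] [i, k]) =
      ?C (\<lambda>l i. T ch x [] [j, l] * T ch x [] [i, k])"
    by (simp add: contr_def mult_ac)
  have 3: "trace (g ch) (T ch) x = ?C (\<lambda>i l. T ch x [] [i, l])"
    by (simp add: trace_def contr_def)
  have 4: "(\<Sum>b\<in>UNIV. \<Sum>i\<in>UNIV. \<Sum>a\<in>UNIV. \<Sum>l\<in>UNIV. \<Sum>p\<in>UNIV. \<Sum>q\<in>UNIV.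
      T ch x [] [j, b] * T ch x [] [i, a] * ?G x i l * ?G x a p * \<psi> ch x [] [l, p, q, k] * ?G x b q) =
    ?C (\<lambda>i l. ?C (\<lambda>b q. T ch x [] [j, b] * ?C (\<lambda>a p. T ch x [] [i, a] * \<psi> ch x [] [l, p, q, k])))"
    by (rule sum_contr_contr_contr)
  note x = \<open>x \<in> chart_image ch\<close>
  show ?thesis
    unfolding U V 1 2 3 4 nabla_divergence[OF x] nabla_trace[OF x]
    using ricci_eq_contr[OF x, of j k] divergence_diff_trace[OF x, of j k] by linarith
qed

end
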